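(* Let $(X,d,\mu)$ be a quasi-metric-measure space and $\nu$ a measure (on the same $\sigma$-algebra as $\mu$) such that $\nu\le C\mu$ for some $C\in(0,\infty)$. Assume that there are a symmetric quasi-metric $\rho$ on $X$ which is equivalent to $d$ and continuous on $X\times X$, a number $r_0\in(0,\infty)$ and a point $x_0\in X$ such that for all $r\in(0,r_0]$: (i) the family $\left\{\dfrac{\chi_{B_\rho(y,r)}(\cdot)}{\mu(B_\rho(\cdot,r))}\right\}_{y\in X}$ is equi-integrable with respect to $\nu$, and (ii) $\displaystyle\sup_{y\in X\setminus B_\rho(x_0,R)}\int_{B_\rho(y,r)}\frac{1}{\mu(B_\rho(x,r))}\,d\nu(x)\to0$ as $R\to\infty$. Then for any $\alpha,p\in(0,\infty)$, $q,r\in(0,\infty]$ and $\beta\in(0,\alpha)$ the embeddings $$M^\alpha_{p,q}(X,d,\mu)\hookrightarrow M^\beta_{p,r}(X,d,\nu),\qquad M^\alpha_{p,q}(X,d,\mu)\hookrightarrow N^\beta_{p,r}(X,d,\nu),$$ $$N^\alpha_{p,q}(X,d,\mu)\hookrightarrow M^\beta_{p,r}(X,d,\nu),\qquad N^\alpha_{p,q}(X,d,\mu)\hookrightarrow N^\beta_{p,r}(X,d,\nu)$$ are compact. In particular (with $\nu\le C\mu$), these embeddings are compact whenever $(X,d)$ is totally bounded. On the other hand, if $(X,d,\mu)$ is a quasi-metric-measure space, $\nu=\mu$, there exists $\delta_0\in(0,\infty)$ such that $\mu$ is $(C_d,\delta)$-doubling for every $\delta\in(0,\delta_0]$, and any one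 of the four embeddings above is compact for some $p,\beta\in(0,\infty)$, $q,r\in(0,\infty]$, and $\alpha\in(0,\infty)$ with $\alpha\preceq_q\mathrm{ind}(X,d)$, then $(X,d)$ is totally bounded.
   Context: A quasi-metric space $(X,d)$ is a set $X$ with at least two elements and a function $d:X\times X\to[0,\infty)$ for which there are constants $C_0,C_1\in(0,\infty)$ such that for all $x,y,z\in X$: $d(x,y)=0$ iff $x=y$; $d(y,x)\le C_0 d(x,y)$; $d(x,y)\le C_1\max\{d(x,z),d(z,y)\}$ (symmetry is not required). $C_d:=\sup\frac{d(x,y)}{\max\{d(x,z),d(z,y)\}}\in[1,\infty)$, the supremum over all $x,y,z\in X$ not all equal. Balls are $B_d(x,r):=\{y\in X:d(x,y)<r\}$. The topology $\tau_d$ consists of all $\mathcal O\subseteq X$ such that for each $x\in\mathcal O$ there is $r>0$ with $B_d(x,r)\subseteq\mathcal O$; continuity of $\rho$ refers to $\tau_d\times\tau_d$. A quasi-metric-measure space $(X,d,\mu)$ is a quasi-metric space with a nonnegative measure $\mu$ on a $\sigma$-algebra containing the Borel sets of $\tau_d$, such that all $d$-balls are measurable and $\mu(B_d(x,r))\in(0,\infty)$ for all $x\in X$, $r\in(0,\infty)$. $(X,d)$ is totally bounded if for every $\varepsilon>0$ it is covered by finitely many balls $B_d(x_i,\varepsilon)$. $\mu$ is $(c,\delta)$-doubling if there is $C(\delta)\in[1,\infty)$ with $\mu(B_d(x,c\delta))\le C(\delta)\mu(B_d(x,\delta))$ for all $x\in X$. A family $\mathcal G$ is equi-integrable with respect to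 $\nu$ if for every $\varepsilon>0$ there is $\delta>0$ such that $\sup_{f\in\mathcal G}\int_A|f|\,d\nu<\varepsilon$ for every measurable $A$ with $\nu(A)<\delta$. A supremum over the empty set in (ii) is $0$. Quasi-metrics $d,\rho$ are equivalent ($\rho\approx d$) if $\kappa^{-1}\rho\le d\le\kappa\rho$ on $X\times X$ for some constant $\kappa>0$. $\mathrm{ind}(X,d):=\sup_{\rho\approx d}(\log_2C_\rho)^{-1}\in(0,\infty]$ (with $1/0:=\infty$). The notation $\alpha\preceq_q\mathrm{ind}(X,d)$ means $\alpha\le\mathrm{ind}(X,d)$, where $\alpha=\mathrm{ind}(X,d)$ is permitted only when $q=\infty$ and the supremum defining $\mathrm{ind}(X,d)$ is attained. For a nonnegative Borel measure $m$ on $(X,d)$ (here $m=\mu$ or $\nu$), $\alpha\in(0,\infty)$ and measurable $u:X\to\mathbb R$, $\mathbb D^\alpha_{d,m}(u)$ is the set of sequences $\vec g=\{g_k\}_{k\in\mathbb Z}$ of nonnegative measurable functions on $X$ for which there is a measurable $E$ with $m(E)=0$ and $|u(x)-u(y)|\le[d(x,y)]^\alpha(g_k(x)+g_k(y))$ for all $k\in\mathbb Z$ and $x,y\in X\setminus E$ with $2^{-k-1}\le d(x,y)<2^{-k}$. The Hajłasz–Triebel–Lizorkin space $M^\alpha_{p,q}(X,d,m)$ is the set of $u\in L^p(X,m)$ with finite (quasi-)norm $\|u\|_{L^p(X,m)}+\inf_{\vec g\in\mathbb D^\alpha_{d,m}(u)}\big\|\,\|\{g_k\}_k\|_{\ell^q(\mathbb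 Z)}\big\|_{L^p(X,m)}$; the Hajłasz–Besov space $N^\alpha_{p,q}(X,d,m)$ is the set of $u\in L^p(X,m)$ with finite (quasi-)norm $\|u\|_{L^p(X,m)}+\inf_{\vec g\in\mathbb D^\alpha_{d,m}(u)}\big\|\{\|g_k\|_{L^p(X,m)}\}_k\big\|_{\ell^q(\mathbb Z)}$. An embedding is compact if the natural map (identity on functions) is well defined and maps bounded sets to totally bounded sets. *)

theory Defs
  imports "HOL-Analysis.Analysis"
begin

text \<open>
  The ambient set \<open>X\<close> is a carrier inside the type \<open>'a\<close>; values of a quasi-metric outside
  \<open>X \<times> X\<close> are irrelevant. A measure on \<open>X\<close> is a value of type \<open>'a measure\<close> with
  \<open>space \<mu> = X\<close>.
\<close>

section \<open>Quasi-metric spaces\<close>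

definition quasi_metric :: "'a set \<Rightarrow> ('a \<Rightarrow> 'a \<Rightarrow> real) \<Rightarrow> bool" where
  "quasi_metric X d \<longleftrightarrow>
     (\<exists>x\<in>X. \<exists>y\<in>X. x \<noteq> y) \<and>
     (\<forall>x\<in>X. \<forall>y\<in>X. 0 \<le> d x y) \<and>
     (\<forall>x\<in>X. \<forall>y\<in>X. d x y = 0 \<longleftrightarrow> x = y) \<and>
     (\<exists>C0>0. \<forall>x\<in>X. \<forall>y\<in>X. d y x \<le> C0 * d x y) \<and>
     (\<exists>C1>0. \<forall>x\<in>X. \<forall>y\<in>X. \<forall>z\<in>X. d x y \<le> C1 * max (d x z) (d z y))"

text \<open>The optimal constant \<open>C\<^sub>d\<close>. For a quasi-metric the set below is nonempty and bounded above.\<close>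

definition qm_const :: "'a set \<Rightarrow> ('a \<Rightarrow> 'a \<Rightarrow> real) \<Rightarrow> real" where
  "qm_const X d =
     Sup {d x y / max (d x z) (d z y) | x y z. x \<in> X \<and> y \<in> X \<and> z \<in> X \<and> \<not> (x = y \<and> y = z)}"

definition qm_ball :: "'a set \<Rightarrow> ('a \<Rightarrow> 'a \<Rightarrow> real) \<Rightarrow> 'a \<Rightarrow> real \<Rightarrow> 'a set" where
  "qm_ball X d x r = {y \<in> X. d x y < r}"

definition qm_topology :: "'a set \<Rightarrow> ('a \<Rightarrow> 'a \<Rightarrow> real) \<Rightarrow> 'a topology" where
  "qm_topology X d = topology (\<lambda>U. U \<subseteq> X \<and> (\<forall>x\<in>U. \<exists>r>0. qm_ball X d x r \<subseteq> U))"

lemma istopology_qm: "istopology (\<lambda>U. U \<subseteq> X \<and> (\<forall>x\<in>U. \<exists>r>0. qm_ball X d x r \<subseteq> U))"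
  unfolding istopology_def
proof (intro conjI allI impI)
  fix S T
  assume S: "S \<subseteq> X \<and> (\<forall>x\<in>S. \<exists>r>0. qm_ball X d x r \<subseteq> S)"
    and T: "T \<subseteq> X \<and> (\<forall>x\<in>T. \<exists>r>0. qm_ball X d x r \<subseteq> T)"
  show "S \<inter> T \<subseteq> X" using S by blast
  show "\<forall>x\<in>S \<inter> T. \<exists>r>0. qm_ball X d x r \<subseteq> S \<inter> T"
  proof
    fix x assume x: "x \<in> S \<inter> T"
    obtain r1 where r1: "r1 > 0" "qm_ball X d x r1 \<subseteq> S" using S x by (metis IntD1)
    obtain r2 where r2: "r2 > 0" "qm_ball X d x r2 \<subseteq> T" using T x by (metis IntD2)
    have "qm_ball X d x (min r1 r2) \<subseteq> qm_ball X d x r1 \<inter> qm_ball X d x r2"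
      by (auto simp: qm_ball_def)
    then have "qm_ball X d x (min r1 r2) \<subseteq> S \<inter> T" using r1(2) r2(2) by (meson Int_mono subset_trans)
    then show "\<exists>r>0. qm_ball X d x r \<subseteq> S \<inter> T" using r1(1) r2(1) by (metis min_less_iff_conj)
  qed
next
  fix K
  assume K: "\<forall>S\<in>K. S \<subseteq> X \<and> (\<forall>x\<in>S. \<exists>r>0. qm_ball X d x r \<subseteq> S)"
  show "\<Union>K \<subseteq> X" using K by (meson Union_least)
  show "\<forall>x\<in>\<Union>K. \<exists>r>0. qm_ball X d x r \<subseteq> \<Union>K"
  proof
    fix x assume "x \<in> \<Union>K"
    then obtain S where S: "S \<in> K" "x \<in> S" by (rule UnionE)
    obtain r where "r > 0" "qm_ball X d x r \<subseteq> S" using K S by metis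
    then show "\<exists>r>0. qm_ball X d x r \<subseteq> \<Union>K" using S(1) by (meson Union_upper subset_trans)
  qed
qed

lemma openin_qm_topology:
  "openin (qm_topology X d) U \<longleftrightarrow> U \<subseteq> X \<and> (\<forall>x\<in>U. \<exists>r>0. qm_ball X d x r \<subseteq> U)"
  by (simp only: qm_topology_def topology_inverse'[OF istopology_qm])

definition qm_totally_bounded :: "'a set \<Rightarrow> ('a \<Rightarrow> 'a \<Rightarrow> real) \<Rightarrow> bool" where
  "qm_totally_bounded X d \<longleftrightarrow>
     (\<forall>\<epsilon>>0. \<exists>F. finite F \<and> F \<subseteq> X \<and> X \<subseteq> (\<Union>x\<in>F. qm_ball X d x \<epsilon>))"

definition qm_equivalent :: "'a set \<Rightarrow> ('a \<Rightarrow> 'a \<Rightarrow> real) \<Rightarrow> ('a \<Rightarrow> 'a \<Rightarrow> real) \<Rightarrow> bool" where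
  "qm_equivalent X \<rho> d \<longleftrightarrow>
     (\<exists>\<kappa>>0. \<forall>x\<in>X. \<forall>y\<in>X. inverse \<kappa> * \<rho> x y \<le> d x y \<and> d x y \<le> \<kappa> * \<rho> x y)"

section \<open>The lower smoothness index\<close>

text \<open>\<open>(log\<^sub>2 C\<^sub>\<rho>)\<inverse>\<close> as an extended number; \<open>C\<^sub>\<rho> \<ge> 1\<close>, and \<open>inverse 0 = top\<close> in \<open>ennreal\<close>.\<close>

definition qm_inv_log :: "'a set \<Rightarrow> ('a \<Rightarrow> 'a \<Rightarrow> real) \<Rightarrow> ennreal" where
  "qm_inv_log X \<rho> = inverse (ennreal (log 2 (qm_const X \<rho>)))"

definition qm_index :: "'a set \<Rightarrow> ('a \<Rightarrow> 'a \<Rightarrow> real) \<Rightarrow> ennreal" where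
  "qm_index X d = (SUP \<rho> \<in> {\<rho>. quasi_metric X \<rho> \<and> qm_equivalent X \<rho> d}. qm_inv_log X \<rho>)"

definition qm_index_attained :: "'a set \<Rightarrow> ('a \<Rightarrow> 'a \<Rightarrow> real) \<Rightarrow> bool" where
  "qm_index_attained X d \<longleftrightarrow>
     (\<exists>\<rho>. quasi_metric X \<rho> \<and> qm_equivalent X \<rho> d \<and> qm_inv_log X \<rho> = qm_index X d)"

definition preceq_index :: "real \<Rightarrow> ennreal \<Rightarrow> 'a set \<Rightarrow> ('a \<Rightarrow> 'a \<Rightarrow> real) \<Rightarrow> bool" where
  "preceq_index \<alpha> q X d \<longleftrightarrow>
     ennreal \<alpha> \<le> qm_index X d \<and>
     (ennreal \<alpha> = qm_index X d \<longrightarrow> q = top \<and> qm_index_attained X d)"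

section \<open>Quasi-metric-measure spaces\<close>

definition quasi_metric_measure_space :: "('a \<Rightarrow> 'a \<Rightarrow> real) \<Rightarrow> 'a measure \<Rightarrow> bool" where
  "quasi_metric_measure_space d \<mu> \<longleftrightarrow>
     quasi_metric (space \<mu>) d \<and>
     sigma_sets (space \<mu>) {U. openin (qm_topology (space \<mu>) d) U} \<subseteq> sets \<mu> \<and>
     (\<forall>x\<in>space \<mu>. \<forall>r>0. qm_ball (space \<mu>) d x r \<in> sets \<mu> \<and>
        0 < emeasure \<mu> (qm_ball (space \<mu>) d x r) \<and> emeasure \<mu> (qm_ball (space \<mu>) d x r) < top)"

definition doubling :: "('a \<Rightarrow> 'a \<Rightarrow> real) \<Rightarrow> 'a measure \<Rightarrow> real \<Rightarrow> real \<Rightarrow> bool" where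
  "doubling d \<mu> c \<delta> \<longleftrightarrow>
     (\<exists>C\<ge>1. \<forall>x\<in>space \<mu>. emeasure \<mu> (qm_ball (space \<mu>) d x (c * \<delta>))
                            \<le> ennreal C * emeasure \<mu> (qm_ball (space \<mu>) d x \<delta>))"

definition equi_integrable :: "'a measure \<Rightarrow> ('a \<Rightarrow> real) set \<Rightarrow> bool" where
  "equi_integrable \<nu> G \<longleftrightarrow>
     (\<forall>\<epsilon>>0. \<exists>\<delta>>0. \<forall>A\<in>sets \<nu>. emeasure \<nu> A < ennreal \<delta> \<longrightarrow>
        (SUP f\<in>G. \<integral>\<^sup>+x\<in>A. ennreal \<bar>f x\<bar> \<partial>\<nu>) < ennreal \<epsilon>)"

section \<open>Hajlasz--Triebel--Lizorkin and Hajlasz--Besov spaces\<close>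

text \<open>Powers with positive exponent on \<open>[0,\<infinity>]\<close>.\<close>

definition ennreal_powr :: "ennreal \<Rightarrow> real \<Rightarrow> ennreal" where
  "ennreal_powr x a = (if x = top then top else ennreal (enn2real x powr a))"

definition Lp_norm :: "'a measure \<Rightarrow> real \<Rightarrow> ('a \<Rightarrow> ennreal) \<Rightarrow> ennreal" where
  "Lp_norm m p f = ennreal_powr (\<integral>\<^sup>+x. ennreal_powr (f x) p \<partial>m) (1 / p)"

text \<open>The exponent \<open>q\<close> ranges over \<open>(0,\<infinity>]\<close>; \<open>q = top\<close> gives the supremum.\<close>

definition lq_norm :: "ennreal \<Rightarrow> (int \<Rightarrow> ennreal) \<Rightarrow> ennreal" where
  "lq_norm q a =
     (if q = top then (SUP k. a k)
      else ennreal_powr (\<integral>\<^sup>+k. ennreal_powr (a k) (enn2real q) \<partial>count_space UNIV) (1 / enn2real q))"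

definition frac_gradients ::
  "('a \<Rightarrow> 'a \<Rightarrow> real) \<Rightarrow> 'a measure \<Rightarrow> real \<Rightarrow> ('a \<Rightarrow> real) \<Rightarrow> (int \<Rightarrow> 'a \<Rightarrow> real) set" where
  "frac_gradients d m \<alpha> u =
     {g. (\<forall>k. g k \<in> borel_measurable m \<and> (\<forall>x\<in>space m. 0 \<le> g k x)) \<and>
         (\<exists>E\<in>null_sets m. \<forall>k. \<forall>x\<in>space m - E. \<forall>y\<in>space m - E.
            2 powi (- k - 1) \<le> d x y \<and> d x y < 2 powi (- k) \<longrightarrow>
            \<bar>u x - u y\<bar> \<le> d x y powr \<alpha> * (g k x + g k y))}"

text \<open>
  The quasi-norms take the value \<open>top\<close> outside the space; note that \<open>Inf {} = top\<close>. Elements of the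
  spaces are represented by functions, two functions representing the same element iff they agree
  almost everywhere.
\<close>

definition hajlasz_TL_norm ::
  "('a \<Rightarrow> 'a \<Rightarrow> real) \<Rightarrow> real \<Rightarrow> real \<Rightarrow> ennreal \<Rightarrow> 'a measure \<Rightarrow> ('a \<Rightarrow> real) \<Rightarrow> ennreal" where
  "hajlasz_TL_norm d \<alpha> p q m u =
     Lp_norm m p (\<lambda>x. ennreal \<bar>u x\<bar>) +
     (INF g\<in>frac_gradients d m \<alpha> u. Lp_norm m p (\<lambda>x. lq_norm q (\<lambda>k. ennreal (g k x))))"

definition hajlasz_Besov_norm ::
  "('a \<Rightarrow> 'a \<Rightarrow> real) \<Rightarrow> real \<Rightarrow> real \<Rightarrow> ennreal \<Rightarrow> 'a measure \<Rightarrow> ('a \<Rightarrow> real) \<Rightarrow> ennreal" where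
  "hajlasz_Besov_norm d \<alpha> p q m u =
     Lp_norm m p (\<lambda>x. ennreal \<bar>u x\<bar>) +
     (INF g\<in>frac_gradients d m \<alpha> u. lq_norm q (\<lambda>k. Lp_norm m p (\<lambda>x. ennreal (g k x))))"

definition finite_norm_space ::
  "'a measure \<Rightarrow> ('a measure \<Rightarrow> ('a \<Rightarrow> real) \<Rightarrow> ennreal) \<Rightarrow> ('a \<Rightarrow> real) set" where
  "finite_norm_space m n = {u \<in> borel_measurable m. n m u < top}"

text \<open>
  Compactness of the natural map from the space over \<open>\<mu>\<close> with quasi-norm \<open>n\<^sub>1\<close> to the space over
  \<open>\<nu>\<close> with quasi-norm \<open>n\<^sub>2\<close>. The first two conjuncts say that it is well defined on classes of
  almost everywhere equal functions.
\<close>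

definition compact_embedding ::
  "'a measure \<Rightarrow> ('a measure \<Rightarrow> ('a \<Rightarrow> real) \<Rightarrow> ennreal) \<Rightarrow>
   'a measure \<Rightarrow> ('a measure \<Rightarrow> ('a \<Rightarrow> real) \<Rightarrow> ennreal) \<Rightarrow> bool" where
  "compact_embedding \<mu> n1 \<nu> n2 \<longleftrightarrow>
     finite_norm_space \<mu> n1 \<subseteq> finite_norm_space \<nu> n2 \<and>
     (\<forall>u\<in>finite_norm_space \<mu> n1. \<forall>v\<in>finite_norm_space \<mu> n1.
        (AE x in \<mu>. u x = v x) \<longrightarrow> (AE x in \<nu>. u x = v x)) \<and>
     (\<forall>B\<subseteq>finite_norm_space \<mu> n1. (\<exists>K::real. \<forall>u\<in>B. n1 \<mu> u \<le> ennreal K) \<longrightarrow>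
        (\<forall>\<epsilon>>0. \<exists>F. finite F \<and> F \<subseteq> finite_norm_space \<nu> n2 \<and>
           (\<forall>u\<in>B. \<exists>v\<in>F. n2 \<nu> (\<lambda>x. u x - v x) < ennreal \<epsilon>)))"

end

theory Submission
  imports Defs
begin

text \<open>Write \<open>x\<^sup>p\<close> for \<^const>\<open>ennreal_powr\<close>. All embeddings factor through one coarse class:
  functions \<open>u\<close> in \<open>L\<^sup>p(\<mu>)\<close> with a fractional gradient \<open>g\<close> each of whose levels \<open>g\<^sub>k\<close> is bounded in
  \<open>L\<^sup>p(\<mu>)\<close> (\<open>weak_hajlasz_ball\<close>). Bounded sets of the source spaces lie in it, whatever \<open>q\<close> is.
  On the target side the gap between \<open>\<beta>\<close> and \<open>\<alpha>\<close> pays for everything: at levels \<open>k \<ge> N\<close> the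
  sequence \<open>2\<^bsup>-k(\<alpha>-\<beta>)\<^esup> g\<^sub>k\<close> is a gradient of order \<open>\<beta>\<close> and contributes a geometric tail, while at
  levels \<open>k < N\<close> a multiple of \<open>\<bar>u\<bar>\<close> is a gradient. Hence inside the coarse class a small \<open>L\<^sup>p(\<nu>)\<close>
  norm forces a small target norm (\<open>weak_small_Lp_imp_small_norm\<close>), and it remains to find finite
  nets of the coarse class in \<open>L\<^sup>p(\<nu>)\<close>.

  As \<open>p < 1\<close> is allowed, \<open>u\<close> may fail to be locally integrable, and the net is built from values of
  \<open>u\<close> at good points instead of averages. The function
  \<open>G = 2\<^sup>p \<Sum>\<^bsub>k\<ge>N\<^esub> 2\<^bsup>-k\<alpha>p\<^esup> g\<^sub>k\<^sup>p\<close> satisfies \<open>\<bar>u x - u y\<bar>\<^sup>p \<le> G x + G y\<close> for almost all \<open>x, y\<close> with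
  \<open>d x y < 2\<^bsup>-N\<^esup>\<close>, and \<open>\<integral>G d\<mu>\<close> is as small as desired, uniformly in \<open>u\<close>. On a cell \<open>Q\<close> of small
  diameter, \<open>u\<close> is therefore close to its value at a point where \<open>G\<close> is at most its \<open>\<mu>\<close>-average
  over \<open>Q\<close>. Finitely many disjoint cells and the rounded constants on them give a finite code, and
  functions with equal codes are close on the union of the cells (\<open>finite_net_of_cells\<close>).

  Thus compactness follows once the \<open>L\<^sup>p(\<nu>)\<close> mass outside suitable finite families of cells is
  uniformly small (\<open>uniformly_tight_cells\<close>). If the space is totally bounded, finitely many cells
  cover it and nothing is left outside. Under conditions (i) and (ii), \<open>\<bar>u x\<bar>\<^sup>p\<close> is at most \<open>2\<^sup>p\<close> times
  the sum of \<open>G x\<close> and the average of \<open>G + \<bar>u\<bar>\<^sup>p\<close> over \<open>B\<^sub>\<rho>(x, r)\<close>; after Tonelli's theorem the mass on a set \<open>Z\<close> is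
  controlled by the supremum over \<open>y\<close> of \<open>\<integral>\<^bsub>Z \<inter> B\<^sub>\<rho>(y,r)\<^esub> 1 / \<mu>(B\<^sub>\<rho>(x,r)) d\<nu>(x)\<close>. For \<open>y\<close> far away
  this is small by (ii), and for the remaining \<open>y\<close> by (i), as \<open>Z\<close> then only matters inside one
  fixed ball, where its measure tends to zero (\<open>tight_if_kernel_condition\<close>).

  For the converse, a space that is not totally bounded contains an infinite separated set. The
  index condition provides an equivalent quasi-metric \<open>\<rho>\<close> and an exponent \<open>\<gamma> \<ge> \<alpha>\<close> with
  \<open>C\<^sub>\<rho>\<^sup>\<gamma> \<le> 2\<close>. By Frink's chain argument the infimum of \<open>\<Sum> \<rho>(x\<^sub>i, x\<^bsub>i+1\<^esub>)\<^sup>\<gamma>\<close> over chains is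
  comparable to \<open>\<rho>\<^sup>\<gamma>\<close>, and truncating it gives functions that are Hoelder continuous of order \<open>\<gamma>\<close>,
  equal to 1 on \<open>B\<^sub>d(x, \<delta>)\<close> and to 0 outside \<open>B\<^sub>d(x, C\<^sub>d \<delta>)\<close> (\<open>ex_holder_bump\<close>). Normalised in \<open>L\<^sup>p\<close>,
  such bumps at the separated points are bounded in the source space, because one application of the
  doubling condition compares the two balls, and they keep a fixed \<open>L\<^sup>p\<close> distance from each other.\<close>

section \<open>Powers, \<open>L\<^sup>p\<close> and \<open>\<ell>\<^sup>q\<close> quasi-norms with values in \<open>[0,\<infinity>]\<close>\<close>

lemma ennreal_powr_ennreal: "0 \<le> x \<Longrightarrow> ennreal_powr (ennreal x) a = ennreal (x powr a)"
  by (simp add: ennreal_powr_def)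

lemma ennreal_powr_top [simp]: "ennreal_powr top a = top"
  by (simp add: ennreal_powr_def)

lemma ennreal_powr_0 [simp]: "ennreal_powr 0 a = 0"
  by (simp add: ennreal_powr_def)

lemma ennreal_powr_eq_top_iff [simp]: "ennreal_powr x a = top \<longleftrightarrow> x = top"
  by (simp add: ennreal_powr_def)

lemma ennreal_powr_less_top_iff [simp]: "ennreal_powr x a < top \<longleftrightarrow> x < top"
  by (simp add: less_top[symmetric])

lemma ennreal_powr_mono:
  assumes "x \<le> y" "0 \<le> a"
  shows "ennreal_powr x a \<le> ennreal_powr y a"
proof (cases y)
  case (real s)
  then obtain t where "x = ennreal t" "0 \<le> t"
    using assms by (cases x) (auto simp: top_unique)
  then show ?thesis
    using real assms by (simp add: powr_mono2 ennreal_powr_ennreal)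
qed auto

lemma ennreal_powr_powr: "ennreal_powr (ennreal_powr x a) b = ennreal_powr x (a * b)"
  by (cases x) (auto simp: powr_powr ennreal_powr_ennreal)

lemma ennreal_powr_1 [simp]: "ennreal_powr x 1 = x"
  by (cases x) (auto simp: ennreal_powr_ennreal)

lemma ennreal_powr_inverse [simp]:
  assumes "0 < a"
  shows "ennreal_powr (ennreal_powr x a) (1 / a) = x" "ennreal_powr (ennreal_powr x (1 / a)) a = x"
  using assms by (simp_all add: ennreal_powr_powr)

lemma ennreal_powr_le_iff:
  assumes "0 < a"
  shows "ennreal_powr x a \<le> ennreal_powr y a \<longleftrightarrow> x \<le> y"
proof
  assume "ennreal_powr x a \<le> ennreal_powr y a"
  then have "ennreal_powr (ennreal_powr x a) (1 / a) \<le> ennreal_powr (ennreal_powr y a) (1 / a)"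
    by (rule ennreal_powr_mono) (use assms in auto)
  then show "x \<le> y" by (simp only: ennreal_powr_inverse[OF assms])
qed (use assms in \<open>auto intro: ennreal_powr_mono\<close>)

lemma ennreal_powr_mult:
  assumes "0 < a"
  shows "ennreal_powr (x * y) a = ennreal_powr x a * ennreal_powr y a"
proof -
  have *: "ennreal_powr (top * y) a = top * ennreal_powr y a" for y
    using ennreal_powr_le_iff[OF assms, of y 0] by (cases "y = 0") (auto simp: ennreal_top_mult)
  show ?thesis
  proof (cases "x = top \<or> y = top")
    case True
    then show ?thesis using *[of y] *[of x] by (auto simp: mult.commute)
  next
    case False
    then obtain s t where "x = ennreal s" "y = ennreal t" "0 \<le> s" "0 \<le> t"
      by (cases x; cases y) auto
    then show ?thesis
      by (simp add: ennreal_mult'[symmetric] powr_mult ennreal_powr_ennreal)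
  qed
qed

lemma ennreal_powr_add_le:
  assumes "0 \<le> a"
  shows "ennreal_powr (x + y) a \<le> ennreal (2 powr a) * (ennreal_powr x a + ennreal_powr y a)"
proof (cases "x = top \<or> y = top")
  case True
  then show ?thesis by (auto simp: ennreal_mult_top)
next
  case False
  then obtain s t where st: "x = ennreal s" "y = ennreal t" "0 \<le> s" "0 \<le> t"
    by (cases x; cases y) auto
  have "(s + t) powr a \<le> (2 * max s t) powr a"
    using st assms by (intro powr_mono2) auto
  also have "\<dots> = 2 powr a * max s t powr a"
    using st by (simp add: powr_mult)
  also have "\<dots> \<le> 2 powr a * (s powr a + t powr a)"
    by (intro mult_left_mono) (auto simp: max_def)
  finally show ?thesis
    using st by (simp add: ennreal_powr_ennreal ennreal_plus[symmetric] ennreal_mult[symmetric] del: ennreal_plus)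
qed

lemma measurable_ennreal_powr [measurable]:
  assumes [measurable]: "f \<in> borel_measurable M"
  shows "(\<lambda>x. ennreal_powr (f x) a) \<in> borel_measurable M"
  unfolding ennreal_powr_def by measurable

abbreviation abs_powr :: "real \<Rightarrow> real \<Rightarrow> ennreal" where
  "abs_powr t p \<equiv> ennreal_powr (ennreal \<bar>t\<bar>) p"

abbreviation Lp_mass :: "'a measure \<Rightarrow> real \<Rightarrow> ('a \<Rightarrow> real) \<Rightarrow> ennreal" where
  "Lp_mass m p u \<equiv> \<integral>\<^sup>+x. abs_powr (u x) p \<partial>m"

abbreviation geometric_sum :: "real \<Rightarrow> ennreal" where
  "geometric_sum c \<equiv> \<Sum>n. ennreal (2 powr (- c * real n))"

lemma Lp_norm_powr:
  "0 < p \<Longrightarrow> ennreal_powr (Lp_norm m p f) p = (\<integral>\<^sup>+x. ennreal_powr (f x) p \<partial>m)"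
  by (simp add: Lp_norm_def)

lemma Lp_norm_mono: "0 < p \<Longrightarrow> (\<And>x. x \<in> space m \<Longrightarrow> f x \<le> g x) \<Longrightarrow> Lp_norm m p f \<le> Lp_norm m p g"
  unfolding Lp_norm_def by (intro ennreal_powr_mono nn_integral_mono) auto

lemma Lp_norm_cmult:
  assumes "0 < p" "f \<in> borel_measurable m"
  shows "Lp_norm m p (\<lambda>x. c * f x) = c * Lp_norm m p f"
proof -
  have "(\<integral>\<^sup>+x. ennreal_powr (c * f x) p \<partial>m) = ennreal_powr c p * (\<integral>\<^sup>+x. ennreal_powr (f x) p \<partial>m)"
    using assms by (simp add: ennreal_powr_mult nn_integral_cmult)
  then show ?thesis
    using assms by (simp add: Lp_norm_def ennreal_powr_mult)
qed

lemma lq_norm_mono: "(\<And>k. a k \<le> b k) \<Longrightarrow> lq_norm q a \<le> lq_norm q b"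
  unfolding lq_norm_def by (auto intro!: SUP_mono ennreal_powr_mono nn_integral_mono)

lemma enn2real_pos: "0 < q \<Longrightarrow> q \<noteq> top \<Longrightarrow> 0 < enn2real q"
  by (simp add: enn2real_positive_iff less_top)

lemma lq_norm_cmult:
  assumes "0 < q"
  shows "lq_norm q (\<lambda>k. c * a k) = c * lq_norm q a"
proof (cases "q = top")
  case True
  then show ?thesis by (simp add: lq_norm_def SUP_mult_left_ennreal)
next
  case False
  then have "0 < enn2real q" using assms by (rule enn2real_pos[rotated])
  then show ?thesis
    using False by (simp add: lq_norm_def ennreal_powr_mult nn_integral_cmult)
qed

lemma lq_norm_ge_component:
  assumes "0 < q"
  shows "a k \<le> lq_norm q a"
proof (cases "q = top")
  case True
  then show ?thesis by (auto simp: lq_norm_def intro: SUP_upper)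
next
  case False
  then have q: "0 < enn2real q" using assms by (rule enn2real_pos[rotated])
  have "ennreal_powr (a k) (enn2real q)
      = (\<integral>\<^sup>+j. ennreal_powr (a k) (enn2real q) * indicator {k} j \<partial>count_space UNIV)"
    by (simp add: nn_integral_cmult_indicator)
  also have "\<dots> \<le> (\<integral>\<^sup>+j. ennreal_powr (a j) (enn2real q) \<partial>count_space UNIV)"
    by (intro nn_integral_mono) (auto split: split_indicator)
  finally have "ennreal_powr (ennreal_powr (a k) (enn2real q)) (1 / enn2real q) \<le> lq_norm q a"
    using False q by (simp add: lq_norm_def ennreal_powr_mono del: ennreal_powr_inverse)
  then show ?thesis using q by simp
qed

text \<open>The weights for which a pointwise domination \<open>g\<^sub>k \<le> weight k * H\<close> turns into a norm bound: at
  large scales (\<open>k \<le> 0\<close>) gradients decay like \<open>2\<^bsup>ak\<^esup>\<close>, at small scales like \<open>2\<^bsup>-bk\<^esup>\<close>.\<close>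

definition geometric_weight :: "real \<Rightarrow> real \<Rightarrow> int \<Rightarrow> real" where
  "geometric_weight a b k = (if k \<le> 0 then 2 powr (a * k) else 2 powr (- b * k))"

lemma geometric_weight_pos [simp]: "0 < geometric_weight a b k"
  by (simp add: geometric_weight_def)

lemma suminf_powr_less_top:
  assumes "0 < c"
  shows "geometric_sum c < top"
proof -
  have *: "2 powr (- c * real n) = (2 powr (- c)) ^ n" for n
    by (simp add: powr_realpow[symmetric] powr_powr)
  have "2 powr (- c) < (1::real)"
    using assms by (simp add: powr_less_one)
  then show ?thesis
    unfolding * by (subst suminf_ennreal2) (auto intro!: summable_geometric)
qed

lemma nn_integral_count_space_int:
  fixes f :: "int \<Rightarrow> ennreal"
  shows "(\<integral>\<^sup>+k. f k \<partial>count_space UNIV) \<le> (\<Sum>n. f (- int n)) + (\<Sum>n. f (int n))"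
proof -
  have "(\<integral>\<^sup>+k. f k \<partial>count_space UNIV)
      \<le> (\<integral>\<^sup>+k. f k * indicator {..0} k + f k * indicator {0..} k \<partial>count_space UNIV)"
    by (intro nn_integral_mono) (auto split: split_indicator)
  also have "\<dots> = (\<integral>\<^sup>+k. f k * indicator {..0} k \<partial>count_space UNIV)
                  + (\<integral>\<^sup>+k. f k * indicator {0..} k \<partial>count_space UNIV)"
    by (intro nn_integral_add) auto
  also have "(\<integral>\<^sup>+k. f k * indicator {..0} k \<partial>count_space UNIV) = (\<integral>\<^sup>+k. f k \<partial>count_space {..0})"
    by (simp add: nn_integral_count_space_indicator)
  also have "\<dots> = (\<integral>\<^sup>+n. f (- int n) \<partial>count_space UNIV)"
    by (intro nn_integral_bij_count_space[symmetric] bij_betwI[where g="\<lambda>k. nat (- k)"]) auto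
  also have "(\<integral>\<^sup>+k. f k * indicator {0..} k \<partial>count_space UNIV) = (\<integral>\<^sup>+k. f k \<partial>count_space {0..})"
    by (simp add: nn_integral_count_space_indicator)
  also have "\<dots> = (\<integral>\<^sup>+n. f (int n) \<partial>count_space UNIV)"
    by (intro nn_integral_bij_count_space[symmetric] bij_betwI[where g=nat]) auto
  finally show ?thesis by (simp add: nn_integral_count_space_nat)
qed

text \<open>Both halves are geometric series. The case \<open>b = 0\<close>, in which the small-scale weights are merely
  bounded, is what permits \<open>\<alpha> = ind(X, d)\<close> for \<open>q = \<infinity>\<close>.\<close>

lemma lq_norm_geometric_weight:
  assumes "0 < q" "0 < a" "0 \<le> b" "0 < b \<or> q = top"
  shows "lq_norm q (\<lambda>k. ennreal (geometric_weight a b k)) < top"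
proof (cases "q = top")
  case True
  have "geometric_weight a b k \<le> 1" for k
  proof -
    have "2 powr (a * k) \<le> 2 powr 0" if "k \<le> 0"
      using assms that by (intro powr_mono) (auto simp: mult_nonneg_nonpos)
    moreover have "2 powr (- b * k) \<le> 2 powr 0" if "k > 0"
      using assms that by (intro powr_mono) auto
    ultimately show ?thesis by (simp add: geometric_weight_def)
  qed
  then have "(SUP k. ennreal (geometric_weight a b k)) \<le> 1"
    by (intro SUP_least) (simp add: ennreal_le_1)
  also have "\<dots> < top" by simp
  finally show ?thesis
    using True by (simp add: lq_norm_def)
next
  case False
  define s where "s = enn2real q"
  have s: "0 < s" using assms False by (simp add: s_def enn2real_pos)
  have b: "0 < b" using assms False by auto
  have 1: "geometric_weight a b (- int n) powr s = 2 powr (- (a * s) * real n)" for n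
    by (simp add: geometric_weight_def powr_powr algebra_simps)
  have 2: "geometric_weight a b (int n) powr s = 2 powr (- (b * s) * real n)" for n
    by (cases n) (simp_all add: geometric_weight_def powr_powr algebra_simps)
  have "(\<integral>\<^sup>+k. ennreal_powr (ennreal (geometric_weight a b k)) s \<partial>count_space UNIV)
      \<le> geometric_sum (a * s) + geometric_sum (b * s)"
    using nn_integral_count_space_int[of "\<lambda>k. ennreal (geometric_weight a b k powr s)"]
    by (simp only: 1 2) (simp add: less_imp_le ennreal_powr_ennreal)
  also have "\<dots> < top"
    unfolding ennreal_add_less_top
    using suminf_powr_less_top[OF mult_pos_pos[OF assms(2) s]]
      suminf_powr_less_top[OF mult_pos_pos[OF b s]] by blast
  finally show ?thesis
    using False by (simp add: lq_norm_def s_def)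
qed

section \<open>The coarsest class of the scale\<close>

text \<open>For simple functions this is the hypothesis, level set by level set; then take suprema.\<close>

lemma nn_integral_le_cmult_measure:
  assumes sets: "sets \<nu> = sets \<mu>" and le: "\<forall>A\<in>sets \<mu>. emeasure \<nu> A \<le> C * emeasure \<mu> A"
  shows "(\<integral>\<^sup>+x. f x \<partial>\<nu>) \<le> C * (\<integral>\<^sup>+x. f x \<partial>\<mu>)"
  unfolding nn_integral_def[of \<nu> f]
proof (rule SUP_least)
  have space: "space \<nu> = space \<mu>"
    using sets by (rule sets_eq_imp_space_eq)
  fix g assume g: "g \<in> {g. simple_function \<nu> g \<and> g \<le> f}"
  then have sg: "simple_function \<mu> g"
    by (simp add: simple_function_def sets space)
  have "integral\<^sup>S \<nu> g \<le> (\<Sum>y\<in>g ` space \<mu>. C * (y * emeasure \<mu> (g -` {y} \<inter> space \<mu>)))"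
    unfolding simple_integral_def space
  proof (rule sum_mono)
    fix y
    have "g -` {y} \<inter> space \<mu> \<in> sets \<mu>"
      using sg by (rule simple_functionD)
    then show "y * emeasure \<nu> (g -` {y} \<inter> space \<mu>) \<le> C * (y * emeasure \<mu> (g -` {y} \<inter> space \<mu>))"
      using le mult_left_mono[of "emeasure \<nu> (g -` {y} \<inter> space \<mu>)"
          "C * emeasure \<mu> (g -` {y} \<inter> space \<mu>)" y]
      by (simp add: mult.left_commute)
  qed
  also have "\<dots> = C * integral\<^sup>S \<mu> g"
    by (simp add: simple_integral_def sum_distrib_left)
  also have "\<dots> \<le> C * (\<integral>\<^sup>+x. f x \<partial>\<mu>)"
    unfolding nn_integral_def using g sg by (intro mult_left_mono SUP_upper) auto
  finally show "integral\<^sup>S \<nu> g \<le> C * (\<integral>\<^sup>+x. f x \<partial>\<mu>)" .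
qed

lemma null_sets_le_cmult_measure:
  assumes "sets \<nu> = sets \<mu>" "\<forall>A\<in>sets \<mu>. emeasure \<nu> A \<le> C * emeasure \<mu> A"
  shows "null_sets \<mu> \<subseteq> null_sets \<nu>"
proof
  fix A assume "A \<in> null_sets \<mu>"
  then have "A \<in> sets \<nu>" "emeasure \<nu> A \<le> C * 0"
    using assms by (auto simp: null_sets_def)
  then show "A \<in> null_sets \<nu>" by (auto simp: null_sets_def)
qed

text \<open>This is a ball of the Besov-type class with \<open>q = \<infinity>\<close>, the largest of the scale. The bound \<open>M\<close> is
  on the integrals of \<open>p\<close>-th powers, which behave additively for every \<open>p > 0\<close>.\<close>

definition weak_hajlasz_ball ::
  "('a \<Rightarrow> 'a \<Rightarrow> real) \<Rightarrow> 'a measure \<Rightarrow> real \<Rightarrow> real \<Rightarrow> ennreal \<Rightarrow> ('a \<Rightarrow> real) set" where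
  "weak_hajlasz_ball d m \<alpha> p M =
     {u \<in> borel_measurable m.
        (Lp_mass m p u) \<le> M \<and>
        (\<exists>g\<in>frac_gradients d m \<alpha> u. \<forall>k. (\<integral>\<^sup>+x. ennreal_powr (ennreal (g k x)) p \<partial>m) \<le> M)}"

lemma Lp_norm_le_imp:
  assumes "0 < p" "Lp_norm m p f \<le> K"
  shows "(\<integral>\<^sup>+x. ennreal_powr (f x) p \<partial>m) \<le> ennreal_powr K p"
  using assms ennreal_powr_mono[of "Lp_norm m p f" K p] by (simp add: Lp_norm_powr)

lemma INF_le_imp_ex:
  fixes f :: "'b \<Rightarrow> ennreal"
  assumes "(INF g\<in>S. f g) \<le> ennreal K"
  shows "\<exists>g\<in>S. f g \<le> ennreal K + 1"
proof -
  have "(INF g\<in>S. f g) < ennreal K + 1"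
    using assms ennreal_add_left_cancel_less[of "ennreal K" 0 1] by (simp add: order_le_less_trans)
  then show ?thesis by (auto simp: INF_less_iff intro: less_imp_le)
qed

text \<open>Each component of a sequence is bounded by its \<open>\<ell>\<^sup>q\<close> quasi-norm. The summand 1 leaves room
  for a gradient that only nearly attains the infimum.\<close>

lemma TL_norm_imp_weak:
  assumes "0 < p" "0 < q" "u \<in> borel_measurable m" "hajlasz_TL_norm d \<alpha> p q m u \<le> ennreal K"
  shows "u \<in> weak_hajlasz_ball d m \<alpha> p (ennreal_powr (ennreal K + 1) p)"
proof -
  have 1: "Lp_norm m p (\<lambda>x. ennreal \<bar>u x\<bar>) \<le> ennreal K"
    and 2: "(INF g\<in>frac_gradients d m \<alpha> u. Lp_norm m p (\<lambda>x. lq_norm q (\<lambda>k. ennreal (g k x))))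
              \<le> ennreal K"
    using assms(4) unfolding hajlasz_TL_norm_def
    by (meson le_add1 le_add2 order_trans zero_le add_increasing add_increasing2 order_refl)+
  obtain g where g: "g \<in> frac_gradients d m \<alpha> u"
    "Lp_norm m p (\<lambda>x. lq_norm q (\<lambda>k. ennreal (g k x))) \<le> ennreal K + 1"
    using INF_le_imp_ex[OF 2] by blast
  have "Lp_norm m p (\<lambda>x. ennreal (g k x)) \<le> ennreal K + 1" for k
    using Lp_norm_mono[OF assms(1), of m "\<lambda>x. ennreal (g k x)"
        "\<lambda>x. lq_norm q (\<lambda>k. ennreal (g k x))"] g(2)
      lq_norm_ge_component[OF assms(2), of "\<lambda>k. ennreal (g k _)" k]
    by (meson order_trans)
  moreover have "Lp_norm m p (\<lambda>x. ennreal \<bar>u x\<bar>) \<le> ennreal K + 1"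
    using 1 by (rule order_trans) simp
  ultimately show ?thesis
    using g(1) assms by (auto simp: weak_hajlasz_ball_def intro!: Lp_norm_le_imp bexI[of _ g])
qed

lemma Besov_norm_imp_weak:
  assumes "0 < p" "0 < q" "u \<in> borel_measurable m" "hajlasz_Besov_norm d \<alpha> p q m u \<le> ennreal K"
  shows "u \<in> weak_hajlasz_ball d m \<alpha> p (ennreal_powr (ennreal K + 1) p)"
proof -
  have 1: "Lp_norm m p (\<lambda>x. ennreal \<bar>u x\<bar>) \<le> ennreal K"
    and 2: "(INF g\<in>frac_gradients d m \<alpha> u. lq_norm q (\<lambda>k. Lp_norm m p (\<lambda>x. ennreal (g k x))))
              \<le> ennreal K"
    using assms(4) unfolding hajlasz_Besov_norm_def
    by (meson le_add1 le_add2 order_trans zero_le add_increasing add_increasing2 order_refl)+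
  obtain g where g: "g \<in> frac_gradients d m \<alpha> u"
    "lq_norm q (\<lambda>k. Lp_norm m p (\<lambda>x. ennreal (g k x))) \<le> ennreal K + 1"
    using INF_le_imp_ex[OF 2] by blast
  have "Lp_norm m p (\<lambda>x. ennreal (g k x)) \<le> ennreal K + 1" for k
    using g(2) lq_norm_ge_component[OF assms(2), of "\<lambda>k. Lp_norm m p (\<lambda>x. ennreal (g k x))" k]
    by (meson order_trans)
  moreover have "Lp_norm m p (\<lambda>x. ennreal \<bar>u x\<bar>) \<le> ennreal K + 1"
    using 1 by (rule order_trans) simp
  ultimately show ?thesis
    using g(1) assms by (auto simp: weak_hajlasz_ball_def intro!: Lp_norm_le_imp bexI[of _ g])
qed

lemma weak_hajlasz_ball_le_measure:
  assumes sets: "sets \<nu> = sets \<mu>" and le: "\<forall>A\<in>sets \<mu>. emeasure \<nu> A \<le> C * emeasure \<mu> A"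
    and u: "u \<in> weak_hajlasz_ball d \<mu> \<alpha> p M"
  shows "u \<in> weak_hajlasz_ball d \<nu> \<alpha> p (C * M)"
proof -
  have space: "space \<nu> = space \<mu>" and bm: "borel_measurable \<nu> = (borel_measurable \<mu> :: ('a \<Rightarrow> real) set)"
    using sets by (auto dest: sets_eq_imp_space_eq intro: measurable_cong_sets)
  have *: "(\<integral>\<^sup>+x. f x \<partial>\<nu>) \<le> C * M" if "(\<integral>\<^sup>+x. f x \<partial>\<mu>) \<le> M" for f
    using nn_integral_le_cmult_measure[OF sets le, of f] mult_left_mono[OF that, of C]
    by (meson order_trans zero_le)
  have "frac_gradients d \<mu> \<alpha> u \<subseteq> frac_gradients d \<nu> \<alpha> u"
    using null_sets_le_cmult_measure[OF sets le] unfolding frac_gradients_def space bm by blast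
  then show ?thesis
    using u * unfolding weak_hajlasz_ball_def bm by blast
qed

text \<open>Gradients of the two functions add up to a gradient of the difference; the factor \<open>2\<^sup>p\<close> replaces
  the triangle inequality, which fails for \<open>p\<close>-th powers.\<close>

lemma weak_hajlasz_ball_diff:
  assumes "0 < p" "u \<in> weak_hajlasz_ball d m \<alpha> p M" "v \<in> weak_hajlasz_ball d m \<alpha> p M"
  shows "(\<lambda>x. u x - v x) \<in> weak_hajlasz_ball d m \<alpha> p (ennreal (2 powr p) * (M + M))"
proof -
  obtain g h where gh: "g \<in> frac_gradients d m \<alpha> u" "h \<in> frac_gradients d m \<alpha> v"
      "\<And>k. (\<integral>\<^sup>+x. ennreal_powr (ennreal (g k x)) p \<partial>m) \<le> M"
      "\<And>k. (\<integral>\<^sup>+x. ennreal_powr (ennreal (h k x)) p \<partial>m) \<le> M"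
    and u: "u \<in> borel_measurable m" "Lp_mass m p u \<le> M"
    and v: "v \<in> borel_measurable m" "Lp_mass m p v \<le> M"
    using assms by (auto simp: weak_hajlasz_ball_def)
  have *: "(\<integral>\<^sup>+x. ennreal_powr (c x) p \<partial>m) \<le> ennreal (2 powr p) * (M + M)"
    if [measurable]: "a \<in> borel_measurable m" "b \<in> borel_measurable m"
      and "(\<integral>\<^sup>+x. ennreal_powr (a x) p \<partial>m) \<le> M" "(\<integral>\<^sup>+x. ennreal_powr (b x) p \<partial>m) \<le> M"
      and c: "\<And>x. x \<in> space m \<Longrightarrow> c x \<le> a x + b x" for a b c
  proof -
    have "(\<integral>\<^sup>+x. ennreal_powr (c x) p \<partial>m)
        \<le> (\<integral>\<^sup>+x. ennreal (2 powr p) * (ennreal_powr (a x) p + ennreal_powr (b x) p) \<partial>m)"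
      using assms(1) c
      by (intro nn_integral_mono order_trans[OF ennreal_powr_mono ennreal_powr_add_le]) auto
    also have "\<dots> = ennreal (2 powr p) *
        ((\<integral>\<^sup>+x. ennreal_powr (a x) p \<partial>m) + (\<integral>\<^sup>+x. ennreal_powr (b x) p \<partial>m))"
      by (simp add: nn_integral_cmult nn_integral_add)
    also have "\<dots> \<le> ennreal (2 powr p) * (M + M)"
      using that by (intro mult_left_mono add_mono) auto
    finally show ?thesis .
  qed
  have gm: "g k \<in> borel_measurable m" "h k \<in> borel_measurable m"
       and g0: "x \<in> space m \<Longrightarrow> 0 \<le> g k x" "x \<in> space m \<Longrightarrow> 0 \<le> h k x" for k x
    using gh by (auto simp: frac_gradients_def)
  obtain E F where E: "E \<in> null_sets m" "\<forall>k. \<forall>x\<in>space m - E. \<forall>y\<in>space m - E.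
            2 powi (- k - 1) \<le> d x y \<and> d x y < 2 powi (- k) \<longrightarrow>
            \<bar>u x - u y\<bar> \<le> d x y powr \<alpha> * (g k x + g k y)"
    and F: "F \<in> null_sets m" "\<forall>k. \<forall>x\<in>space m - F. \<forall>y\<in>space m - F.
            2 powi (- k - 1) \<le> d x y \<and> d x y < 2 powi (- k) \<longrightarrow>
            \<bar>v x - v y\<bar> \<le> d x y powr \<alpha> * (h k x + h k y)"
    using gh by (auto simp: frac_gradients_def)
  have "(\<lambda>k x. g k x + h k x) \<in> frac_gradients d m \<alpha> (\<lambda>x. u x - v x)"
    unfolding frac_gradients_def
  proof (intro CollectI conjI allI ballI bexI[of _ "E \<union> F"] impI)
    fix k x y assume xy: "x \<in> space m - (E \<union> F)" "y \<in> space m - (E \<union> F)"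
      "2 powi (- k - 1) \<le> d x y \<and> d x y < 2 powi (- k)"
    have "\<bar>u x - v x - (u y - v y)\<bar> \<le> \<bar>u x - u y\<bar> + \<bar>v x - v y\<bar>" by linarith
    also have "\<dots> \<le> d x y powr \<alpha> * (g k x + g k y) + d x y powr \<alpha> * (h k x + h k y)"
      using E(2) F(2) xy by (intro add_mono) auto
    finally show "\<bar>u x - v x - (u y - v y)\<bar> \<le> d x y powr \<alpha> * (g k x + h k x + (g k y + h k y))"
      by (simp add: algebra_simps)
  qed (use E F gm g0 in auto)
  moreover have "(\<integral>\<^sup>+x. ennreal_powr (ennreal (g k x + h k x)) p \<partial>m) \<le> ennreal (2 powr p) * (M + M)" for k
    using gm gh g0 by (intro *[of "\<lambda>x. ennreal (g k x)" "\<lambda>x. ennreal (h k x)"]) auto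
  moreover have "Lp_mass m p (\<lambda>x. u x - v x) \<le> ennreal (2 powr p) * (M + M)"
    using u v by (intro *[of "\<lambda>x. ennreal \<bar>u x\<bar>" "\<lambda>x. ennreal \<bar>v x\<bar>"])
      (auto simp: ennreal_plus[symmetric] simp del: ennreal_plus)
  ultimately show ?thesis
    using u v unfolding weak_hajlasz_ball_def
    by (intro CollectI conjI bexI[of _ "\<lambda>k x. g k x + h k x"] allI) auto
qed

section \<open>Dominated gradients\<close>

text \<open>When the levels of a gradient are dominated by fixed multiples of one function \<open>H\<close>, the order in which the
  \<open>\<ell>\<^sup>q\<close> and \<open>L\<^sup>p\<close> quasi-norms are taken does not matter. So the Triebel--Lizorkin and the Besov
  norm obey the same bound, for every relation between \<open>p\<close> and \<open>q\<close>.\<close>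

lemma dominated_gradient_TL:
  assumes "0 < p" "0 < q" "h \<in> frac_gradients d m \<beta> u" "H \<in> borel_measurable m"
    and dom: "\<And>k x. x \<in> space m \<Longrightarrow> ennreal (h k x) \<le> l k * H x"
  shows "hajlasz_TL_norm d \<beta> p q m u \<le> Lp_norm m p (\<lambda>x. ennreal \<bar>u x\<bar>) + lq_norm q l * Lp_norm m p H"
proof -
  have "Lp_norm m p (\<lambda>x. lq_norm q (\<lambda>k. ennreal (h k x))) \<le> Lp_norm m p (\<lambda>x. lq_norm q l * H x)"
  proof (rule Lp_norm_mono[OF assms(1)])
    fix x assume "x \<in> space m"
    then have "lq_norm q (\<lambda>k. ennreal (h k x)) \<le> lq_norm q (\<lambda>k. H x * l k)"
      using dom by (intro lq_norm_mono) (simp add: mult.commute)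
    then show "lq_norm q (\<lambda>k. ennreal (h k x)) \<le> lq_norm q l * H x"
      using assms by (simp add: lq_norm_cmult mult.commute)
  qed
  also have "\<dots> = lq_norm q l * Lp_norm m p H"
    using assms by (intro Lp_norm_cmult)
  finally show ?thesis
    unfolding hajlasz_TL_norm_def using assms(3) by (intro add_left_mono INF_lower2)
qed

lemma dominated_gradient_Besov:
  assumes "0 < p" "0 < q" "h \<in> frac_gradients d m \<beta> u" "H \<in> borel_measurable m"
    and dom: "\<And>k x. x \<in> space m \<Longrightarrow> ennreal (h k x) \<le> l k * H x"
  shows "hajlasz_Besov_norm d \<beta> p q m u \<le> Lp_norm m p (\<lambda>x. ennreal \<bar>u x\<bar>) + lq_norm q l * Lp_norm m p H"
proof -
  have "Lp_norm m p (\<lambda>x. ennreal (h k x)) \<le> Lp_norm m p H * l k" for k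
    using Lp_norm_mono[OF assms(1), of m "\<lambda>x. ennreal (h k x)" "\<lambda>x. l k * H x"] dom assms
    by (simp add: Lp_norm_cmult mult.commute[of _ "l k"])
  then have "lq_norm q (\<lambda>k. Lp_norm m p (\<lambda>x. ennreal (h k x))) \<le> lq_norm q (\<lambda>k. Lp_norm m p H * l k)"
    by (rule lq_norm_mono)
  also have "\<dots> = lq_norm q l * Lp_norm m p H"
    unfolding lq_norm_cmult[OF assms(2)] by (rule mult.commute)
  finally show ?thesis
    unfolding hajlasz_Besov_norm_def using assms(3) by (intro add_left_mono INF_lower2)
qed

lemma powi_eq_powr: "(2::real) powi k = 2 powr (real_of_int k)"
  by (simp add: powr_real_of_int')

text \<open>A weighted sum of \<open>p\<close>-th powers instead of a supremum over the levels: it dominates every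
  single level from \<open>N\<close> on, and its integral is computed term by term.\<close>

definition level_tail :: "real \<Rightarrow> real \<Rightarrow> nat \<Rightarrow> (int \<Rightarrow> 'a \<Rightarrow> real) \<Rightarrow> 'a \<Rightarrow> ennreal" where
  "level_tail c p N g x =
     (\<Sum>i. ennreal (2 powr (- c * real (N + i))) * ennreal_powr (ennreal (g (int (N + i)) x)) p)"

lemma measurable_level_tail [measurable]:
  "(\<And>k. g k \<in> borel_measurable m) \<Longrightarrow> level_tail c p N g \<in> borel_measurable m"
  unfolding level_tail_def[abs_def] by measurable

lemma level_tail_ge:
  assumes "int N \<le> k"
  shows "ennreal (2 powr (- c * k)) * ennreal_powr (ennreal (g k x)) p \<le> level_tail c p N g x"
proof -
  obtain i where k: "k = int (N + i)"
    using assms by (metis zero_le_imp_eq_int of_nat_add le_add_diff_inverse diff_ge_0_iff_ge)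
  show ?thesis
    unfolding level_tail_def k
    by (rule order_trans[OF _ sum_le_suminf[of _ "{i}"]]) auto
qed

lemma nn_integral_level_tail_le:
  assumes [measurable]: "\<And>k. g k \<in> borel_measurable m"
    and M: "\<And>k. (\<integral>\<^sup>+x. ennreal_powr (ennreal (g k x)) p \<partial>m) \<le> M"
  shows "(\<integral>\<^sup>+x. level_tail c p N g x \<partial>m)
     \<le> ennreal (2 powr (- c * real N)) * geometric_sum c * M"
proof -
  have "(\<integral>\<^sup>+x. level_tail c p N g x \<partial>m)
      = (\<Sum>i. ennreal (2 powr (- c * real (N + i))) * (\<integral>\<^sup>+x. ennreal_powr (ennreal (g (int (N + i)) x)) p \<partial>m))"
    unfolding level_tail_def by (simp add: nn_integral_suminf nn_integral_cmult)
  also have "\<dots> \<le> (\<Sum>i. ennreal (2 powr (- c * real N)) * (ennreal (2 powr (- c * real i)) * M))"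
  proof (rule suminf_le)
    fix i
    have "2 powr (- c * real (N + i)) = 2 powr (- c * real N) * 2 powr (- c * real i)"
      by (simp add: powr_add[symmetric] algebra_simps)
    then have "ennreal (2 powr (- c * real (N + i)))
        = ennreal (2 powr (- c * real N)) * ennreal (2 powr (- c * real i))"
      by (simp add: ennreal_mult)
    then show "ennreal (2 powr (- c * real (N + i))) * (\<integral>\<^sup>+x. ennreal_powr (ennreal (g (int (N + i)) x)) p \<partial>m)
        \<le> ennreal (2 powr (- c * real N)) * (ennreal (2 powr (- c * real i)) * M)"
      using M[of "int (N + i)"] by (simp only: mult.assoc) (intro mult_left_mono, auto)
  qed auto
  also have "\<dots> = ennreal (2 powr (- c * real N)) * geometric_sum c * M"
    by (simp add: mult.assoc)
  finally show ?thesis .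
qed

section \<open>Passing to lower smoothness\<close>

lemma ennreal_mult_less_topI: "a < top \<Longrightarrow> b < top \<Longrightarrow> a * b < (top::ennreal)"
  by (simp add: ennreal_mult_less_top)

lemma ennreal_less_topE:
  assumes "x < (top::ennreal)"
  obtains t where "x = ennreal t" "0 \<le> t"
  using assms by (cases x) auto

lemma ex_powr_small:
  assumes "0 < (c::real)" "0 < t"
  shows "\<exists>N. 2 powr (- c * real N) * S < t"
proof -
  have "(\<lambda>N. (2 powr (- c)) ^ N * S) \<longlonglongrightarrow> 0 * S"
    using assms by (intro tendsto_mult LIMSEQ_realpow_zero tendsto_const) (auto simp: powr_less_one)
  then have "eventually (\<lambda>N. (2 powr (- c)) ^ N * S < t) sequentially"
    using assms by (intro order_tendstoD(2)) auto
  then obtain N where "(2 powr (- c)) ^ N * S < t"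
    by (auto simp: eventually_sequentially)
  then have "2 powr (- c * real N) * S < t"
    by (simp add: powr_realpow[symmetric] powr_powr)
  then show ?thesis ..
qed

text \<open>At level \<open>k\<close> one has \<open>2\<^bsup>-k-1\<^esup> \<le> d x y < 2\<^bsup>-k\<^esup>\<close>. Above the cut-off the surplus
  \<open>d x y powr (\<alpha> - \<beta>)\<close> is absorbed into the gradient; below it the distance is bounded from below
  and \<open>\<bar>u x - u y\<bar> \<le> \<bar>u x\<bar> + \<bar>u y\<bar>\<close> suffices.\<close>

lemma frac_gradients_lower_order:
  fixes u :: "'a \<Rightarrow> real" and \<alpha> \<beta> :: real
  assumes g: "g \<in> frac_gradients d m \<alpha> u" and u[measurable]: "u \<in> borel_measurable m"
    and "0 < \<beta>" "\<beta> \<le> \<alpha>"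
  shows "(\<lambda>k x. if k < N then 2 powr ((real_of_int k + 1) * \<beta>) * \<bar>u x\<bar> else 2 powr (- real_of_int k * (\<alpha> - \<beta>)) * g k x)
           \<in> frac_gradients d m \<beta> u"
proof -
  obtain E where E: "E \<in> null_sets m" "\<forall>k. \<forall>x\<in>space m - E. \<forall>y\<in>space m - E.
            2 powi (- k - 1) \<le> d x y \<and> d x y < 2 powi (- k) \<longrightarrow>
            \<bar>u x - u y\<bar> \<le> d x y powr \<alpha> * (g k x + g k y)"
    and g0: "x \<in> space m \<Longrightarrow> 0 \<le> g k x" and [measurable]: "g k \<in> borel_measurable m" for k x
    using g by (auto simp: frac_gradients_def)
  show ?thesis
    unfolding frac_gradients_def
  proof (intro CollectI conjI allI ballI bexI[OF _ E(1)] impI)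
    fix k x y assume xy: "x \<in> space m - E" "y \<in> space m - E"
      "2 powi (- k - 1) \<le> d x y \<and> d x y < 2 powi (- k)"
    moreover have "- real_of_int k - 1 = - (k + 1)" by simp
    ultimately have dl: "2 powr (- (k + 1)) \<le> d x y" and du: "d x y < 2 powr (- k)"
      by (auto simp only: powi_eq_powr of_int_diff of_int_minus of_int_1)
    have d0: "0 < d x y" using dl by (rule less_le_trans[rotated]) simp
    show "\<bar>u x - u y\<bar> \<le> d x y powr \<beta> *
          ((if k < N then 2 powr ((real_of_int k + 1) * \<beta>) * \<bar>u x\<bar> else 2 powr (- real_of_int k * (\<alpha> - \<beta>)) * g k x)
         + (if k < N then 2 powr ((real_of_int k + 1) * \<beta>) * \<bar>u y\<bar> else 2 powr (- real_of_int k * (\<alpha> - \<beta>)) * g k y))"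
    proof (cases "k < N")
      case True
      have "1 = (2 powr (- (k + 1))) powr \<beta> * 2 powr ((real_of_int k + 1) * \<beta>)"
        by (simp add: powr_powr powr_add[symmetric] distrib_right[symmetric])
      also have "\<dots> \<le> d x y powr \<beta> * 2 powr ((real_of_int k + 1) * \<beta>)"
        using dl assms by (intro mult_right_mono powr_mono2) auto
      finally have "1 * (\<bar>u x\<bar> + \<bar>u y\<bar>) \<le> (d x y powr \<beta> * 2 powr ((real_of_int k + 1) * \<beta>)) * (\<bar>u x\<bar> + \<bar>u y\<bar>)"
        by (intro mult_right_mono) auto
      then show ?thesis using True by (simp add: algebra_simps)
    next
      case False
      have "\<bar>u x - u y\<bar> \<le> d x y powr \<alpha> * (g k x + g k y)"
        using E(2) xy by blast
      also have "d x y powr \<alpha> = d x y powr \<beta> * d x y powr (\<alpha> - \<beta>)"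
        by (simp add: powr_add[symmetric])
      also have "\<dots> * (g k x + g k y) \<le> d x y powr \<beta> * (2 powr (- k)) powr (\<alpha> - \<beta>) * (g k x + g k y)"
        using d0 du assms g0 xy by (intro mult_right_mono mult_left_mono powr_mono2) auto
      finally show ?thesis
        using False by (simp add: powr_powr algebra_simps)
    qed
  qed (auto simp: g0)
qed

text \<open>The gap \<open>\<alpha> - \<beta> = 2 e\<close> is split in two: one factor \<open>2\<^bsup>-ek\<^esup>\<close> makes the weights \<open>\<ell>\<^sup>r\<close>-summable, the
  other makes the tail of the levels small. The factor \<open>2 powr (Suc N * (\<beta> + e) + \<beta>)\<close> is the price
  for writing the large-scale gradient with weights that do not depend on the cut-off.\<close>

lemma norm_le_of_level_bounds:
  fixes w :: "'a \<Rightarrow> real" and \<alpha> \<beta> p :: real and N :: nat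
  assumes p: "0 < p" and r: "0 < r" and ab: "0 < \<beta>" "\<beta> < \<alpha>"
    and w: "w \<in> weak_hajlasz_ball d m \<alpha> p M"
  defines "e \<equiv> (\<alpha> - \<beta>) / 2"
  defines "B \<equiv> Lp_norm m p (\<lambda>x. ennreal \<bar>w x\<bar>) + lq_norm r (\<lambda>k. ennreal (geometric_weight \<beta> e k)) *
     ennreal_powr (ennreal ((2 powr (Suc N * (\<beta> + e) + \<beta>)) powr p) *
         (Lp_mass m p w)
       + ennreal (2 powr (- (e * p) * real (Suc N))) * geometric_sum (e * p) * M) (1 / p)"
  shows "hajlasz_TL_norm d \<beta> p r m w \<le> B" "hajlasz_Besov_norm d \<beta> p r m w \<le> B"
proof -
  obtain g where g: "g \<in> frac_gradients d m \<alpha> w"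
    and M: "\<And>k. (\<integral>\<^sup>+x. ennreal_powr (ennreal (g k x)) p \<partial>m) \<le> M"
    and wm[measurable]: "w \<in> borel_measurable m"
    using w by (auto simp: weak_hajlasz_ball_def)
  have g0: "x \<in> space m \<Longrightarrow> 0 \<le> g k x" and gm[measurable]: "g k \<in> borel_measurable m" for k x
    using g by (auto simp: frac_gradients_def)
  have e: "0 < e" using ab by (simp add: e_def)
  define n where "n = Suc N"
  define A where "A = 2 powr (n * (\<beta> + e) + \<beta>)"
  define l where "l = (\<lambda>k. ennreal (geometric_weight \<beta> e k))"
  define h where "h = (\<lambda>k x. if k < int n then 2 powr ((real_of_int k + 1) * \<beta>) * \<bar>w x\<bar>
                                else 2 powr (- real_of_int k * (\<alpha> - \<beta>)) * g k x)"
  define H where "H = (\<lambda>x. ennreal_powr (ennreal (A powr p) * abs_powr (w x) p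
                             + level_tail (e * p) p n g x) (1 / p))"
  have h: "h \<in> frac_gradients d m \<beta> w"
    unfolding h_def by (rule frac_gradients_lower_order[OF g wm ab(1) less_imp_le[OF ab(2)]])
  have [measurable]: "H \<in> borel_measurable m"
    unfolding H_def by measurable
  have A: "0 < A" by (simp add: A_def)
  have dom: "ennreal (h k x) \<le> l k * H x" if x: "x \<in> space m" for k x
  proof (cases "k < int n")
    case True
    have "2 powr ((real_of_int k + 1) * \<beta>) \<le> geometric_weight \<beta> e k * A"
    proof (cases "k \<le> 0")
      case True
      have "(k + 1) * \<beta> \<le> \<beta> * k + (n * (\<beta> + e) + \<beta>)"
        using ab e by (simp add: algebra_simps)
      then show ?thesis using True by (simp add: geometric_weight_def A_def powr_add[symmetric])
    next
      case False
      have "k * (\<beta> + e) \<le> n * (\<beta> + e)"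
        using \<open>k < int n\<close> ab e by (intro mult_right_mono) auto
      then have "(k + 1) * \<beta> \<le> - e * k + (n * (\<beta> + e) + \<beta>)"
        by (simp add: algebra_simps)
      then show ?thesis using False by (simp add: geometric_weight_def A_def powr_add[symmetric])
    qed
    then have "h k x \<le> geometric_weight \<beta> e k * (A * \<bar>w x\<bar>)"
      using True mult_right_mono[of "2 powr ((real_of_int k + 1) * \<beta>)" "geometric_weight \<beta> e k * A" "\<bar>w x\<bar>"]
      by (simp add: h_def)
    then have "ennreal (h k x) \<le> l k * ennreal (A * \<bar>w x\<bar>)"
      using A by (simp add: l_def ennreal_mult[symmetric] less_imp_le ennreal_leI)
    also have "ennreal (A * \<bar>w x\<bar>) = ennreal_powr (ennreal (A powr p) * abs_powr (w x) p) (1 / p)"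
      using A p by (simp add: ennreal_powr_ennreal ennreal_mult[symmetric] powr_mult[symmetric] powr_powr)
    also have "\<dots> \<le> H x"
      unfolding H_def using p by (intro ennreal_powr_mono) auto
    finally show ?thesis by (simp add: mult_left_mono)
  next
    case False
    then have k: "int n \<le> k" "0 < k" by (auto simp: n_def)
    have "h k x = geometric_weight \<beta> e k * (2 powr (- e * k) * g k x)"
    proof -
      have "- real_of_int k * (\<alpha> - \<beta>) = - e * k + - e * k"
        by (simp add: e_def field_simps)
      then show ?thesis
        using False k by (simp only: h_def geometric_weight_def powr_add) simp
    qed
    then have "ennreal (h k x) = l k * ennreal (2 powr (- e * k) * g k x)"
      using g0[OF x] by (simp add: l_def ennreal_mult less_imp_le)
    also have "ennreal (2 powr (- e * k) * g k x)
        = ennreal_powr (ennreal (2 powr (- (e * p) * k)) * ennreal_powr (ennreal (g k x)) p) (1 / p)"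
    proof -
      have "ennreal (2 powr (- (e * p) * k)) = ennreal_powr (ennreal (2 powr (- e * k))) p"
        by (simp add: ennreal_powr_ennreal powr_powr algebra_simps)
      then show ?thesis
        using g0[OF x]
        by (simp only: ennreal_powr_mult[OF p, symmetric] ennreal_powr_inverse[OF p])
          (simp add: ennreal_mult)
    qed
    also have "\<dots> \<le> H x"
      unfolding H_def
      using p level_tail_ge[OF k(1), of "e * p" g x p]
      by (intro ennreal_powr_mono) (auto intro: order_trans)
    finally show ?thesis by (simp add: mult_left_mono)
  qed
  have "Lp_norm m p H \<le> ennreal_powr (ennreal (A powr p) * (Lp_mass m p w)
       + ennreal (2 powr (- (e * p) * real n)) * geometric_sum (e * p) * M) (1 / p)"
    unfolding Lp_norm_def
  proof (rule ennreal_powr_mono)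
    have "(\<integral>\<^sup>+x. ennreal_powr (H x) p \<partial>m)
        = (\<integral>\<^sup>+x. ennreal (A powr p) * abs_powr (w x) p + level_tail (e * p) p n g x \<partial>m)"
      using p by (simp add: H_def)
    also have "\<dots> = ennreal (A powr p) * (Lp_mass m p w)
        + (\<integral>\<^sup>+x. level_tail (e * p) p n g x \<partial>m)"
      by (simp add: nn_integral_add nn_integral_cmult)
    also have "\<dots> \<le> ennreal (A powr p) * (Lp_mass m p w)
       + ennreal (2 powr (- (e * p) * real n)) * geometric_sum (e * p) * M"
      by (intro add_left_mono nn_integral_level_tail_le gm M)
    finally show "(\<integral>\<^sup>+x. ennreal_powr (H x) p \<partial>m) \<le> \<dots>" .
  qed (use p in auto)
  then have "Lp_norm m p (\<lambda>x. ennreal \<bar>w x\<bar>) + lq_norm r l * Lp_norm m p H \<le> B"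
    unfolding B_def l_def A_def n_def by (intro add_left_mono mult_left_mono) auto
  moreover have "hajlasz_TL_norm d \<beta> p r m w \<le> Lp_norm m p (\<lambda>x. ennreal \<bar>w x\<bar>) + lq_norm r l * Lp_norm m p H"
    using p r h dom by (intro dominated_gradient_TL) auto
  moreover have "hajlasz_Besov_norm d \<beta> p r m w \<le> Lp_norm m p (\<lambda>x. ennreal \<bar>w x\<bar>) + lq_norm r l * Lp_norm m p H"
    using p r h dom by (intro dominated_gradient_Besov) auto
  ultimately show "hajlasz_TL_norm d \<beta> p r m w \<le> B" "hajlasz_Besov_norm d \<beta> p r m w \<le> B"
    by (meson order_trans)+
qed

lemma weak_imp_finite_norm:
  assumes "0 < p" "0 < r" "0 < \<beta>" "\<beta> < \<alpha>" "w \<in> weak_hajlasz_ball d m \<alpha> p M" "M < top"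
  shows "hajlasz_TL_norm d \<beta> p r m w < top" "hajlasz_Besov_norm d \<beta> p r m w < top"
proof -
  define e where "e = (\<alpha> - \<beta>) / 2"
  have e: "0 < e" using assms by (simp add: e_def)
  have I: "Lp_mass m p w < top"
    using assms by (auto simp: weak_hajlasz_ball_def intro: le_less_trans)
  have \<Lambda>: "lq_norm r (\<lambda>k. ennreal (geometric_weight \<beta> e k)) < top"
    using assms e by (intro lq_norm_geometric_weight) auto
  have S: "geometric_sum (e * p) < top"
    by (rule suminf_powr_less_top[OF mult_pos_pos[OF e assms(1)]])
  have "Lp_norm m p (\<lambda>x. ennreal \<bar>w x\<bar>) < top"
    using I by (simp add: Lp_norm_def)
  moreover have "lq_norm r (\<lambda>k. ennreal (geometric_weight \<beta> e k)) *
     ennreal_powr (ennreal ((2 powr (Suc 0 * (\<beta> + e) + \<beta>)) powr p) *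
         (Lp_mass m p w)
       + ennreal (2 powr (- (e * p) * real (Suc 0))) * geometric_sum (e * p) * M) (1 / p) < top"
    unfolding ennreal_powr_less_top_iff
    by (intro ennreal_mult_less_topI \<Lambda> S I assms(6) ennreal_less_top
        iffD2[OF ennreal_powr_less_top_iff] iffD2[OF ennreal_add_less_top] conjI)
  ultimately show "hajlasz_TL_norm d \<beta> p r m w < top" "hajlasz_Besov_norm d \<beta> p r m w < top"
    using norm_le_of_level_bounds[OF assms(1-5), of 0, folded e_def]
    by (auto intro: le_less_trans simp del: ennreal_powr_less_top_iff)
qed

text \<open>First the cut-off \<open>N\<close> is chosen to make the tail of the levels small; only then is the smallness
  of the \<open>L\<^sup>p\<close> norm fixed, since its factor grows with \<open>N\<close>.\<close>

lemma weak_small_Lp_imp_small_norm: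
  assumes p: "0 < p" and r: "0 < r" and ab: "0 < \<beta>" "\<beta> < \<alpha>" and M: "M < top" and eps: "(0::real) < \<epsilon>"
  shows "\<exists>\<eta>>0::real. \<forall>w\<in>weak_hajlasz_ball d m \<alpha> p M.
           (Lp_mass m p w) \<le> ennreal \<eta> \<longrightarrow>
           hajlasz_TL_norm d \<beta> p r m w < ennreal \<epsilon> \<and> hajlasz_Besov_norm d \<beta> p r m w < ennreal \<epsilon>"
proof -
  define e where "e = (\<alpha> - \<beta>) / 2"
  have e: "0 < e" using ab by (simp add: e_def)
  obtain L where L: "lq_norm r (\<lambda>k. ennreal (geometric_weight \<beta> e k)) = ennreal L" "0 \<le> L"
    using lq_norm_geometric_weight[OF r ab(1), of e] e by (auto elim: ennreal_less_topE)
  have "geometric_sum (e * p) * M < top"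
    by (rule ennreal_mult_less_topI[OF suminf_powr_less_top[OF mult_pos_pos[OF e p]] M])
  then obtain S where S: "geometric_sum (e * p) * M = ennreal S" "0 \<le> S"
    by (rule ennreal_less_topE)
  define t where "t = (\<epsilon> / (3 * (L + 1))) powr p"
  have t: "0 < t" "L * t powr (1 / p) \<le> \<epsilon> / 3"
    using eps L p by (auto simp: t_def powr_powr field_simps)
  obtain N where N': "2 powr (- (e * p) * real N) * S < t / 2"
    using ex_powr_small[of "e * p" "t / 2"] e p t by auto
  have "2 powr (- (e * p) * real (Suc N)) * S \<le> 2 powr (- (e * p) * real N) * S"
    using e p S by (intro mult_right_mono powr_mono) auto
  with N' have N: "2 powr (- (e * p) * real (Suc N)) * S < t / 2" by simp
  define A where "A = (2 powr (Suc N * (\<beta> + e) + \<beta>)) powr p"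
  define \<eta> where "\<eta> = min (t / (2 * A)) ((\<epsilon> / 3) powr p)"
  have A: "0 < A" by (simp add: A_def)
  have eta: "0 < \<eta>" "A * \<eta> \<le> t / 2" "\<eta> powr (1 / p) \<le> \<epsilon> / 3"
  proof -
    show "0 < \<eta>" using t A eps by (simp add: \<eta>_def)
    show "A * \<eta> \<le> t / 2" using A by (auto simp: \<eta>_def field_simps min_def)
    have "\<eta> powr (1 / p) \<le> ((\<epsilon> / 3) powr p) powr (1 / p)"
      using \<open>0 < \<eta>\<close> p by (intro powr_mono2) (auto simp: \<eta>_def)
    then show "\<eta> powr (1 / p) \<le> \<epsilon> / 3" using p eps by (simp add: powr_powr)
  qed
  have "hajlasz_TL_norm d \<beta> p r m w < ennreal \<epsilon> \<and> hajlasz_Besov_norm d \<beta> p r m w < ennreal \<epsilon>"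
    if w: "w \<in> weak_hajlasz_ball d m \<alpha> p M"
      and I: "Lp_mass m p w \<le> ennreal \<eta>" for w
  proof -
    define I' where "I' = (Lp_mass m p w)"
    have "ennreal A * I' + ennreal (2 powr (- (e * p) * real (Suc N))) * geometric_sum (e * p) * M
        \<le> ennreal A * ennreal \<eta> + ennreal (2 powr (- (e * p) * real (Suc N))) * ennreal S"
      using I by (intro add_mono mult_left_mono) (auto simp: I'_def S(1)[symmetric] mult.assoc)
    also have "\<dots> \<le> ennreal t"
      using A eta N S by (simp add: ennreal_mult[symmetric] ennreal_plus[symmetric] ennreal_leI del: ennreal_plus)
    finally have 1: "ennreal_powr (ennreal A * I' + ennreal (2 powr (- (e * p) * real (Suc N)))
          * geometric_sum (e * p) * M) (1 / p) \<le> ennreal (t powr (1 / p))"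
      using ennreal_powr_mono[of _ "ennreal t" "1 / p"] p t by (simp add: ennreal_powr_ennreal)
    have 2: "Lp_norm m p (\<lambda>x. ennreal \<bar>w x\<bar>) \<le> ennreal (\<eta> powr (1 / p))"
      using ennreal_powr_mono[OF I, of "1 / p"] p eta by (simp add: ennreal_powr_ennreal Lp_norm_def)
    have "Lp_norm m p (\<lambda>x. ennreal \<bar>w x\<bar>) + ennreal L * ennreal_powr (ennreal A * I' + ennreal (2 powr (- (e * p) * real (Suc N)))
          * geometric_sum (e * p) * M) (1 / p)
        \<le> ennreal (\<eta> powr (1 / p)) + ennreal L * ennreal (t powr (1 / p))"
      by (intro add_mono mult_left_mono 1 2) auto
    also have "\<dots> < ennreal \<epsilon>"
      using t eta eps L
      by (simp add: ennreal_mult[symmetric] ennreal_plus[symmetric] ennreal_less_iff del: ennreal_plus)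
    finally show ?thesis
      using norm_le_of_level_bounds[OF p r ab w, of N] unfolding e_def[symmetric] L(1) A_def[symmetric] I'_def[symmetric]
      by (auto intro: le_less_trans)
  qed
  then show ?thesis using eta by blast
qed

section \<open>Oscillation at small scales\<close>

lemma ex_dyadic_level:
  assumes "0 < (t::real)"
  shows "\<exists>k::int. 2 powi (- k - 1) \<le> t \<and> t < 2 powi (- k)"
proof -
  define k where "k = - \<lfloor>log 2 t\<rfloor> - 1"
  have "2 powr (- real_of_int k - 1) \<le> 2 powr log 2 t"
    by (intro powr_mono) (auto simp: k_def)
  moreover have "2 powr log 2 t < 2 powr (- real_of_int k)"
    by (intro powr_less_mono) (auto simp: k_def, linarith)
  ultimately show ?thesis
    using assms by (intro exI[of _ k]) (simp add: powi_eq_powr)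
qed

text \<open>All that the construction of nets in \<open>L\<^sup>p(\<nu>)\<close> retains of the smoothness of \<open>u\<close>: oscillation at
  scale \<open>s\<close>, measured additively so that averages of \<open>G\<close> bound averages of the left-hand side.\<close>

definition oscillation_bound ::
  "('a \<Rightarrow> 'a \<Rightarrow> real) \<Rightarrow> 'a measure \<Rightarrow> real \<Rightarrow> real \<Rightarrow> real \<Rightarrow> ('a \<Rightarrow> real) \<Rightarrow> ('a \<Rightarrow> ennreal) \<Rightarrow> bool" where
  "oscillation_bound d m p s \<eta> u G \<longleftrightarrow>
     G \<in> borel_measurable m \<and> (\<integral>\<^sup>+x. G x \<partial>m) \<le> ennreal \<eta> \<and>
     (\<exists>E\<in>null_sets m. \<forall>x\<in>space m - E. \<forall>y\<in>space m - E. d x y < s \<longrightarrow>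
        abs_powr (u x - u y) p \<le> G x + G y)"

text \<open>Points with \<open>d x y < 2\<^bsup>-N\<^esup>\<close> have a dyadic level \<open>k \<ge> N\<close>, and the level \<open>k\<close> of the gradient is one
  term of the weighted tail. The scale depends on the class only, not on the individual function.\<close>

lemma weak_imp_oscillation_bound:
  assumes qm: "quasi_metric (space m) d" and p: "0 < p" and a: "0 < \<alpha>" and M: "M < top" and eta: "0 < \<eta>"
  shows "\<exists>s>0. \<forall>u\<in>weak_hajlasz_ball d m \<alpha> p M. \<exists>G. oscillation_bound d m p s \<eta> u G"
proof -
  define c where "c = \<alpha> * p"
  have c: "0 < c" using a p by (simp add: c_def)
  have "geometric_sum c * M < top"
    by (rule ennreal_mult_less_topI[OF suminf_powr_less_top[OF c] M])
  then obtain S where S: "geometric_sum c * M = ennreal S" "0 \<le> S"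
    by (rule ennreal_less_topE)
  obtain N where N: "2 powr p * (2 powr (- c * real N) * S) < \<eta>"
    using ex_powr_small[OF c eta, of "2 powr p * S"] by (auto simp: mult.left_commute)
  have "\<exists>G. oscillation_bound d m p (2 powr (- real N)) \<eta> u G"
    if u: "u \<in> weak_hajlasz_ball d m \<alpha> p M" for u
  proof -
    obtain g where g: "g \<in> frac_gradients d m \<alpha> u"
      and gM: "\<And>k. (\<integral>\<^sup>+x. ennreal_powr (ennreal (g k x)) p \<partial>m) \<le> M"
      using u by (auto simp: weak_hajlasz_ball_def)
    obtain E where E: "E \<in> null_sets m" "\<forall>k. \<forall>x\<in>space m - E. \<forall>y\<in>space m - E.
            2 powi (- k - 1) \<le> d x y \<and> d x y < 2 powi (- k) \<longrightarrow>
            \<bar>u x - u y\<bar> \<le> d x y powr \<alpha> * (g k x + g k y)"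
      and g0: "x \<in> space m \<Longrightarrow> 0 \<le> g k x" and [measurable]: "g k \<in> borel_measurable m" for k x
      using g by (auto simp: frac_gradients_def)
    define G where "G = (\<lambda>x. ennreal (2 powr p) * level_tail c p N g x)"
    have "(\<integral>\<^sup>+x. G x \<partial>m) = ennreal (2 powr p) * (\<integral>\<^sup>+x. level_tail c p N g x \<partial>m)"
      unfolding G_def by (intro nn_integral_cmult) measurable
    also have "\<dots> \<le> ennreal (2 powr p) * (ennreal (2 powr (- c * real N)) * ennreal S)"
      unfolding S(1)[symmetric] mult.assoc[symmetric, of "ennreal (2 powr (- c * real N))"]
      by (intro mult_left_mono nn_integral_level_tail_le gM) auto
    also have "\<dots> \<le> ennreal \<eta>"
      using N S by (simp add: ennreal_mult[symmetric] ennreal_leI)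
    finally have int: "(\<integral>\<^sup>+x. G x \<partial>m) \<le> ennreal \<eta>" .
    have "abs_powr (u x - u y) p \<le> G x + G y"
      if xy: "x \<in> space m - E" "y \<in> space m - E" "d x y < 2 powr (- real N)" for x y
    proof (cases "x = y")
      case False
      then have "d x y \<noteq> 0" "0 \<le> d x y" using qm xy unfolding quasi_metric_def by blast+
      then have d0: "0 < d x y" by simp
      obtain k where k: "2 powi (- k - 1) \<le> d x y" "d x y < 2 powi (- k)"
        using ex_dyadic_level[OF d0] by blast
      have "2 powr (- real_of_int k - 1) < 2 powr (- real N)"
        using order_le_less_trans[OF k(1) xy(3)] by (simp add: powi_eq_powr)
      then have kN: "int N \<le> k" by simp
      have "\<bar>u x - u y\<bar> \<le> d x y powr \<alpha> * (g k x + g k y)"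
        using E(2) xy k by blast
      also have "\<dots> \<le> (2 powr (- k)) powr \<alpha> * (g k x + g k y)"
        using d0 k(2) a g0 xy by (intro mult_right_mono powr_mono2) (auto simp: powi_eq_powr)
      finally have "ennreal \<bar>u x - u y\<bar> \<le> ennreal ((2 powr (- k)) powr \<alpha>) * (ennreal (g k x) + ennreal (g k y))"
        using g0 xy by (simp add: ennreal_mult[symmetric] ennreal_plus[symmetric] ennreal_leI del: ennreal_plus)
      then have "abs_powr (u x - u y) p
          \<le> ennreal_powr (ennreal ((2 powr (- k)) powr \<alpha>)) p * ennreal_powr (ennreal (g k x) + ennreal (g k y)) p"
        using p ennreal_powr_mono by (simp add: ennreal_powr_mult[symmetric])
      also have "ennreal_powr (ennreal ((2 powr (- k)) powr \<alpha>)) p = ennreal (2 powr (- c * k))"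
        by (simp add: ennreal_powr_ennreal powr_powr c_def algebra_simps)
      also have "\<dots> * ennreal_powr (ennreal (g k x) + ennreal (g k y)) p
         \<le> ennreal (2 powr (- c * k)) * (ennreal (2 powr p) *
             (ennreal_powr (ennreal (g k x)) p + ennreal_powr (ennreal (g k y)) p))"
        using p by (intro mult_left_mono ennreal_powr_add_le) auto
      also have "\<dots> = ennreal (2 powr p) * (ennreal (2 powr (- c * k)) * ennreal_powr (ennreal (g k x)) p
             + ennreal (2 powr (- c * k)) * ennreal_powr (ennreal (g k y)) p)"
        by (simp only: distrib_left mult.left_commute)
      also have "\<dots> \<le> ennreal (2 powr p) * (level_tail c p N g x + level_tail c p N g y)"
        using kN by (intro mult_left_mono add_mono level_tail_ge) auto
      finally show ?thesis by (simp add: G_def distrib_left)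
    qed simp
    then show ?thesis
      using int E(1) unfolding oscillation_bound_def
      by (intro exI[of _ G] conjI bexI[OF _ E(1)]) (auto simp: G_def)
  qed
  then show ?thesis by (intro exI[of _ "2 powr (- real N)"]) auto
qed

section \<open>Finite nets from finitely many small cells\<close>

text \<open>Otherwise \<open>G\<close> would exceed its average almost everywhere on \<open>Q\<close>.\<close>

lemma ex_point_le_average:
  fixes G :: "'a \<Rightarrow> ennreal"
  assumes [measurable]: "G \<in> borel_measurable m" and Q[measurable]: "Q \<in> sets m"
    and fin: "(\<integral>\<^sup>+x\<in>Q. G x \<partial>m) < top" and E: "E \<in> null_sets m"
    and pos: "emeasure m Q \<noteq> 0" and top: "emeasure m Q < top"
  shows "\<exists>y\<in>Q - E. G y * emeasure m Q \<le> (\<integral>\<^sup>+x\<in>Q. G x \<partial>m)"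
proof (rule ccontr)
  define I where "I = (\<integral>\<^sup>+x\<in>Q. G x \<partial>m)"
  define c where "c = I / emeasure m Q"
  assume "\<not> (\<exists>y\<in>Q - E. G y * emeasure m Q \<le> (\<integral>\<^sup>+x\<in>Q. G x \<partial>m))"
  then have *: "I < G y * emeasure m Q" if "y \<in> Q - E" for y
    using that by (auto simp: I_def not_le)
  have cI: "c * emeasure m Q = I"
    using pos top by (simp add: c_def ennreal_divide_times ennreal_divide_self)
  have less: "c < G y" if "y \<in> Q - E" for y
    using *[OF that] mult_right_mono[of "G y" c "emeasure m Q"] cI by (meson leD leI zero_le)
  have "(\<integral>\<^sup>+x. c * indicator Q x \<partial>m) < (\<integral>\<^sup>+x. G x * indicator Q x \<partial>m)"
  proof (rule nn_integral_less)
    show "(\<integral>\<^sup>+x. c * indicator Q x \<partial>m) \<noteq> \<infinity>"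
      using fin cI by (simp add: nn_integral_cmult_indicator I_def)
    show "AE x in m. c * indicator Q x \<le> G x * indicator Q x"
      using AE_not_in[OF E] by eventually_elim (use less in \<open>auto split: split_indicator intro: less_imp_le\<close>)
    show "\<not> (AE x in m. G x * indicator Q x \<le> c * indicator Q x)"
    proof
      assume "AE x in m. G x * indicator Q x \<le> c * indicator Q x"
      then have "AE x in m. x \<notin> Q"
        using AE_not_in[OF E] by eventually_elim (use less in \<open>auto split: split_indicator simp: not_less[symmetric]\<close>)
      then have "emeasure m Q = 0"
        using AE_iff_measurable[of Q m "\<lambda>x. x \<notin> Q"] sets.sets_into_space[OF Q] by auto
      then show False using pos by simp
    qed
  qed measurable
  then show False
    using cI by (simp add: nn_integral_cmult_indicator I_def)
qed

text \<open>Take for \<open>c\<close> the value of \<open>u\<close> at a point where \<open>G\<close> does not exceed its \<open>\<mu>\<close>-average over \<open>Q\<close>. On a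
  \<open>\<mu>\<close>-null cell every constant will do.\<close>

lemma ex_cell_constant:
  assumes sets: "sets \<nu> = sets \<mu>" and le: "\<forall>A\<in>sets \<mu>. emeasure \<nu> A \<le> ennreal C * emeasure \<mu> A"
    and osc: "oscillation_bound d \<mu> p s \<eta> u G"
    and Q: "Q \<in> sets \<mu>" "emeasure \<mu> Q < top" "\<And>x y. x \<in> Q \<Longrightarrow> y \<in> Q \<Longrightarrow> d x y < s"
  shows "\<exists>c. (\<integral>\<^sup>+x\<in>Q. abs_powr (u x - c) p \<partial>\<nu>) \<le> ennreal C * (2 * (\<integral>\<^sup>+x\<in>Q. G x \<partial>\<mu>))"
proof -
  note [measurable_cong] = sets
  have [measurable]: "G \<in> borel_measurable \<mu>" and int: "(\<integral>\<^sup>+x. G x \<partial>\<mu>) \<le> ennreal \<eta>"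
    using osc by (auto simp: oscillation_bound_def)
  obtain E where E: "E \<in> null_sets \<mu>"
    and osc': "\<And>x y. x \<in> space \<mu> - E \<Longrightarrow> y \<in> space \<mu> - E \<Longrightarrow> d x y < s \<Longrightarrow>
        abs_powr (u x - u y) p \<le> G x + G y"
    using osc unfolding oscillation_bound_def by blast
  have E': "E \<in> null_sets \<nu>" using null_sets_le_cmult_measure[OF sets le] E by blast
  note Q(1)[measurable]
  have QX: "Q \<subseteq> space \<mu>" using Q(1) by (rule sets.sets_into_space)
  show ?thesis
  proof (cases "emeasure \<mu> Q = 0")
    case True
    then have "Q \<in> null_sets \<mu>" using Q by auto
    then have "Q \<in> null_sets \<nu>"
      using null_sets_le_cmult_measure[OF sets le] by blast
    then have "(\<integral>\<^sup>+x\<in>Q. abs_powr (u x - 0) p \<partial>\<nu>) = 0"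
      by (rule nn_integral_null_set)
    then show ?thesis by (metis zero_le)
  next
    case False
    have "(\<integral>\<^sup>+x\<in>Q. G x \<partial>\<mu>) \<le> (\<integral>\<^sup>+x. G x \<partial>\<mu>)"
      by (intro nn_integral_mono) (auto split: split_indicator)
    then have "(\<integral>\<^sup>+x\<in>Q. G x \<partial>\<mu>) < top"
      using int by (meson ennreal_less_top le_less_trans order_trans)
    then obtain y where y: "y \<in> Q - E" "G y * emeasure \<mu> Q \<le> (\<integral>\<^sup>+x\<in>Q. G x \<partial>\<mu>)"
      using ex_point_le_average[of G \<mu> Q E] E Q False by auto
    have "(\<integral>\<^sup>+x\<in>Q. abs_powr (u x - u y) p \<partial>\<nu>) \<le> (\<integral>\<^sup>+x. G x * indicator Q x + G y * indicator Q x \<partial>\<nu>)"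
    proof (rule nn_integral_mono_AE)
      show "AE x in \<nu>. abs_powr (u x - u y) p * indicator Q x
              \<le> G x * indicator Q x + G y * indicator Q x"
        using AE_not_in[OF E']
      proof eventually_elim
        case (elim x)
        show ?case
          using osc'[of x y] y(1) QX elim Q(3)[of x y] by (cases "x \<in> Q") auto
      qed
    qed
    also have "\<dots> = (\<integral>\<^sup>+x\<in>Q. G x \<partial>\<nu>) + G y * emeasure \<nu> Q"
      by (subst nn_integral_add) (auto simp: nn_integral_cmult_indicator sets)
    also have "\<dots> \<le> ennreal C * (\<integral>\<^sup>+x\<in>Q. G x \<partial>\<mu>) + G y * (ennreal C * emeasure \<mu> Q)"
      using le Q(1) by (intro add_mono nn_integral_le_cmult_measure[OF sets le] mult_left_mono) auto
    also have "G y * (ennreal C * emeasure \<mu> Q) \<le> ennreal C * (\<integral>\<^sup>+x\<in>Q. G x \<partial>\<mu>)"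
      using mult_left_mono[OF y(2), of "ennreal C"] by (simp add: mult.left_commute)
    finally have "(\<integral>\<^sup>+x\<in>Q. abs_powr (u x - u y) p \<partial>\<nu>)
        \<le> ennreal C * (\<integral>\<^sup>+x\<in>Q. G x \<partial>\<mu>) + ennreal C * (\<integral>\<^sup>+x\<in>Q. G x \<partial>\<mu>)"
      by (simp add: add_left_mono)
    then show ?thesis
      by (intro exI[of _ "u y"]) (simp add: mult_2 distrib_left)
  qed
qed

lemma ennreal_powr_add3_le:
  assumes "0 \<le> p"
  shows "ennreal_powr (a + b + c) p
     \<le> ennreal (4 powr p) * (ennreal_powr a p + ennreal_powr b p + ennreal_powr c p)"
proof -
  have "ennreal_powr (a + b + c) p \<le> ennreal (2 powr p) * (ennreal_powr (a + b) p + ennreal_powr c p)"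
    using assms by (rule ennreal_powr_add_le)
  also have "\<dots> \<le> ennreal (2 powr p) * (ennreal (2 powr p) * (ennreal_powr a p + ennreal_powr b p) +
                                         ennreal (2 powr p) * ennreal_powr c p)"
  proof (intro mult_left_mono add_mono ennreal_powr_add_le assms)
    have "1 * ennreal_powr c p \<le> ennreal (2 powr p) * ennreal_powr c p"
      using assms by (intro mult_right_mono) (auto simp: ge_one_powr_ge_zero)
    then show "ennreal_powr c p \<le> ennreal (2 powr p) * ennreal_powr c p" by simp
  qed auto
  also have "\<dots> = ennreal (2 powr p * 2 powr p) * (ennreal_powr a p + ennreal_powr b p + ennreal_powr c p)"
    by (simp add: ennreal_mult distrib_left mult.assoc)
  also have "2 powr p * 2 powr p = (4::real) powr p"
    by (simp add: powr_mult[symmetric])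
  finally show ?thesis .
qed

lemma ennreal_abs_triangle3: "ennreal \<bar>x - y\<bar> \<le> ennreal \<bar>x - a\<bar> + ennreal \<bar>y - b\<bar> + ennreal \<bar>a - b\<bar>"
  by (simp add: ennreal_plus[symmetric] ennreal_leI del: ennreal_plus)

text \<open>Each \<open>u\<close> is encoded by its rounded constants on the cells. The constants are uniformly bounded
  because the \<open>L\<^sup>p\<close> norms are, so there are finitely many codes; picking one function per code gives
  a net consisting of members of \<open>W\<close>.\<close>

lemma finite_net_of_cells:
  fixes d :: "'a \<Rightarrow> 'a \<Rightarrow> real" and Q :: "nat \<Rightarrow> 'a set"
  assumes sets: "sets \<nu> = sets \<mu>" and C: "0 < C"
    and le: "\<forall>A\<in>sets \<mu>. emeasure \<nu> A \<le> ennreal C * emeasure \<mu> A"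
    and p: "0 < p" and M: "M < top" and eta: "0 < \<eta>"
    and W: "W \<subseteq> borel_measurable \<mu>" "\<And>u. u \<in> W \<Longrightarrow> Lp_mass \<mu> p u \<le> M"
    and osc: "\<And>u. u \<in> W \<Longrightarrow> \<exists>G. oscillation_bound d \<mu> p s \<eta> u G"
    and disj: "disjoint_family_on Q {..<N}"
    and Q: "\<And>i. i < N \<Longrightarrow> Q i \<in> sets \<mu>" "\<And>i. i < N \<Longrightarrow> emeasure \<mu> (Q i) < top"
      "\<And>i x y. i < N \<Longrightarrow> x \<in> Q i \<Longrightarrow> y \<in> Q i \<Longrightarrow> d x y < s"
    and tail: "\<And>u. u \<in> W \<Longrightarrow>
      (\<integral>\<^sup>+x\<in>space \<mu> - (\<Union>i<N. Q i). abs_powr (u x) p \<partial>\<nu>) \<le> ennreal \<eta>"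
  shows "\<exists>F. finite F \<and> F \<subseteq> W \<and> (\<forall>u\<in>W. \<exists>v\<in>F.
      (Lp_mass \<nu> p (\<lambda>x. u x - v x)) \<le> ennreal (4 powr p * (4 * C + 3) * \<eta>))"
proof -
  note [measurable_cong] = sets
  have space: "space \<nu> = space \<mu>" using sets by (rule sets_eq_imp_space_eq)
  have [measurable]: "Q i \<in> sets \<mu>" if "i < N" for i using Q(1) that .
  have Wm[measurable]: "u \<in> borel_measurable \<mu>" if "u \<in> W" for u using W that by auto
  obtain G where G: "\<And>u. u \<in> W \<Longrightarrow> oscillation_bound d \<mu> p s \<eta> u (G u)"
    using bchoice[of W "\<lambda>u G. oscillation_bound d \<mu> p s \<eta> u G"] osc by blast
  then have Gm[measurable]: "G u \<in> borel_measurable \<mu>" and Gint: "(\<integral>\<^sup>+x. G u x \<partial>\<mu>) \<le> ennreal \<eta>" if "u \<in> W" for u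
    using that by (auto simp: oscillation_bound_def)
  have "\<exists>c. (\<integral>\<^sup>+x\<in>Q i. abs_powr (u x - c) p \<partial>\<nu>) \<le> ennreal C * (2 * (\<integral>\<^sup>+x\<in>Q i. G u x \<partial>\<mu>))
          \<and> (emeasure \<nu> (Q i) = 0 \<longrightarrow> c = 0)" if "u \<in> W" "i < N" for u i
  proof (cases "emeasure \<nu> (Q i) = 0")
    case True
    then have "Q i \<in> null_sets \<nu>" using Q(1)[OF that(2)] sets by auto
    then have "(\<integral>\<^sup>+x\<in>Q i. abs_powr (u x - 0) p \<partial>\<nu>) = 0"
      by (rule nn_integral_null_set)
    then show ?thesis by (metis zero_le)
  next
    case False
    then show ?thesis
      using ex_cell_constant[OF sets le G[OF that(1)] Q(1)[OF that(2)] Q(2)[OF that(2)] Q(3)[OF that(2)]] by auto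
  qed
  note ex_c = this
  define c where "c = (\<lambda>u i. SOME c. (\<integral>\<^sup>+x\<in>Q i. abs_powr (u x - c) p \<partial>\<nu>)
        \<le> ennreal C * (2 * (\<integral>\<^sup>+x\<in>Q i. G u x \<partial>\<mu>)) \<and> (emeasure \<nu> (Q i) = 0 \<longrightarrow> c = 0))"
  have c: "\<And>u i. u \<in> W \<Longrightarrow> i < N \<Longrightarrow>
        (\<integral>\<^sup>+x\<in>Q i. abs_powr (u x - c u i) p \<partial>\<nu>) \<le> ennreal C * (2 * (\<integral>\<^sup>+x\<in>Q i. G u x \<partial>\<mu>))"
      and c0: "\<And>u i. u \<in> W \<Longrightarrow> i < N \<Longrightarrow> emeasure \<nu> (Q i) = 0 \<Longrightarrow> c u i = 0"
    using someI_ex[OF ex_c] unfolding c_def by blast+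
  have \<nu>Q: "emeasure \<nu> (Q i) < top" if "i < N" for i
  proof -
    have "emeasure \<nu> (Q i) \<le> ennreal C * emeasure \<mu> (Q i)" using le Q(1)[OF that] by blast
    also have "\<dots> < top" using Q(2)[OF that] by (intro ennreal_mult_less_topI) auto
    finally show ?thesis .
  qed
  have bdd: "\<exists>R. \<forall>u\<in>W. \<bar>c u i\<bar> \<le> R" if i: "i < N" for i
  proof (cases "emeasure \<nu> (Q i) = 0")
    case True
    then show ?thesis using c0 i by (intro exI[of _ 0]) auto
  next
    case False
    define B where "B = ennreal (2 powr p) * (ennreal C * (2 * ennreal \<eta>) + ennreal C * M)"
    have B: "B < top"
      unfolding B_def using M by (intro ennreal_mult_less_topI iffD2[OF ennreal_add_less_top] conjI) auto
    have *: "abs_powr (c u i) p * emeasure \<nu> (Q i) \<le> B" if u: "u \<in> W" for u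
    proof -
      have [measurable]: "u \<in> borel_measurable \<nu>" "Q i \<in> sets \<nu>"
        using Wm[OF u] Q(1)[OF i] by (simp_all add: measurable_cong_sets[OF sets refl] sets)
      have "abs_powr (c u i) p * emeasure \<nu> (Q i)
          = (\<integral>\<^sup>+x\<in>Q i. abs_powr (c u i) p \<partial>\<nu>)"
        by (simp add: nn_integral_cmult_indicator)
      also have "\<dots> \<le> (\<integral>\<^sup>+x. ennreal (2 powr p) * (abs_powr (u x - c u i) p * indicator (Q i) x
            + abs_powr (u x) p) \<partial>\<nu>)"
      proof (intro nn_integral_mono)
        fix x
        have "ennreal \<bar>c u i\<bar> \<le> ennreal \<bar>u x - c u i\<bar> + ennreal \<bar>u x\<bar>"
          by (simp add: ennreal_plus[symmetric] ennreal_leI del: ennreal_plus)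
        then have "abs_powr (c u i) p
            \<le> ennreal (2 powr p) * (abs_powr (u x - c u i) p + abs_powr (u x) p)"
          using p by (intro order_trans[OF ennreal_powr_mono ennreal_powr_add_le]) auto
        then show "abs_powr (c u i) p * indicator (Q i) x
            \<le> ennreal (2 powr p) * (abs_powr (u x - c u i) p * indicator (Q i) x
               + abs_powr (u x) p)"
          by (auto split: split_indicator)
      qed
      also have "\<dots> = ennreal (2 powr p) * ((\<integral>\<^sup>+x\<in>Q i. abs_powr (u x - c u i) p \<partial>\<nu>)
            + (Lp_mass \<nu> p u))"
        by (subst nn_integral_cmult, measurable, subst nn_integral_add, measurable)
      also have "\<dots> \<le> B"
        unfolding B_def
      proof (intro mult_left_mono add_mono)
        have "(\<integral>\<^sup>+x\<in>Q i. G u x \<partial>\<mu>) \<le> (\<integral>\<^sup>+x. G u x \<partial>\<mu>)"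
          by (intro nn_integral_mono) (auto split: split_indicator)
        then have "(\<integral>\<^sup>+x\<in>Q i. G u x \<partial>\<mu>) \<le> ennreal \<eta>" using Gint[OF u] by (rule order_trans)
        then show "(\<integral>\<^sup>+x\<in>Q i. abs_powr (u x - c u i) p \<partial>\<nu>) \<le> ennreal C * (2 * ennreal \<eta>)"
          by (intro order_trans[OF c[OF u i]] mult_left_mono) auto
        show "Lp_mass \<nu> p u \<le> ennreal C * M"
          using W(2)[OF u] by (intro order_trans[OF nn_integral_le_cmult_measure[OF sets le]] mult_left_mono) auto
      qed auto
      finally show ?thesis .
    qed
    obtain b where b: "B = ennreal b" "0 \<le> b" using B by (rule ennreal_less_topE)
    obtain v where v: "emeasure \<nu> (Q i) = ennreal v" "0 \<le> v" using \<nu>Q[OF i] by (rule ennreal_less_topE)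
    have v0: "0 < v" using v False by (cases "v = 0") auto
    have "\<bar>c u i\<bar> \<le> (b / v) powr (1 / p)" if "u \<in> W" for u
    proof -
      have "\<bar>c u i\<bar> powr p * v \<le> b"
        using *[OF that] b v by (simp add: ennreal_powr_ennreal ennreal_mult[symmetric])
      then have "\<bar>c u i\<bar> powr p \<le> b / v" using v0 by (simp add: field_simps)
      then have "(\<bar>c u i\<bar> powr p) powr (1 / p) \<le> (b / v) powr (1 / p)"
        using p by (intro powr_mono2) auto
      then show ?thesis using p by (simp add: powr_powr)
    qed
    then show ?thesis by blast
  qed
  define V where "V = (\<Sum>i<N. measure \<nu> (Q i))"
  have V: "0 \<le> V" "(\<Sum>i<N. emeasure \<nu> (Q i)) = ennreal V"
    using \<nu>Q by (auto simp: V_def sum_nonneg emeasure_eq_ennreal_measure less_top[symmetric])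
  \<comment> \<open>The mesh of the rounding: an error \<open>\<tau>\<close> on all cells together costs at most \<open>\<eta>\<close>.\<close>
  define \<tau> where "\<tau> = (\<eta> / (V + 1)) powr (1 / p)"
  have \<tau>: "0 < \<tau>" "\<tau> powr p * V \<le> \<eta>"
    using eta V p by (auto simp: \<tau>_def powr_powr field_simps)
  define code where "code = (\<lambda>u. restrict (\<lambda>i. \<lfloor>c u i / \<tau>\<rfloor>) {..<N})"
  obtain R where R: "\<And>i u. i < N \<Longrightarrow> u \<in> W \<Longrightarrow> \<bar>c u i\<bar> \<le> R i"
      using bchoice[of "{..<N}" "\<lambda>i R. \<forall>u\<in>W. \<bar>c u i\<bar> \<le> R"] bdd by (metis lessThan_iff)
  have "finite (code ` W)"
  proof (rule finite_subset)
    show "code ` W \<subseteq> PiE {..<N} (\<lambda>i. {\<lfloor>- R i / \<tau>\<rfloor>..\<lfloor>R i / \<tau>\<rfloor>})"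
    proof (clarsimp simp: code_def PiE_iff)
      fix u i assume "u \<in> W" "i < N"
      then have "- R i \<le> c u i" "c u i \<le> R i" using R[of i u] by auto
      then show "\<lfloor>- (R i / \<tau>)\<rfloor> \<le> \<lfloor>c u i / \<tau>\<rfloor> \<and> \<lfloor>c u i / \<tau>\<rfloor> \<le> \<lfloor>R i / \<tau>\<rfloor>"
        using \<tau> by (auto intro!: floor_mono divide_right_mono simp: minus_divide_left simp del: minus_divide_left[symmetric])
    qed
    show "finite (PiE {..<N} (\<lambda>i. {\<lfloor>- R i / \<tau>\<rfloor>..\<lfloor>R i / \<tau>\<rfloor>}))"
      by (intro finite_PiE) auto
  qed
  then obtain F where F: "F \<subseteq> W" "finite F" "code ` W = code ` F"
    by (meson finite_subset_image subset_refl)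
  have "Lp_mass \<nu> p (\<lambda>x. u x - v x) \<le> ennreal (4 powr p * (4 * C + 3) * \<eta>)"
    if u: "u \<in> W" and v: "v \<in> W" and uv: "code u = code v" for u v
  proof -
    have [measurable]: "u \<in> borel_measurable \<nu>" "v \<in> borel_measurable \<nu>"
      using Wm[OF u] Wm[OF v] by (simp_all add: measurable_cong_sets[OF sets refl])
    have Qm: "Q i \<in> sets \<nu>" if "i < N" for i using Q(1)[OF that] sets by simp
    define Z where "Z = space \<mu> - (\<Union>i<N. Q i)"
    have [measurable]: "Z \<in> sets \<nu>" unfolding Z_def using Q(1) sets by auto
    have close: "\<bar>c u i - c v i\<bar> \<le> \<tau>" if "i < N" for i
    proof -
      have "\<lfloor>c u i / \<tau>\<rfloor> = \<lfloor>c v i / \<tau>\<rfloor>"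
        using fun_cong[OF uv, of i] that by (simp add: code_def)
      then have "\<bar>c u i / \<tau> - c v i / \<tau>\<bar> \<le> 1" by linarith
      then show ?thesis using \<tau> by (simp add: diff_divide_distrib[symmetric] abs_le_iff field_simps)
    qed
    define f where "f = (\<lambda>x. abs_powr (u x - v x) p)"
    define a where "a = (\<lambda>w i x. abs_powr (w x - c w i) p * indicator (Q i) x)"
    have am: "a w i \<in> borel_measurable \<nu>" if "w \<in> W" "i < N" for w i
    proof -
      have [measurable]: "w \<in> borel_measurable \<nu>" using Wm[OF that(1)] by (simp add: measurable_cong_sets[OF sets refl])
      have [measurable]: "Q i \<in> sets \<nu>" using Qm[OF that(2)] .
      show ?thesis unfolding a_def by measurable
    qed
    define K where "K = ennreal (4 powr p)"
    have fm[measurable]: "f \<in> borel_measurable \<nu>" unfolding f_def by measurable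
    have fZ: "f x * indicator Z x \<le> K * (abs_powr (u x) p * indicator Z x + abs_powr (v x) p * indicator Z x)" for x
    proof -
      have "f x \<le> K * (abs_powr (u x - 0) p + abs_powr (v x - 0) p + abs_powr (0 - 0) p)"
        unfolding f_def K_def using p
        by (intro order_trans[OF ennreal_powr_mono ennreal_powr_add3_le] ennreal_abs_triangle3) auto
      then show ?thesis by (auto split: split_indicator)
    qed
    have fQ: "f x * indicator (Q i) x \<le> K * (a u i x + a v i x + ennreal (\<tau> powr p) * indicator (Q i) x)" if i: "i < N" for i x
    proof -
      have "f x \<le> K * (abs_powr (u x - c u i) p + abs_powr (v x - c v i) p + abs_powr (c u i - c v i) p)"
        unfolding f_def K_def using p
        by (intro order_trans[OF ennreal_powr_mono ennreal_powr_add3_le] ennreal_abs_triangle3) auto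
      also have "abs_powr (c u i - c v i) p \<le> ennreal (\<tau> powr p)"
        using close[OF i] p by (simp add: ennreal_powr_ennreal ennreal_leI powr_mono2)
      finally show ?thesis
        by (auto split: split_indicator simp: a_def add_left_mono mult_left_mono)
    qed
    have "(\<integral>\<^sup>+x. f x \<partial>\<nu>) \<le> (\<integral>\<^sup>+x. f x * indicator Z x + (\<Sum>i<N. f x * indicator (Q i) x) \<partial>\<nu>)"
    proof (rule nn_integral_mono)
      fix x assume "x \<in> space \<nu>"
      show "f x \<le> f x * indicator Z x + (\<Sum>i<N. f x * indicator (Q i) x)"
      proof (cases "x \<in> Z")
        case False
        then obtain i where i: "i < N" "x \<in> Q i" using \<open>x \<in> space \<nu>\<close> space by (auto simp: Z_def)
        then have "f x \<le> (\<Sum>i<N. f x * indicator (Q i) x)"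
          using member_le_sum[of i "{..<N}" "\<lambda>i. f x * indicator (Q i) x"] by auto
        then show ?thesis using False by simp
      qed simp
    qed
    also have "\<dots> = (\<integral>\<^sup>+x\<in>Z. f x \<partial>\<nu>) + (\<Sum>i<N. \<integral>\<^sup>+x\<in>Q i. f x \<partial>\<nu>)"
    proof -
      have m: "(\<lambda>x. f x * indicator (Q i) x) \<in> borel_measurable \<nu>" if "i \<in> {..<N}" for i
        using Qm[of i] that by (intro borel_measurable_times_ennreal fm borel_measurable_indicator) auto
      have "(\<integral>\<^sup>+x. (\<Sum>i<N. f x * indicator (Q i) x) \<partial>\<nu>) = (\<Sum>i<N. \<integral>\<^sup>+x\<in>Q i. f x \<partial>\<nu>)"
        using m by (rule nn_integral_sum)
      moreover have "(\<lambda>x. \<Sum>i<N. f x * indicator (Q i) x) \<in> borel_measurable \<nu>"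
        using m by (rule borel_measurable_sum)
      ultimately show ?thesis
        by (subst nn_integral_add) (auto simp del: sum_mult_indicator)
    qed
    also have "\<dots> \<le> K * (ennreal \<eta> + ennreal \<eta>)
        + (\<Sum>i<N. K * (ennreal C * (2 * (\<integral>\<^sup>+x\<in>Q i. G u x \<partial>\<mu>)) + ennreal C * (2 * (\<integral>\<^sup>+x\<in>Q i. G v x \<partial>\<mu>))
                     + ennreal (\<tau> powr p) * emeasure \<nu> (Q i)))"
    proof (intro add_mono sum_mono)
      have "(\<integral>\<^sup>+x\<in>Z. f x \<partial>\<nu>) \<le> (\<integral>\<^sup>+x. K * (abs_powr (u x) p * indicator Z x + abs_powr (v x) p * indicator Z x) \<partial>\<nu>)"
        using fZ by (intro nn_integral_mono) auto
      also have "\<dots> = K * ((\<integral>\<^sup>+x\<in>Z. abs_powr (u x) p \<partial>\<nu>) + (\<integral>\<^sup>+x\<in>Z. abs_powr (v x) p \<partial>\<nu>))"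
        by (subst nn_integral_cmult, measurable, subst nn_integral_add, measurable)
      also have "\<dots> \<le> K * (ennreal \<eta> + ennreal \<eta>)"
        using tail[OF u] tail[OF v] by (intro mult_left_mono add_mono) (auto simp: Z_def)
      finally show "(\<integral>\<^sup>+x\<in>Z. f x \<partial>\<nu>) \<le> K * (ennreal \<eta> + ennreal \<eta>)" .
    next
      fix i assume "i \<in> {..<N}"
      then have i: "i < N" by simp
      have [measurable]: "Q i \<in> sets \<nu>" "a u i \<in> borel_measurable \<nu>" "a v i \<in> borel_measurable \<nu>"
        using Qm i am u v by auto
      have "(\<integral>\<^sup>+x\<in>Q i. f x \<partial>\<nu>) \<le> (\<integral>\<^sup>+x. K * (a u i x + a v i x + ennreal (\<tau> powr p) * indicator (Q i) x) \<partial>\<nu>)"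
        using fQ[OF i] by (intro nn_integral_mono) auto
      also have "\<dots> = K * ((\<integral>\<^sup>+x. a u i x \<partial>\<nu>) + (\<integral>\<^sup>+x. a v i x \<partial>\<nu>) + ennreal (\<tau> powr p) * emeasure \<nu> (Q i))"
        by (simp add: nn_integral_cmult nn_integral_add)
      also have "\<dots> \<le> K * (ennreal C * (2 * (\<integral>\<^sup>+x\<in>Q i. G u x \<partial>\<mu>)) + ennreal C * (2 * (\<integral>\<^sup>+x\<in>Q i. G v x \<partial>\<mu>))
                     + ennreal (\<tau> powr p) * emeasure \<nu> (Q i))"
        using c[OF u i] c[OF v i] by (intro mult_left_mono add_mono) (auto simp: a_def)
      finally show "(\<integral>\<^sup>+x\<in>Q i. f x \<partial>\<nu>) \<le> \<dots>" .
    qed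
    also have "\<dots> = K * ((ennreal \<eta> + ennreal \<eta>) + (ennreal C * (2 * (\<Sum>i<N. \<integral>\<^sup>+x\<in>Q i. G u x \<partial>\<mu>))
        + ennreal C * (2 * (\<Sum>i<N. \<integral>\<^sup>+x\<in>Q i. G v x \<partial>\<mu>)) + ennreal (\<tau> powr p) * (\<Sum>i<N. emeasure \<nu> (Q i))))"
      by (simp add: sum_distrib_left[symmetric] sum.distrib distrib_left)
    also have "\<dots> \<le> K * ((ennreal \<eta> + ennreal \<eta>) + (ennreal C * (2 * ennreal \<eta>)
        + ennreal C * (2 * ennreal \<eta>) + ennreal \<eta>))"
    proof -
      have *: "(\<Sum>i<N. \<integral>\<^sup>+x\<in>Q i. G w x \<partial>\<mu>) \<le> ennreal \<eta>" if w: "w \<in> W" for w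
      proof -
        have "(\<Sum>i<N. \<integral>\<^sup>+x\<in>Q i. G w x \<partial>\<mu>) = (\<integral>\<^sup>+x. (\<Sum>i<N. G w x * indicator (Q i) x) \<partial>\<mu>)"
          using Gm[OF w] Q(1) by (subst nn_integral_sum) auto
        also have "\<dots> \<le> (\<integral>\<^sup>+x. G w x \<partial>\<mu>)"
        proof (rule nn_integral_mono)
          fix x
          have "(\<Sum>i<N. indicator (Q i) x :: ennreal) = indicator (\<Union>i<N. Q i) x"
            using disj by (subst indicator_UN_disjoint) auto
          also have "\<dots> \<le> 1" by (auto split: split_indicator)
          finally show "(\<Sum>i<N. G w x * indicator (Q i) x) \<le> G w x"
            using mult_left_mono[of _ 1 "G w x"] by (simp add: sum_distrib_left[symmetric])
        qed
        finally show ?thesis using Gint[OF w] by simp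
      qed
      have "ennreal (\<tau> powr p) * (\<Sum>i<N. emeasure \<nu> (Q i)) \<le> ennreal \<eta>"
        unfolding V(2) using \<tau> V by (simp add: ennreal_mult[symmetric] ennreal_leI)
      then show ?thesis
        using *[OF u] *[OF v] by (intro mult_left_mono add_mono) auto
    qed
    also have "\<dots> = ennreal (4 powr p * (4 * C + 3) * \<eta>)"
    proof -
      have "ennreal C * (2 * ennreal \<eta>) = ennreal (C * (2 * \<eta>))"
        using C eta by (simp add: ennreal_mult)
      then show ?thesis
        unfolding K_def using C eta
        by (simp add: ennreal_plus[symmetric] ennreal_mult[symmetric] algebra_simps del: ennreal_plus)
    qed
    finally show ?thesis by (simp add: f_def)
  qed
  moreover have "\<exists>v\<in>F. code u = code v" if "u \<in> W" for u
    using F(3) that by (metis imageE imageI)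
  ultimately show ?thesis using F by (intro exI[of _ F]) blast
qed

text \<open>The common ground of the two sufficient conditions for compactness: total boundedness and the
  kernel conditions (i), (ii) both imply it. The cells must be small (\<open>s\<close>) to make \<open>u\<close> nearly
  constant on them and carry almost all of the mass (\<open>\<eta>\<close>).\<close>

definition uniformly_tight_cells ::
  "('a \<Rightarrow> 'a \<Rightarrow> real) \<Rightarrow> 'a measure \<Rightarrow> 'a measure \<Rightarrow> real \<Rightarrow> real \<Rightarrow> bool" where
  "uniformly_tight_cells d \<mu> \<nu> \<alpha> p \<longleftrightarrow>
     (\<forall>M<top. \<forall>s>0. \<forall>\<eta>>0. \<exists>(N::nat) Q. disjoint_family_on Q {..<N} \<and>
        (\<forall>i<N. Q i \<in> sets \<mu> \<and> emeasure \<mu> (Q i) < top \<and> (\<forall>x\<in>Q i. \<forall>y\<in>Q i. d x y < s)) \<and>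
        (\<forall>u\<in>weak_hajlasz_ball d \<mu> \<alpha> p M.
           (\<integral>\<^sup>+x\<in>space \<mu> - (\<Union>i<N. Q i). abs_powr (u x) p \<partial>\<nu>) \<le> ennreal \<eta>))"

lemma weak_ball_finite_net:
  fixes d :: "'a \<Rightarrow> 'a \<Rightarrow> real"
  assumes sets: "sets \<nu> = sets \<mu>" and C: "0 < C"
    and le: "\<forall>A\<in>sets \<mu>. emeasure \<nu> A \<le> ennreal C * emeasure \<mu> A"
    and qm: "quasi_metric (space \<mu>) d" and p: "0 < p" and a: "0 < \<alpha>" and M: "M < top" and eta: "0 < \<eta>"
    and W: "W \<subseteq> weak_hajlasz_ball d \<mu> \<alpha> p M"
    and cells: "uniformly_tight_cells d \<mu> \<nu> \<alpha> p"
  shows "\<exists>F. finite F \<and> F \<subseteq> W \<and> (\<forall>u\<in>W. \<exists>v\<in>F.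
      (Lp_mass \<nu> p (\<lambda>x. u x - v x)) \<le> ennreal \<eta>)"
proof -
  define K where "K = 4 powr p * (4 * C + 3)"
  have K: "0 < K" unfolding K_def using C by (intro mult_pos_pos) auto
  have e: "0 < \<eta> / K" using eta K by simp
  obtain s where s: "0 < s" "\<And>u. u \<in> weak_hajlasz_ball d \<mu> \<alpha> p M \<Longrightarrow> \<exists>G. oscillation_bound d \<mu> p s (\<eta> / K) u G"
    using weak_imp_oscillation_bound[OF qm p a M e] by blast
  obtain N :: nat and Q where *: "disjoint_family_on Q {..<N} \<and>
        (\<forall>i<N. Q i \<in> sets \<mu> \<and> emeasure \<mu> (Q i) < top \<and> (\<forall>x\<in>Q i. \<forall>y\<in>Q i. d x y < s)) \<and>
        (\<forall>u\<in>weak_hajlasz_ball d \<mu> \<alpha> p M.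
           (\<integral>\<^sup>+x\<in>space \<mu> - (\<Union>i<N. Q i). abs_powr (u x) p \<partial>\<nu>) \<le> ennreal (\<eta> / K))"
    using cells[unfolded uniformly_tight_cells_def, rule_format, OF M s(1) e] by (elim exE)
  note Q = conjunct1[OF *] conjunct2[OF *]
  have "\<exists>F. finite F \<and> F \<subseteq> W \<and> (\<forall>u\<in>W. \<exists>v\<in>F.
      (Lp_mass \<nu> p (\<lambda>x. u x - v x)) \<le> ennreal (4 powr p * (4 * C + 3) * (\<eta> / K)))"
  proof (rule finite_net_of_cells[where Q=Q and N=N and M=M and s=s and d=d, OF sets C le p M e])
    show "W \<subseteq> borel_measurable \<mu>" "\<And>u. u \<in> W \<Longrightarrow> Lp_mass \<mu> p u \<le> M"
      using W by (auto simp: weak_hajlasz_ball_def)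
  qed (use Q s(2) W in auto)
  moreover have "4 powr p * (4 * C + 3) * (\<eta> / K) = \<eta>"
    using K C by (simp add: K_def)
  ultimately show ?thesis by simp
qed

text \<open>The net in \<open>L\<^sup>p(\<nu>)\<close> consists of members of the bounded set itself. Differences \<open>u - v\<close> therefore
  stay in the coarse class, which is where a small \<open>L\<^sup>p\<close> norm yields a small target norm.\<close>

lemma compact_embeddingI:
  fixes d :: "'a \<Rightarrow> 'a \<Rightarrow> real"
  assumes sets: "sets \<nu> = sets \<mu>" and C: "0 < C"
    and le: "\<forall>A\<in>sets \<mu>. emeasure \<nu> A \<le> ennreal C * emeasure \<mu> A"
    and qm: "quasi_metric (space \<mu>) d" and p: "0 < p" and a: "0 < \<alpha>"
    and cells: "uniformly_tight_cells d \<mu> \<nu> \<alpha> p"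
    and n1: "\<And>u K. u \<in> borel_measurable \<mu> \<Longrightarrow> n1 \<mu> u \<le> ennreal K \<Longrightarrow>
          u \<in> weak_hajlasz_ball d \<mu> \<alpha> p (ennreal_powr (ennreal K + 1) p)"
    and n2_finite: "\<And>u M. u \<in> weak_hajlasz_ball d \<nu> \<alpha> p M \<Longrightarrow> M < top \<Longrightarrow> n2 \<nu> u < top"
    and n2_small: "\<And>M \<epsilon>::real. M < top \<Longrightarrow> 0 < \<epsilon> \<Longrightarrow>
          \<exists>\<eta>>0::real. \<forall>w\<in>weak_hajlasz_ball d \<nu> \<alpha> p M.
             (Lp_mass \<nu> p w) \<le> ennreal \<eta> \<longrightarrow> n2 \<nu> w < ennreal \<epsilon>"
  shows "compact_embedding \<mu> n1 \<nu> n2"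
proof -
  have bm: "borel_measurable \<nu> = (borel_measurable \<mu> :: ('a \<Rightarrow> real) set)"
    using sets by (intro measurable_cong_sets) auto
  have sub: "finite_norm_space \<mu> n1 \<subseteq> finite_norm_space \<nu> n2"
  proof
    fix u assume u: "u \<in> finite_norm_space \<mu> n1"
    then have "u \<in> borel_measurable \<mu>" "n1 \<mu> u < top" by (auto simp: finite_norm_space_def)
    moreover then obtain K where "n1 \<mu> u = ennreal K" by (auto elim: ennreal_less_topE)
    ultimately have "u \<in> weak_hajlasz_ball d \<mu> \<alpha> p (ennreal_powr (ennreal K + 1) p)"
      by (intro n1) auto
    then have "n2 \<nu> u < top"
      by (intro n2_finite[OF weak_hajlasz_ball_le_measure[OF sets le]] ennreal_mult_less_topI) auto
    then show "u \<in> finite_norm_space \<nu> n2"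
      using \<open>u \<in> borel_measurable \<mu>\<close> by (simp add: finite_norm_space_def bm)
  qed
  have ae: "AE x in \<nu>. P x" if P: "AE x in \<mu>. P x" for P
  proof -
    obtain E where "{x \<in> space \<mu>. \<not> P x} \<subseteq> E" "emeasure \<mu> E = 0" "E \<in> sets \<mu>"
      using AE_E[OF P] by blast
    moreover then have "E \<in> null_sets \<mu>" by auto
    ultimately show ?thesis
      using null_sets_le_cmult_measure[OF sets le] sets_eq_imp_space_eq[OF sets]
      by (intro AE_I'[of E]) auto
  qed
  have "\<exists>F. finite F \<and> F \<subseteq> finite_norm_space \<nu> n2 \<and> (\<forall>u\<in>B. \<exists>v\<in>F. n2 \<nu> (\<lambda>x. u x - v x) < ennreal \<epsilon>)"
    if B: "B \<subseteq> finite_norm_space \<mu> n1" and K: "\<forall>u\<in>B. n1 \<mu> u \<le> ennreal K" and eps: "0 < \<epsilon>" for B K and \<epsilon> :: real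
  proof -
    define M where "M = ennreal_powr (ennreal K + 1) p"
    have M: "M < top" by (simp add: M_def)
    define M' where "M' = ennreal C * (ennreal (2 powr p) * (M + M))"
    have M': "M' < top" unfolding M'_def using M by (intro ennreal_mult_less_topI) auto
    have W: "B \<subseteq> weak_hajlasz_ball d \<mu> \<alpha> p M"
      using B K n1 unfolding M_def finite_norm_space_def by blast
    obtain \<eta> :: real where eta: "0 < \<eta>" "\<And>w. w \<in> weak_hajlasz_ball d \<nu> \<alpha> p M' \<Longrightarrow>
        (Lp_mass \<nu> p w) \<le> ennreal \<eta> \<Longrightarrow> n2 \<nu> w < ennreal \<epsilon>"
      using n2_small[OF M' eps] by blast
    obtain F where F: "finite F" "F \<subseteq> B" "\<And>u. u \<in> B \<Longrightarrow> \<exists>v\<in>F.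
      (Lp_mass \<nu> p (\<lambda>x. u x - v x)) \<le> ennreal \<eta>"
      using weak_ball_finite_net[OF sets C le qm p a M eta(1) W cells] by blast
    have "\<exists>v\<in>F. n2 \<nu> (\<lambda>x. u x - v x) < ennreal \<epsilon>" if u: "u \<in> B" for u
    proof -
      obtain v where v: "v \<in> F" "Lp_mass \<nu> p (\<lambda>x. u x - v x) \<le> ennreal \<eta>"
        using F(3)[OF u] by blast
      have "(\<lambda>x. u x - v x) \<in> weak_hajlasz_ball d \<nu> \<alpha> p M'"
        unfolding M'_def using u v F(2) W p
        by (intro weak_hajlasz_ball_le_measure[OF sets le] weak_hajlasz_ball_diff) auto
      then show ?thesis using eta(2)[OF _ v(2)] v(1) by (intro bexI[of _ v])
    qed
    then show ?thesis
      using F(1) subset_trans[OF F(2) subset_trans[OF B sub]] by (intro exI[of _ F]) simp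
  qed
  then show ?thesis
    unfolding compact_embedding_def using sub by (intro conjI allI ballI impI ae) auto
qed

lemma compact_embeddings_if_tight:
  fixes d :: "'a \<Rightarrow> 'a \<Rightarrow> real"
  assumes sets: "sets \<nu> = sets \<mu>" and C: "0 < C"
    and le: "\<forall>A\<in>sets \<mu>. emeasure \<nu> A \<le> ennreal C * emeasure \<mu> A"
    and qm: "quasi_metric (space \<mu>) d"
    and pq: "0 < p" "0 < \<alpha>" "0 < q" "0 < r" "0 < \<beta>" "\<beta> < \<alpha>"
    and cells: "uniformly_tight_cells d \<mu> \<nu> \<alpha> p"
  shows "compact_embedding \<mu> (hajlasz_TL_norm d \<alpha> p q) \<nu> (hajlasz_TL_norm d \<beta> p r)"
    "compact_embedding \<mu> (hajlasz_TL_norm d \<alpha> p q) \<nu> (hajlasz_Besov_norm d \<beta> p r)"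
    "compact_embedding \<mu> (hajlasz_Besov_norm d \<alpha> p q) \<nu> (hajlasz_TL_norm d \<beta> p r)"
    "compact_embedding \<mu> (hajlasz_Besov_norm d \<alpha> p q) \<nu> (hajlasz_Besov_norm d \<beta> p r)"
proof -
  note n1 = TL_norm_imp_weak[OF pq(1,3)] Besov_norm_imp_weak[OF pq(1,3)]
  note fin = weak_imp_finite_norm[OF pq(1,4,5,6)]
  have small: "\<exists>\<eta>>0::real. \<forall>w\<in>weak_hajlasz_ball d \<nu> \<alpha> p M.
      (Lp_mass \<nu> p w) \<le> ennreal \<eta> \<longrightarrow> hajlasz_TL_norm d \<beta> p r \<nu> w < ennreal \<epsilon>"
    "\<exists>\<eta>>0::real. \<forall>w\<in>weak_hajlasz_ball d \<nu> \<alpha> p M.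
      (Lp_mass \<nu> p w) \<le> ennreal \<eta> \<longrightarrow> hajlasz_Besov_norm d \<beta> p r \<nu> w < ennreal \<epsilon>"
    if "M < top" "0 < \<epsilon>" for M and \<epsilon> :: real
    using weak_small_Lp_imp_small_norm[OF pq(1,4,5,6) that, of d \<nu>] by blast+
  note I = compact_embeddingI[OF sets C le qm pq(1,2) cells]
  show "compact_embedding \<mu> (hajlasz_TL_norm d \<alpha> p q) \<nu> (hajlasz_TL_norm d \<beta> p r)"
    by (rule I) (fact n1 fin small)+
  show "compact_embedding \<mu> (hajlasz_TL_norm d \<alpha> p q) \<nu> (hajlasz_Besov_norm d \<beta> p r)"
    by (rule I) (fact n1 fin small)+
  show "compact_embedding \<mu> (hajlasz_Besov_norm d \<alpha> p q) \<nu> (hajlasz_TL_norm d \<beta> p r)"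
    by (rule I) (fact n1 fin small)+
  show "compact_embedding \<mu> (hajlasz_Besov_norm d \<alpha> p q) \<nu> (hajlasz_Besov_norm d \<beta> p r)"
    by (rule I) (fact n1 fin small)+
qed

section \<open>Quasi-metric spaces: constants, separated sets and covers\<close>

text \<open>Merging the two constants lets one number \<open>C \<ge> 1\<close> serve in every estimate.\<close>

definition qm_constant :: "'a set \<Rightarrow> ('a \<Rightarrow> 'a \<Rightarrow> real) \<Rightarrow> real \<Rightarrow> bool" where
  "qm_constant X d C \<longleftrightarrow> 1 \<le> C \<and> (\<forall>x\<in>X. \<forall>y\<in>X. d y x \<le> C * d x y) \<and>
     (\<forall>x\<in>X. \<forall>y\<in>X. \<forall>z\<in>X. d x y \<le> C * max (d x z) (d z y)) \<and>
     (\<forall>x\<in>X. \<forall>y\<in>X. 0 \<le> d x y) \<and> (\<forall>x\<in>X. \<forall>y\<in>X. d x y = 0 \<longleftrightarrow> x = y)"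

lemma qm_constantD:
  assumes "qm_constant X d C"
  shows "1 \<le> C" "\<And>x y. x \<in> X \<Longrightarrow> y \<in> X \<Longrightarrow> d y x \<le> C * d x y"
    "\<And>x y z. x \<in> X \<Longrightarrow> y \<in> X \<Longrightarrow> z \<in> X \<Longrightarrow> d x y \<le> C * max (d x z) (d z y)"
    "\<And>x y. x \<in> X \<Longrightarrow> y \<in> X \<Longrightarrow> 0 \<le> d x y"
    "\<And>x y. x \<in> X \<Longrightarrow> y \<in> X \<Longrightarrow> d x y = 0 \<longleftrightarrow> x = y"
  using assms unfolding qm_constant_def by auto

lemma ex_qm_constant:
  assumes "quasi_metric X d"
  shows "\<exists>C. qm_constant X d C"
proof -
  obtain A B where A: "A > 0" "\<And>x y. x \<in> X \<Longrightarrow> y \<in> X \<Longrightarrow> d y x \<le> A * d x y"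
    and B: "B > 0" "\<And>x y z. x \<in> X \<Longrightarrow> y \<in> X \<Longrightarrow> z \<in> X \<Longrightarrow> d x y \<le> B * max (d x z) (d z y)"
    and nn: "\<And>x y. x \<in> X \<Longrightarrow> y \<in> X \<Longrightarrow> 0 \<le> d x y"
    and z: "\<And>x y. x \<in> X \<Longrightarrow> y \<in> X \<Longrightarrow> d x y = 0 \<longleftrightarrow> x = y"
    using assms unfolding quasi_metric_def by auto
  define C where "C = max 1 (max A B)"
  have C: "1 \<le> C" "A \<le> C" "B \<le> C" by (auto simp: C_def)
  have "d y x \<le> C * d x y" if "x \<in> X" "y \<in> X" for x y
    using A(2)[OF that] mult_right_mono[OF C(2) nn[OF that]] by linarith
  moreover have "d x y \<le> C * max (d x z) (d z y)" if "x \<in> X" "y \<in> X" "z \<in> X" for x y z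
    using B(2)[OF that] mult_right_mono[OF C(3), of "max (d x z) (d z y)"] nn that
    by (meson le_max_iff_disj order_trans)
  ultimately have "qm_constant X d C" using C(1) nn z by (auto simp: qm_constant_def)
  then show ?thesis ..
qed

lemma qm_ball_small_diam:
  assumes qm: "quasi_metric X d" and s: "0 < s"
  shows "\<exists>t>0. \<forall>z\<in>X. \<forall>x\<in>qm_ball X d z t. \<forall>y\<in>qm_ball X d z t. d x y < s"
proof -
  obtain C where "qm_constant X d C"
    using ex_qm_constant[OF qm] ..
  note C = qm_constantD[OF this]
  define t where "t = s / (C * C)"
  have t: "0 < t" using s C by (simp add: t_def)
  have "d x y < s" if z: "z \<in> X" "x \<in> qm_ball X d z t" "y \<in> qm_ball X d z t" for x y z
  proof -
    have xy: "x \<in> X" "y \<in> X" "d z x < t" "d z y < t" using z by (auto simp: qm_ball_def)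
    have "d x z \<le> C * d z x" using C(2) z xy by blast
    also have "\<dots> < C * t" using xy C(1) by simp
    finally have "d x z < C * t" .
    moreover have "d z y < C * t" using xy(4) C(1) t mult_right_mono[of 1 C t] by linarith
    ultimately have "C * max (d x z) (d z y) < C * (C * t)" using C(1) by simp
    then show ?thesis
      using C(3)[of x y z] xy z C(1) by (simp add: t_def)
  qed
  then show ?thesis using t by blast
qed

lemma disjointed_ball_cells:
  fixes z :: "nat \<Rightarrow> 'a"
  assumes qmm: "quasi_metric_measure_space d \<mu>" and z: "\<And>i. z i \<in> space \<mu>" and t: "0 < t"
    and diam: "\<forall>z\<in>space \<mu>. \<forall>x\<in>qm_ball (space \<mu>) d z t. \<forall>y\<in>qm_ball (space \<mu>) d z t. d x y < s"
  defines "b \<equiv> \<lambda>i. qm_ball (space \<mu>) d (z i) t"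
  shows "disjoint_family_on (disjointed b) {..<N}"
    "\<forall>i<N. disjointed b i \<in> sets \<mu> \<and> emeasure \<mu> (disjointed b i) < top \<and>
       (\<forall>x\<in>disjointed b i. \<forall>y\<in>disjointed b i. d x y < s)"
    "(\<Union>i<N. disjointed b i) = (\<Union>i<N. b i)"
proof -
  have b: "b i \<in> sets \<mu>" "emeasure \<mu> (b i) < top" for i
    using qmm z t by (auto simp: b_def quasi_metric_measure_space_def)
  have sub: "disjointed b i \<subseteq> b i" for i by (rule disjointed_subset)
  show "disjoint_family_on (disjointed b) {..<N}"
    using disjoint_family_disjointed[of b] by (auto simp: disjoint_family_on_def)
  have "emeasure \<mu> (disjointed b i) < top" for i
    using emeasure_mono[OF sub b(1), of i] b(2)[of i] by (rule le_less_trans)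
  moreover have "d x y < s" if "x \<in> disjointed b i" "y \<in> disjointed b i" for i x y
    using sub[of i] that diam z[of i] by (auto simp: b_def)
  moreover have "disjointed b i \<in> sets \<mu>" for i
    using sets.range_disjointed_sets[of b \<mu>] b by auto
  ultimately show "\<forall>i<N. disjointed b i \<in> sets \<mu> \<and> emeasure \<mu> (disjointed b i) < top \<and>
       (\<forall>x\<in>disjointed b i. \<forall>y\<in>disjointed b i. d x y < s)" by simp
  show "(\<Union>i<N. disjointed b i) = (\<Union>i<N. b i)"
    using finite_UN_disjointed_eq[of b N] by (simp add: atLeast0LessThan)
qed

lemma tight_if_totally_bounded:
  assumes qmm: "quasi_metric_measure_space d \<mu>" and tb: "qm_totally_bounded (space \<mu>) d"
  shows "uniformly_tight_cells d \<mu> \<nu> \<alpha> p"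
  unfolding uniformly_tight_cells_def
proof (intro allI impI)
  fix M :: ennreal and s \<eta> :: real
  assume s: "0 < s" and "0 < \<eta>"
  have qm: "quasi_metric (space \<mu>) d" using qmm by (simp add: quasi_metric_measure_space_def)
  obtain t where t: "0 < t" "\<forall>z\<in>space \<mu>. \<forall>x\<in>qm_ball (space \<mu>) d z t. \<forall>y\<in>qm_ball (space \<mu>) d z t. d x y < s"
    using qm_ball_small_diam[OF qm s] by (elim exE conjE)
  obtain F where F: "finite F" "F \<subseteq> space \<mu>" "space \<mu> \<subseteq> (\<Union>x\<in>F. qm_ball (space \<mu>) d x t)"
    using tb[unfolded qm_totally_bounded_def, rule_format, OF t(1)] by (elim exE conjE)
  obtain x0 where x0: "x0 \<in> space \<mu>" using qm by (auto simp: quasi_metric_def)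
  obtain y and N :: nat where y: "F = y ` {..<N}"
    using finite_imp_nat_seg_image_inj_on[OF F(1)] by (auto simp: lessThan_def)
  define z where "z i = (if i < N then y i else x0)" for i
  have z: "z i \<in> space \<mu>" for i using F(2) x0 y by (auto simp: z_def)
  note cells = disjointed_ball_cells[where N=N and z=z, OF qmm z t]
  have none: "space \<mu> - (\<Union>i<N. disjointed (\<lambda>i. qm_ball (space \<mu>) d (z i) t) i) = {}"
    unfolding cells(3) using F(3) by (auto simp: y z_def)
  show "\<exists>(N::nat) Q. disjoint_family_on Q {..<N} \<and>
        (\<forall>i<N. Q i \<in> sets \<mu> \<and> emeasure \<mu> (Q i) < top \<and> (\<forall>x\<in>Q i. \<forall>y\<in>Q i. d x y < s)) \<and>
        (\<forall>u\<in>weak_hajlasz_ball d \<mu> \<alpha> p M.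
           (\<integral>\<^sup>+x\<in>space \<mu> - (\<Union>i<N. Q i). abs_powr (u x) p \<partial>\<nu>) \<le> ennreal \<eta>)"
    by (intro exI[of _ N] exI[of _ "disjointed (\<lambda>i. qm_ball (space \<mu>) d (z i) t)"] conjI cells(1,2))
      (simp only: none, simp)
qed

lemma ball_inter_empty:
  assumes qm: "quasi_metric X d" and t: "0 < t"
  shows "\<exists>r>0. \<forall>x\<in>X. \<forall>y\<in>X. t \<le> d x y \<longrightarrow> qm_ball X d x r \<inter> qm_ball X d y r = {}"
proof -
  obtain C where "qm_constant X d C"
    using ex_qm_constant[OF qm] ..
  note C = qm_constantD[OF this]
  define r where "r = t / (C * C)"
  have r: "0 < r" using t C by (simp add: r_def)
  have False if xy: "x \<in> X" "y \<in> X" "t \<le> d x y" and z: "z \<in> X" "d x z < r" "d y z < r" for x y z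
  proof -
    have "d z y \<le> C * d y z" using C(2) z(1) xy by blast
    also have "\<dots> < C * r" using z(3) C(1) by simp
    finally have "d z y < C * r" .
    moreover have "d x z < C * r" using z(2) C(1) r mult_right_mono[of 1 C r] by linarith
    ultimately have "C * max (d x z) (d z y) < C * (C * r)" using C(1) by simp
    then show False
      using C(3)[of x y z] xy z C(1) by (simp add: r_def)
  qed
  then show ?thesis using r by (intro exI[of _ r]) (auto simp: qm_ball_def)
qed

text \<open>A maximal separated set exists by Zorn's lemma; a point outside all the balls could be added
  to it. As the distance is not symmetric, separation is only by a multiple \<open>t\<close> of \<open>\<epsilon>\<close>.\<close>

lemma ex_maximal_separated:
  fixes d :: "'a \<Rightarrow> 'a \<Rightarrow> real"
  assumes qm: "quasi_metric X d" and eps: "0 < \<epsilon>"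
  shows "\<exists>S t. 0 < t \<and> S \<subseteq> X \<and> (\<forall>x\<in>S. \<forall>y\<in>S. x \<noteq> y \<longrightarrow> t \<le> d x y) \<and> X \<subseteq> (\<Union>z\<in>S. qm_ball X d z \<epsilon>)"
proof -
  obtain C where "qm_constant X d C"
    using ex_qm_constant[OF qm] ..
  note C = qm_constantD[OF this]
  define t where "t = \<epsilon> / C"
  have t: "0 < t" "C * t = \<epsilon>" "t \<le> \<epsilon>"
    using eps C(1) by (auto simp: t_def field_simps)
  define A where "A = {S. S \<subseteq> X \<and> (\<forall>x\<in>S. \<forall>y\<in>S. x \<noteq> y \<longrightarrow> t \<le> d x y)}"
  have "\<exists>M\<in>A. \<forall>S\<in>A. M \<subseteq> S \<longrightarrow> S = M"
  proof (rule subset_Zorn')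
    fix \<C> assume c: "subset.chain A \<C>"
    then have sub: "\<C> \<subseteq> A" and chain: "\<And>S T. S \<in> \<C> \<Longrightarrow> T \<in> \<C> \<Longrightarrow> S \<subseteq> T \<or> T \<subseteq> S"
      by (auto simp: subset.chain_def)
    have "t \<le> d x y" if "x \<in> S" "S \<in> \<C>" "y \<in> T" "T \<in> \<C>" "x \<noteq> y" for x y S T
    proof (cases "S \<subseteq> T")
      case True
      then have "x \<in> T" "T \<in> A" using that sub by auto
      then show ?thesis using that by (simp add: A_def)
    next
      case False
      then have "T \<subseteq> S" using chain that by blast
      then have "y \<in> S" "S \<in> A" using that sub by auto
      then show ?thesis using that by (simp add: A_def)
    qed
    then show "\<Union>\<C> \<in> A" using sub by (auto simp: A_def)
  qed
  then obtain S where S: "S \<in> A" "\<And>T. T \<in> A \<Longrightarrow> S \<subseteq> T \<Longrightarrow> T = S" by auto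
  have "\<exists>z\<in>S. d z x < \<epsilon>" if x: "x \<in> X" for x
  proof (rule ccontr)
    assume "\<not> (\<exists>z\<in>S. d z x < \<epsilon>)"
    then have far: "\<And>z. z \<in> S \<Longrightarrow> \<epsilon> \<le> d z x" by force
    have far': "t \<le> d x z" if "z \<in> S" for z
    proof -
      have "z \<in> X" using that S(1) by (auto simp: A_def)
      then have "C * t \<le> C * d x z" using far[OF that] C(2)[of x z] x t by simp
      then show ?thesis using C(1) by simp
    qed
    have "t \<le> d z x" if "z \<in> S" for z using far[OF that] t(3) by simp
    then have "insert x S \<in> A" using S(1) x far' by (auto simp: A_def)
    then have "insert x S = S" by (rule S(2)) auto
    then have "x \<in> S" by blast
    then show False using far[of x] C(5)[OF x x] eps by auto
  qed
  then show ?thesis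
    using S(1) t by (intro exI[of _ S] exI[of _ t]) (auto simp: A_def qm_ball_def)
qed

text \<open>Small balls around the points of \<open>S\<close> are disjoint and of positive measure. Among those whose
  centre lies in a given ball, only finitely many can have measure at least \<open>1 / Suc m\<close>, since they
  all lie in one larger ball of finite measure.\<close>

lemma countable_if_separated:
  assumes qmm: "quasi_metric_measure_space d \<mu>" and t: "0 < t"
    and S: "S \<subseteq> space \<mu>" "\<And>x y. x \<in> S \<Longrightarrow> y \<in> S \<Longrightarrow> x \<noteq> y \<Longrightarrow> t \<le> d x y"
  shows "countable S"
proof -
  let ?B = "qm_ball (space \<mu>) d"
  have qm: "quasi_metric (space \<mu>) d"
    and ball: "\<And>x r. x \<in> space \<mu> \<Longrightarrow> 0 < r \<Longrightarrow> ?B x r \<in> sets \<mu>"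
      "\<And>x r. x \<in> space \<mu> \<Longrightarrow> 0 < r \<Longrightarrow> 0 < emeasure \<mu> (?B x r)"
      "\<And>x r. x \<in> space \<mu> \<Longrightarrow> 0 < r \<Longrightarrow> emeasure \<mu> (?B x r) < top"
    using qmm by (auto simp: quasi_metric_measure_space_def)
  obtain C where "qm_constant (space \<mu>) d C"
    using ex_qm_constant[OF qm] ..
  note C = qm_constantD[OF this]
  obtain r where r: "0 < r" "\<And>x y. x \<in> space \<mu> \<Longrightarrow> y \<in> space \<mu> \<Longrightarrow> t \<le> d x y \<Longrightarrow> ?B x r \<inter> ?B y r = {}"
    using ball_inter_empty[OF qm t] by auto
  obtain x0 where x0: "x0 \<in> space \<mu>" using qm by (auto simp: quasi_metric_def)
  define T where "T = (\<lambda>n m. {x \<in> S. d x0 x < real n \<and> 1 / real (Suc m) \<le> measure \<mu> (?B x r)})"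
  have "finite (T n m)" for n m
  proof -
    define R where "R = C * max (real n + 1) r"
    have R: "0 < R" using C(1) r(1) by (auto simp: R_def max_def)
    have sub: "?B x r \<subseteq> ?B x0 R" if "x \<in> T n m" for x
    proof
      fix y assume "y \<in> ?B x r"
      then have y: "y \<in> space \<mu>" "d x y < r" by (auto simp: qm_ball_def)
      have x: "x \<in> space \<mu>" "d x0 x < real n" using that S by (auto simp: T_def)
      have "max (d x0 x) (d x y) < max (real n + 1) r" using x y by auto
      then have "C * max (d x0 x) (d x y) < R" using C(1) by (simp add: R_def)
      then show "y \<in> ?B x0 R"
        using C(3)[OF x0 y(1) x(1)] y by (simp add: qm_ball_def)
    qed
    define L where "L = measure \<mu> (?B x0 R)"
    have "card F \<le> nat \<lfloor>real (Suc m) * L\<rfloor>" if F: "F \<subseteq> T n m" "finite F" for F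
    proof -
      have FS: "x \<in> S" "x \<in> space \<mu>" if "x \<in> F" for x using that F S by (auto simp: T_def)
      have "disjoint_family_on (\<lambda>x. ?B x r) F"
        unfolding disjoint_family_on_def using r(2)[OF FS(2) FS(2) S(2)[OF FS(1) FS(1)]] by auto
      then have "(\<Sum>x\<in>F. emeasure \<mu> (?B x r)) = emeasure \<mu> (\<Union>x\<in>F. ?B x r)"
        using F FS ball(1) r(1) by (intro sum_emeasure) auto
      also have "\<dots> \<le> emeasure \<mu> (?B x0 R)"
        using sub F ball(1)[OF x0 R] by (intro emeasure_mono) auto
      also have "\<dots> = ennreal L"
        unfolding L_def using ball(3)[OF x0 R] by (intro emeasure_eq_ennreal_measure) auto
      finally have 1: "(\<Sum>x\<in>F. emeasure \<mu> (?B x r)) \<le> ennreal L" .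
      have "(\<Sum>x\<in>F. ennreal (1 / real (Suc m))) \<le> (\<Sum>x\<in>F. emeasure \<mu> (?B x r))"
      proof (rule sum_mono)
        fix x assume "x \<in> F"
        then have "emeasure \<mu> (?B x r) = ennreal (measure \<mu> (?B x r))"
          using ball(3)[OF FS(2) r(1), of x] by (intro emeasure_eq_ennreal_measure) auto
        then show "ennreal (1 / real (Suc m)) \<le> emeasure \<mu> (?B x r)"
          using \<open>x \<in> F\<close> F by (auto simp: T_def intro!: ennreal_leI)
      qed
      with 1 have "(\<Sum>x\<in>F. ennreal (1 / real (Suc m))) \<le> ennreal L" by (rule order_trans[rotated])
      then have "ennreal (real (card F) * (1 / real (Suc m))) \<le> ennreal L"
        by (simp add: ennreal_of_nat_eq_real_of_nat ennreal_mult[symmetric])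
      moreover have "0 \<le> L" by (simp add: L_def)
      ultimately have "real (card F) * (1 / real (Suc m)) \<le> L" by simp
      then have "real (card F) \<le> real (Suc m) * L" by (simp add: field_simps)
      then show ?thesis by (simp add: le_nat_iff le_floor_iff)
    qed
    then show ?thesis using finite_if_finite_subsets_card_bdd by blast
  qed
  moreover have "S \<subseteq> (\<Union>n. \<Union>m. T n m)"
  proof
    fix x assume x: "x \<in> S"
    then have xX: "x \<in> space \<mu>" using S by auto
    obtain n where n: "d x0 x < real n" using reals_Archimedean2 by blast
    have "0 < measure \<mu> (?B x r)"
      using ball(2,3)[OF xX r(1)] by (auto simp: measure_def enn2real_positive_iff)
    then obtain m where "1 / real (Suc m) < measure \<mu> (?B x r)"
      using nat_approx_posE by blast
    then show "x \<in> (\<Union>n. \<Union>m. T n m)" using x n by (auto simp: T_def intro: less_imp_le)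
  qed
  ultimately show ?thesis
    by (meson countable_UN countable_finite countable_subset uncountable_def countableI_type)
qed

lemma ex_countable_cover:
  assumes qmm: "quasi_metric_measure_space d \<mu>" and eps: "0 < \<epsilon>"
  shows "\<exists>z :: nat \<Rightarrow> 'a. (\<forall>i. z i \<in> space \<mu>) \<and> (\<forall>x\<in>space \<mu>. \<exists>i. x \<in> qm_ball (space \<mu>) d (z i) \<epsilon>)"
proof -
  have qm: "quasi_metric (space \<mu>) d" using qmm by (simp add: quasi_metric_measure_space_def)
  obtain S t where S: "0 < t" "S \<subseteq> space \<mu>" "\<forall>x\<in>S. \<forall>y\<in>S. x \<noteq> y \<longrightarrow> t \<le> d x y"
    "space \<mu> \<subseteq> (\<Union>z\<in>S. qm_ball (space \<mu>) d z \<epsilon>)"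
    using ex_maximal_separated[OF qm eps] by (elim exE conjE)
  have c: "countable S" using S by (intro countable_if_separated[OF qmm]) auto
  have "S \<noteq> {}" using S(4) qm by (auto simp: quasi_metric_def)
  then have r: "range (from_nat_into S) = S" using c by (rule range_from_nat_into)
  show ?thesis
  proof (intro exI[of _ "from_nat_into S"] conjI ballI allI)
    show "from_nat_into S i \<in> space \<mu>" for i using r S(2) by blast
    fix x assume "x \<in> space \<mu>"
    then obtain s where s: "s \<in> S" "x \<in> qm_ball (space \<mu>) d s \<epsilon>" using S(4) by blast
    then obtain i where "s = from_nat_into S i" using r by auto
    then show "\<exists>i. x \<in> qm_ball (space \<mu>) d (from_nat_into S i) \<epsilon>" using s by blast
  qed
qed

lemma sigma_finite_qmm:
  assumes qmm: "quasi_metric_measure_space d \<mu>" and sets: "sets \<nu> = sets \<mu>"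
    and le: "\<forall>A\<in>sets \<mu>. emeasure \<nu> A \<le> ennreal C * emeasure \<mu> A"
  shows "sigma_finite_measure \<nu>"
proof
  obtain z :: "nat \<Rightarrow> 'a" where z: "\<And>i. z i \<in> space \<mu>" "\<And>x. x \<in> space \<mu> \<Longrightarrow> \<exists>i. x \<in> qm_ball (space \<mu>) d (z i) 1"
    using ex_countable_cover[OF qmm zero_less_one] by blast
  have b: "qm_ball (space \<mu>) d (z i) 1 \<in> sets \<mu>" "emeasure \<mu> (qm_ball (space \<mu>) d (z i) 1) < top" for i
    using qmm z(1) by (auto simp: quasi_metric_measure_space_def)
  have "emeasure \<nu> (qm_ball (space \<mu>) d (z i) 1) < top" for i
    using le[rule_format, OF b(1), of i] ennreal_mult_less_topI[OF ennreal_less_top b(2), of C i]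
    by (rule le_less_trans)
  then show "\<exists>A. countable A \<and> A \<subseteq> sets \<nu> \<and> \<Union>A = space \<nu> \<and> (\<forall>a\<in>A. emeasure \<nu> a \<noteq> \<infinity>)"
    using b z sets sets_eq_imp_space_eq[OF sets]
    by (intro exI[of _ "range (\<lambda>i. qm_ball (space \<mu>) d (z i) 1)"]) (auto simp: qm_ball_def less_top)
qed

section \<open>Measurability of continuous quasi-metrics\<close>

text \<open>The set is open in the product topology, and separability makes it a countable union of products
  of \<open>d\<close>-balls. These balls are measurable although they may fail to be open.\<close>

lemma continuous_sublevel_in_product_sets:
  assumes qmm: "quasi_metric_measure_space d \<mu>"
    and cont: "continuous_map (prod_topology (qm_topology (space \<mu>) d) (qm_topology (space \<mu>) d))
            euclideanreal (\<lambda>(x, y). \<rho> x y)"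
  shows "{z \<in> space \<mu> \<times> space \<mu>. \<rho> (fst z) (snd z) < r} \<in> sets (\<mu> \<Otimes>\<^sub>M \<mu>)"
proof -
  let ?X = "space \<mu>" and ?B = "qm_ball (space \<mu>) d" and ?\<tau> = "qm_topology (space \<mu>) d"
  have qm: "quasi_metric ?X d" and ball: "\<And>x r. x \<in> ?X \<Longrightarrow> 0 < r \<Longrightarrow> ?B x r \<in> sets \<mu>"
    using qmm by (auto simp: quasi_metric_measure_space_def)
  have top: "topspace ?\<tau> = ?X"
  proof -
    have "openin ?\<tau> ?X" by (auto simp: openin_qm_topology qm_ball_def intro!: exI[of _ 1])
    moreover have "topspace ?\<tau> \<subseteq> ?X"
      using openin_topspace[of ?\<tau>] by (simp only: openin_qm_topology)
    ultimately show ?thesis using openin_subset by blast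
  qed
  define U where "U = {z \<in> ?X \<times> ?X. \<rho> (fst z) (snd z) < r}"
  have "openin (prod_topology ?\<tau> ?\<tau>) {z \<in> topspace (prod_topology ?\<tau> ?\<tau>). (\<lambda>(x, y). \<rho> x y) z \<in> {..<r}}"
    by (rule openin_continuous_map_preimage[OF cont]) auto
  then have openU: "openin (prod_topology ?\<tau> ?\<tau>) U"
    by (simp add: U_def top case_prod_unfold)
  have "\<forall>n::nat. \<exists>z :: nat \<Rightarrow> 'a. (\<forall>i. z i \<in> ?X) \<and> (\<forall>x\<in>?X. \<exists>i. x \<in> ?B (z i) (1 / real (Suc n)))"
    by (intro allI ex_countable_cover[OF qmm]) simp
  then obtain z where z: "\<And>n i. z n i \<in> ?X" "\<And>n x. x \<in> ?X \<Longrightarrow> \<exists>i. x \<in> ?B (z n (i::nat)) (1 / real (Suc n))"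
    unfolding choice_iff by blast
  define R where "R = (\<lambda>(n, i, j). ?B (z n i) (1 / real (Suc n)) \<times> ?B (z n j) (1 / real (Suc n)))"
  have Rsets: "R k \<in> sets (\<mu> \<Otimes>\<^sub>M \<mu>)" for k
    using ball z(1) by (auto simp: R_def split: prod.split)
  have "U = (\<Union>k\<in>{k. R k \<subseteq> U}. R k)"
  proof (rule antisym[OF subsetI])
    fix w assume w: "w \<in> U"
    then obtain x y where xy: "w = (x, y)" "x \<in> ?X" "y \<in> ?X" by (auto simp: U_def)
    obtain V W where VW: "openin ?\<tau> V" "openin ?\<tau> W" "x \<in> V" "y \<in> W" "V \<times> W \<subseteq> U"
      using openU w xy unfolding openin_prod_topology_alt by metis
    obtain e1 where e1: "0 < e1" "?B x e1 \<subseteq> V"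
      using VW(1,3) unfolding openin_qm_topology by auto
    obtain e2 where e2: "0 < e2" "?B y e2 \<subseteq> W"
      using VW(2,4) unfolding openin_qm_topology by auto
    define e where "e = min e1 e2"
    have e: "0 < e" "?B x e \<subseteq> V" "?B y e \<subseteq> W"
      using e1 e2 by (auto simp: e_def qm_ball_def)
    obtain t where t: "0 < t" "\<And>z x y. z \<in> ?X \<Longrightarrow> x \<in> ?B z t \<Longrightarrow> y \<in> ?B z t \<Longrightarrow> d x y < e"
      using qm_ball_small_diam[OF qm e(1)] by auto
    obtain n where n: "1 / real (Suc n) < t" using nat_approx_posE[OF t(1)] by blast
    have small: "?B c (1 / real (Suc n)) \<subseteq> ?B v e" if "v \<in> ?B c (1 / real (Suc n))" "c \<in> ?X" for c v
    proof
      fix a assume "a \<in> ?B c (1 / real (Suc n))"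
      then have "a \<in> ?B c t" "v \<in> ?B c t" using that n by (auto simp: qm_ball_def)
      then show "a \<in> ?B v e" using t(2)[OF that(2), of v a] by (auto simp: qm_ball_def)
    qed
    obtain i j where ij: "x \<in> ?B (z n i) (1 / real (Suc n))" "y \<in> ?B (z n j) (1 / real (Suc n))"
      using z(2) xy by blast
    have "R (n, i, j) \<subseteq> V \<times> W"
      using small[OF ij(1) z(1)] small[OF ij(2) z(1)] e by (auto simp: R_def)
    then have "R (n, i, j) \<subseteq> U" using VW(5) by (rule subset_trans)
    moreover have "w \<in> R (n, i, j)" using ij xy by (simp add: R_def)
    ultimately show "w \<in> (\<Union>k\<in>{k. R k \<subseteq> U}. R k)" by blast
  qed auto
  also have "\<dots> \<in> sets (\<mu> \<Otimes>\<^sub>M \<mu>)"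
    using Rsets by (intro sets.countable_UN') auto
  finally show ?thesis unfolding U_def .
qed

section \<open>Tightness from integrability of the kernel\<close>

text \<open>For almost all \<open>x\<close> the inequality \<open>\<bar>u x\<bar>\<^sup>p \<le> 2\<^sup>p (G x + G y + \<bar>u y\<bar>\<^sup>p)\<close> holds for almost all \<open>y\<close> in
  \<open>B\<^sub>\<rho>(x, r)\<close>. Averaging over \<open>y\<close>, integrating over \<open>x \<in> Z\<close> and exchanging the integrals puts the
  kernel in front of \<open>G + \<bar>u\<bar>\<^sup>p\<close>; the symmetry of \<open>\<rho>\<close> turns \<open>y \<in> B\<^sub>\<rho>(x, r)\<close> into \<open>x \<in> B\<^sub>\<rho>(y, r)\<close>.\<close>

lemma nn_integral_tail_le_kernel:
  fixes u :: "'a \<Rightarrow> real" and \<rho> :: "'a \<Rightarrow> 'a \<Rightarrow> real"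
  assumes qmm: "quasi_metric_measure_space d \<mu>" and sets: "sets \<nu> = sets \<mu>"
    and le: "\<forall>A\<in>sets \<mu>. emeasure \<nu> A \<le> ennreal C * emeasure \<mu> A"
    and sub: "{z \<in> space \<mu> \<times> space \<mu>. \<rho> (fst z) (snd z) < r} \<in> sets (\<mu> \<Otimes>\<^sub>M \<mu>)"
    and sym: "\<And>x y. x \<in> space \<mu> \<Longrightarrow> y \<in> space \<mu> \<Longrightarrow> \<rho> x y = \<rho> y x"
    and pos: "\<And>x. x \<in> space \<mu> \<Longrightarrow> 0 < emeasure \<mu> (qm_ball (space \<mu>) \<rho> x r)"
      "\<And>x. x \<in> space \<mu> \<Longrightarrow> emeasure \<mu> (qm_ball (space \<mu>) \<rho> x r) < top"
    and p: "0 < p" and u[measurable]: "u \<in> borel_measurable \<mu>"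
    and osc: "oscillation_bound d \<mu> p s \<eta> u G"
    and rs: "\<And>x y. x \<in> space \<mu> \<Longrightarrow> y \<in> space \<mu> \<Longrightarrow> \<rho> x y < r \<Longrightarrow> d x y < s"
    and Z: "Z \<in> sets \<mu>"
    and kernel: "\<And>y. y \<in> space \<mu> \<Longrightarrow>
       (\<integral>\<^sup>+x\<in>Z. ennreal (1 / measure \<mu> (qm_ball (space \<mu>) \<rho> x r)) * indicator (qm_ball (space \<mu>) \<rho> y r) x \<partial>\<nu>) \<le> \<delta>"
  shows "(\<integral>\<^sup>+x\<in>Z. abs_powr (u x) p \<partial>\<nu>)
     \<le> ennreal (2 powr p) * (ennreal C * ennreal \<eta> + \<delta> * (ennreal \<eta> + (Lp_mass \<mu> p u)))"
proof -
  let ?X = "space \<mu>" and ?B = "\<lambda>x. qm_ball (space \<mu>) \<rho> x r"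
  note [measurable_cong] = sets
  have space: "space \<nu> = ?X" using sets by (rule sets_eq_imp_space_eq)
  note Z[measurable]
  have [measurable]: "G \<in> borel_measurable \<mu>" and int: "(\<integral>\<^sup>+x. G x \<partial>\<mu>) \<le> ennreal \<eta>"
    using osc by (auto simp: oscillation_bound_def)
  obtain E where E: "E \<in> null_sets \<mu>"
    and osc': "\<And>x y. x \<in> ?X - E \<Longrightarrow> y \<in> ?X - E \<Longrightarrow> d x y < s \<Longrightarrow>
        abs_powr (u x - u y) p \<le> G x + G y"
    using osc unfolding oscillation_bound_def by blast
  have E': "E \<in> null_sets \<nu>" using null_sets_le_cmult_measure[OF sets le] E by blast
  interpret \<mu>: sigma_finite_measure \<mu>
    by (rule sigma_finite_qmm[OF qmm refl, where C=1]) simp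
  interpret \<nu>: sigma_finite_measure \<nu>
    by (rule sigma_finite_qmm[OF qmm sets le])
  interpret \<mu>\<nu>: pair_sigma_finite \<mu> \<nu> ..
  \<comment> \<open>The indicator of \<open>\<rho> x y < r\<close> as a jointly measurable kernel, for Tonelli's theorem.\<close>
  define I :: "'a \<Rightarrow> 'a \<Rightarrow> ennreal"
    where "I = (\<lambda>x y. indicator {z \<in> ?X \<times> ?X. \<rho> (fst z) (snd z) < r} (x, y))"
  have Im: "(\<lambda>z. I (fst z) (snd z)) \<in> borel_measurable (\<mu> \<Otimes>\<^sub>M \<mu>)"
    unfolding I_def using sub by (simp add: borel_measurable_indicator)
  have Im'[measurable]: "(\<lambda>z. I (f z) (g z)) \<in> borel_measurable N"
    if [measurable]: "f \<in> measurable N \<mu>" "g \<in> measurable N \<mu>" for f g and N :: "'b measure"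
    using measurable_compose[OF measurable_Pair[OF that] Im] by simp
  have I: "I x y = indicator (?B x) y" "I x y = indicator (?B y) x" if "x \<in> ?X" "y \<in> ?X" for x y
    using that sym[OF that] by (auto simp: I_def qm_ball_def split: split_indicator)
  have ballm: "?B x \<in> sets \<mu>" if "x \<in> ?X" for x
  proof -
    have "Pair x -` {z \<in> ?X \<times> ?X. \<rho> (fst z) (snd z) < r} \<in> sets \<mu>"
      by (rule sets_Pair1[OF sub])
    moreover have "Pair x -` {z \<in> ?X \<times> ?X. \<rho> (fst z) (snd z) < r} = ?B x"
      using that by (auto simp: qm_ball_def)
    ultimately show ?thesis by simp
  qed
  define m where "m = (\<lambda>x. ennreal (1 / measure \<mu> (?B x)))"
  have volume: "emeasure \<mu> (?B x) = (\<integral>\<^sup>+y. I x y \<partial>\<mu>)" if x: "x \<in> ?X" for x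
  proof -
    have "(\<integral>\<^sup>+y. I x y \<partial>\<mu>) = (\<integral>\<^sup>+y. indicator (?B x) y \<partial>\<mu>)"
      by (intro nn_integral_cong) (simp add: I(1)[OF x])
    then show ?thesis using ballm[OF x] by simp
  qed
  have m_eq: "m x = 1 / emeasure \<mu> (?B x)" "m x * emeasure \<mu> (?B x) = 1" if x: "x \<in> ?X" for x
  proof -
    have fin: "emeasure \<mu> (?B x) = ennreal (measure \<mu> (?B x))"
      using pos(2)[OF x] by (intro emeasure_eq_ennreal_measure) auto
    then have p0: "0 < measure \<mu> (?B x)" using pos(1)[OF x] by (metis ennreal_less_zero_iff)
    show "m x = 1 / emeasure \<mu> (?B x)"
      unfolding m_def fin using p0 by (simp add: divide_ennreal[symmetric])
    show "m x * emeasure \<mu> (?B x) = 1"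
      unfolding m_def fin using p0 by (simp add: ennreal_mult[symmetric])
  qed
  have mm[measurable]: "m \<in> borel_measurable \<mu>"
  proof -
    have "(\<lambda>x. 1 / (\<integral>\<^sup>+y. I x y \<partial>\<mu>)) \<in> borel_measurable \<mu>" by measurable
    then show ?thesis
      by (rule measurable_cong[THEN iffD1, rotated]) (simp add: m_eq volume)
  qed
  define H where "H = (\<lambda>y. G y + abs_powr (u y) p)"
  have [measurable]: "H \<in> borel_measurable \<mu>" unfolding H_def by measurable
  have point: "abs_powr (u x) p \<le> ennreal (2 powr p) * (G x + m x * (\<integral>\<^sup>+y. H y * I x y \<partial>\<mu>))"
    if x: "x \<in> ?X" "x \<notin> E" for x
  proof -
    define a where "a = abs_powr (u x) p"
    have "a * emeasure \<mu> (?B x) = (\<integral>\<^sup>+y. a * I x y \<partial>\<mu>)"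
      by (simp add: nn_integral_cmult volume x)
    also have "\<dots> \<le> (\<integral>\<^sup>+y. ennreal (2 powr p) * (G x * I x y + H y * I x y) \<partial>\<mu>)"
    proof (rule nn_integral_mono_AE)
      show "AE y in \<mu>. a * I x y \<le> ennreal (2 powr p) * (G x * I x y + H y * I x y)"
        using AE_not_in[OF E] AE_space
      proof eventually_elim
        case (elim y)
        show ?case
        proof (cases "\<rho> x y < r")
          case True
          have "ennreal \<bar>u x\<bar> \<le> ennreal \<bar>u x - u y\<bar> + ennreal \<bar>u y\<bar>"
            by (simp add: ennreal_plus[symmetric] ennreal_leI del: ennreal_plus)
          then have "a \<le> ennreal (2 powr p) * (abs_powr (u x - u y) p + abs_powr (u y) p)"
            unfolding a_def using p by (intro order_trans[OF ennreal_powr_mono ennreal_powr_add_le]) auto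
          also have "\<dots> \<le> ennreal (2 powr p) * (G x + G y + abs_powr (u y) p)"
            using osc'[of x y] rs[OF x(1) _ True] elim x by (intro mult_left_mono add_mono) auto
          finally have "a \<le> ennreal (2 powr p) * (G x + H y)" by (simp add: H_def add.assoc)
          then show ?thesis using True x elim by (simp add: I_def)
        qed (simp add: I_def)
      qed
    qed
    also have "\<dots> = ennreal (2 powr p) * (G x * emeasure \<mu> (?B x) + (\<integral>\<^sup>+y. H y * I x y \<partial>\<mu>))"
      using x by (simp add: nn_integral_cmult nn_integral_add volume)
    finally have "m x * (a * emeasure \<mu> (?B x))
        \<le> m x * (ennreal (2 powr p) * (G x * emeasure \<mu> (?B x) + (\<integral>\<^sup>+y. H y * I x y \<partial>\<mu>)))"
      by (rule mult_left_mono) simp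
    also have "\<dots> = ennreal (2 powr p) * (G x * (m x * emeasure \<mu> (?B x)) + m x * (\<integral>\<^sup>+y. H y * I x y \<partial>\<mu>))"
      by (simp add: distrib_left mult.left_commute)
    also have "m x * (a * emeasure \<mu> (?B x)) = a * (m x * emeasure \<mu> (?B x))"
      by (simp add: mult.left_commute)
    finally show ?thesis by (simp add: m_eq(2)[OF x(1)] a_def)
  qed
  have "(\<integral>\<^sup>+x\<in>Z. abs_powr (u x) p \<partial>\<nu>)
      \<le> (\<integral>\<^sup>+x. ennreal (2 powr p) * (G x + indicator Z x * m x * (\<integral>\<^sup>+y. H y * I x y \<partial>\<mu>)) \<partial>\<nu>)"
  proof (rule nn_integral_mono_AE)
    show "AE x in \<nu>. abs_powr (u x) p * indicator Z x
        \<le> ennreal (2 powr p) * (G x + indicator Z x * m x * (\<integral>\<^sup>+y. H y * I x y \<partial>\<mu>))"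
      using AE_not_in[OF E'] AE_space
    proof eventually_elim
      case (elim x)
      then show ?case using point[of x] by (auto split: split_indicator simp: space)
    qed
  qed
  also have "\<dots> = ennreal (2 powr p) * ((\<integral>\<^sup>+x. G x \<partial>\<nu>)
      + (\<integral>\<^sup>+x. indicator Z x * m x * (\<integral>\<^sup>+y. H y * I x y \<partial>\<mu>) \<partial>\<nu>))"
    by (simp add: nn_integral_cmult nn_integral_add)
  also have "(\<integral>\<^sup>+x. indicator Z x * m x * (\<integral>\<^sup>+y. H y * I x y \<partial>\<mu>) \<partial>\<nu>)
      = (\<integral>\<^sup>+x. (\<integral>\<^sup>+y. H y * (indicator Z x * m x * I x y) \<partial>\<mu>) \<partial>\<nu>)"
  proof (rule nn_integral_cong)
    fix x assume "x \<in> space \<nu>"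
    then have x: "x \<in> ?X" by (simp add: space)
    have "indicator Z x * m x * (\<integral>\<^sup>+y. H y * I x y \<partial>\<mu>) = (\<integral>\<^sup>+y. indicator Z x * m x * (H y * I x y) \<partial>\<mu>)"
      using x by (intro nn_integral_cmult[symmetric]) measurable
    then show "indicator Z x * m x * (\<integral>\<^sup>+y. H y * I x y \<partial>\<mu>) = (\<integral>\<^sup>+y. H y * (indicator Z x * m x * I x y) \<partial>\<mu>)"
      by (simp only: mult_ac)
  qed
  also have "\<dots> = (\<integral>\<^sup>+y. (\<integral>\<^sup>+x. H y * (indicator Z x * m x * I x y) \<partial>\<nu>) \<partial>\<mu>)"
    by (rule \<mu>\<nu>.Fubini') measurable
  also have "\<dots> \<le> (\<integral>\<^sup>+y. \<delta> * H y \<partial>\<mu>)"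
  proof (rule nn_integral_mono)
    fix y assume y: "y \<in> ?X"
    have "(\<integral>\<^sup>+x. H y * (indicator Z x * m x * I x y) \<partial>\<nu>) = H y * (\<integral>\<^sup>+x. indicator Z x * m x * I x y \<partial>\<nu>)"
      using y by (intro nn_integral_cmult) measurable
    also have "(\<integral>\<^sup>+x. indicator Z x * m x * I x y \<partial>\<nu>) = (\<integral>\<^sup>+x\<in>Z. m x * indicator (?B y) x \<partial>\<nu>)"
      using y by (intro nn_integral_cong) (auto simp: I(2) space split: split_indicator)
    also have "H y * \<dots> \<le> H y * \<delta>" using kernel[OF y] unfolding m_def by (rule mult_left_mono) simp
    finally show "(\<integral>\<^sup>+x. H y * (indicator Z x * m x * I x y) \<partial>\<nu>) \<le> \<delta> * H y"
      by (simp only: mult.commute)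
  qed
  also have "\<dots> = \<delta> * ((\<integral>\<^sup>+y. G y \<partial>\<mu>) + (Lp_mass \<mu> p u))"
    by (simp add: nn_integral_cmult nn_integral_add H_def)
  also have "\<dots> \<le> \<delta> * (ennreal \<eta> + (Lp_mass \<mu> p u))"
    using int by (intro mult_left_mono add_mono) auto
  also have "(\<integral>\<^sup>+x. G x \<partial>\<nu>) \<le> ennreal C * ennreal \<eta>"
    using int by (intro order_trans[OF nn_integral_le_cmult_measure[OF sets le]] mult_left_mono) auto
  finally show ?thesis by (simp add: add_mono mult_left_mono)
qed

text \<open>The cells are a disjointed sequence of small balls covering the space. Making \<open>\<integral>G d\<mu>\<close> small forces
  the radius \<open>r\<close> to be small, which is why (i) and (ii) are assumed for all small radii; for this
  fixed \<open>r\<close> the kernel over the uncovered part then becomes uniformly small.\<close>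

lemma tight_if_kernel_condition:
  fixes \<rho> :: "'a \<Rightarrow> 'a \<Rightarrow> real"
  assumes qmm: "quasi_metric_measure_space d \<mu>" and sets: "sets \<nu> = sets \<mu>" and C: "0 < C"
    and le: "\<forall>A\<in>sets \<mu>. emeasure \<nu> A \<le> ennreal C * emeasure \<mu> A"
    and \<rho>: "quasi_metric (space \<mu>) \<rho>"
    and sym: "\<And>x y. x \<in> space \<mu> \<Longrightarrow> y \<in> space \<mu> \<Longrightarrow> \<rho> x y = \<rho> y x"
    and eqv: "qm_equivalent (space \<mu>) \<rho> d"
    and cont: "continuous_map (prod_topology (qm_topology (space \<mu>) d) (qm_topology (space \<mu>) d))
            euclideanreal (\<lambda>(x, y). \<rho> x y)"
    and r0: "0 < r0" and x0: "x0 \<in> space \<mu>"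
    and equi: "\<And>r. r \<in> {0<..r0} \<Longrightarrow> equi_integrable \<nu>
         ((\<lambda>y x. indicator (qm_ball (space \<mu>) \<rho> y r) x / measure \<mu> (qm_ball (space \<mu>) \<rho> x r)) ` space \<mu>)"
    and far: "\<And>r. r \<in> {0<..r0} \<Longrightarrow>
          ((\<lambda>R. SUP y \<in> space \<mu> - qm_ball (space \<mu>) \<rho> x0 R.
                 \<integral>\<^sup>+x\<in>qm_ball (space \<mu>) \<rho> y r.
                   ennreal (1 / measure \<mu> (qm_ball (space \<mu>) \<rho> x r)) \<partial>\<nu>)
               \<longlongrightarrow> 0) at_top"
    and p: "0 < p" and a: "0 < \<alpha>"
  shows "uniformly_tight_cells d \<mu> \<nu> \<alpha> p"
  unfolding uniformly_tight_cells_def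
proof (intro allI impI)
  fix M :: ennreal and s \<eta> :: real
  assume M: "M < top" and s: "0 < s" and eta: "0 < \<eta>"
  let ?X = "space \<mu>" and ?D = "qm_ball (space \<mu>) d" and ?B = "qm_ball (space \<mu>) \<rho>"
  have space: "space \<nu> = ?X" using sets by (rule sets_eq_imp_space_eq)
  have qm: "quasi_metric ?X d"
    and ball: "\<And>x r. x \<in> ?X \<Longrightarrow> 0 < r \<Longrightarrow> ?D x r \<in> sets \<mu>"
      "\<And>x r. x \<in> ?X \<Longrightarrow> 0 < r \<Longrightarrow> 0 < emeasure \<mu> (?D x r)"
      "\<And>x r. x \<in> ?X \<Longrightarrow> 0 < r \<Longrightarrow> emeasure \<mu> (?D x r) < top"
    using qmm by (auto simp: quasi_metric_measure_space_def)
  obtain \<kappa> where \<kappa>: "0 < \<kappa>" "\<And>x y. x \<in> ?X \<Longrightarrow> y \<in> ?X \<Longrightarrow> inverse \<kappa> * \<rho> x y \<le> d x y"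
      "\<And>x y. x \<in> ?X \<Longrightarrow> y \<in> ?X \<Longrightarrow> d x y \<le> \<kappa> * \<rho> x y"
    using eqv unfolding qm_equivalent_def by auto
  have B_sub: "?B x r \<subseteq> ?D x (\<kappa> * r)" if "x \<in> ?X" for x r
  proof
    fix y assume "y \<in> ?B x r"
    then have y: "y \<in> ?X" "\<rho> x y < r" by (auto simp: qm_ball_def)
    then have "\<kappa> * \<rho> x y < \<kappa> * r" using \<kappa>(1) by simp
    then show "y \<in> ?D x (\<kappa> * r)" using \<kappa>(3)[OF that y(1)] y(1) by (simp add: qm_ball_def)
  qed
  have D_sub: "?D x (r / \<kappa>) \<subseteq> ?B x r" if "x \<in> ?X" for x r
  proof
    fix y assume "y \<in> ?D x (r / \<kappa>)"
    then have y: "y \<in> ?X" "d x y < r / \<kappa>" by (auto simp: qm_ball_def)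
    then have "inverse \<kappa> * \<rho> x y < r / \<kappa>" using \<kappa>(2)[OF that y(1)] by simp
    then show "y \<in> ?B x r" using \<kappa>(1) y(1) by (simp add: qm_ball_def field_simps)
  qed
  \<comment> \<open>\<open>\<eta>1\<close> and \<open>\<delta>\<close> are such that each of the two terms of the tail estimate is at most \<open>\<eta> / 2\<close>.\<close>
  obtain M' where M': "M = ennreal M'" "0 \<le> M'" using M by (rule ennreal_less_topE)
  define P where "P = (2::real) powr p"
  have P: "0 < P" by (simp add: P_def)
  define \<eta>1 where "\<eta>1 = \<eta> / (2 * P * C)"
  have \<eta>1: "0 < \<eta>1" "P * (C * \<eta>1) = \<eta> / 2" using eta P C by (auto simp: \<eta>1_def)
  define \<delta> where "\<delta> = \<eta> / (2 * P * (\<eta>1 + M'))"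
  have \<delta>: "0 < \<delta>" "P * (\<delta> * (\<eta>1 + M')) = \<eta> / 2"
    using eta P \<eta>1 M' by (auto simp: \<delta>_def add_pos_nonneg)
  obtain s1 where s1: "0 < s1" "\<And>u. u \<in> weak_hajlasz_ball d \<mu> \<alpha> p M \<Longrightarrow> \<exists>G. oscillation_bound d \<mu> p s1 \<eta>1 u G"
    using weak_imp_oscillation_bound[OF qm p a M \<eta>1(1)] by blast
  \<comment> \<open>\<open>\<rho> x y < r\<close> implies \<open>d x y < s1\<close>, so the oscillation bound is available on \<open>\<rho>\<close>-balls of radius \<open>r\<close>.\<close>
  define r where "r = min r0 (s1 / \<kappa>)"
  have r: "0 < r" "r \<in> {0<..r0}" "\<kappa> * r \<le> s1"
    using r0 s1 \<kappa> by (auto simp: r_def min_def field_simps)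
  have sub: "{z \<in> ?X \<times> ?X. \<rho> (fst z) (snd z) < r} \<in> sets (\<mu> \<Otimes>\<^sub>M \<mu>)"
    by (rule continuous_sublevel_in_product_sets[OF qmm cont])
  have Bm: "?B x r \<in> sets \<mu>" if "x \<in> ?X" for x
  proof -
    have "Pair x -` {z \<in> ?X \<times> ?X. \<rho> (fst z) (snd z) < r} \<in> sets \<mu>"
      by (rule sets_Pair1[OF sub])
    moreover have "Pair x -` {z \<in> ?X \<times> ?X. \<rho> (fst z) (snd z) < r} = ?B x r"
      using that by (auto simp: qm_ball_def)
    ultimately show ?thesis by simp
  qed
  have Bpos: "0 < emeasure \<mu> (?B x r)" "emeasure \<mu> (?B x r) < top" if x: "x \<in> ?X" for x
  proof -
    have "emeasure \<mu> (?D x (r / \<kappa>)) \<le> emeasure \<mu> (?B x r)"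
      using D_sub[OF x] Bm[OF x] by (rule emeasure_mono)
    then show "0 < emeasure \<mu> (?B x r)" using ball(2)[OF x, of "r / \<kappa>"] r \<kappa> by simp
    have "emeasure \<mu> (?B x r) \<le> emeasure \<mu> (?D x (\<kappa> * r))"
      using B_sub[OF x] ball(1)[OF x] r \<kappa> by (intro emeasure_mono) auto
    then show "emeasure \<mu> (?B x r) < top" using ball(3)[OF x, of "\<kappa> * r"] r \<kappa> by (auto intro: le_less_trans)
  qed
  obtain t where t: "0 < t" "\<forall>z\<in>?X. \<forall>x\<in>?D z t. \<forall>y\<in>?D z t. d x y < s"
    using qm_ball_small_diam[OF qm s] by (elim exE conjE)
  obtain z :: "nat \<Rightarrow> 'a" where z: "\<And>i. z i \<in> ?X" "\<And>x. x \<in> ?X \<Longrightarrow> \<exists>i. x \<in> ?D (z i) t"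
    using ex_countable_cover[OF qmm t(1)] by blast
  define b where "b = (\<lambda>i. ?D (z i) t)"
  have b: "b i \<in> sets \<mu>" for i using ball(1) z(1) t(1) by (auto simp: b_def)
  note cells = disjointed_ball_cells[where z=z, OF qmm z(1) t, folded b_def]
  define Z where "Z = (\<lambda>N. ?X - (\<Union>i<N. b i))"
  have Zm: "Z N \<in> sets \<mu>" for N unfolding Z_def using b by auto
  \<comment> \<open>For centres outside \<open>B\<^sub>\<rho>(x\<^sub>0, R)\<close> the kernel is small even before it is restricted to \<open>Z N\<close>.\<close>
  define k where "k = (\<lambda>x. ennreal (1 / measure \<mu> (?B x r)))"
  have "eventually (\<lambda>R. (SUP y \<in> ?X - ?B x0 R. \<integral>\<^sup>+x\<in>?B y r. k x \<partial>\<nu>) < ennreal \<delta>) at_top"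
    using far[OF r(2)] \<delta>(1) unfolding k_def by (intro order_tendstoD(2)) auto
  then have "eventually (\<lambda>R. 0 < R \<and> (SUP y \<in> ?X - ?B x0 R. \<integral>\<^sup>+x\<in>?B y r. k x \<partial>\<nu>) < ennreal \<delta>) at_top"
    by (intro eventually_conj eventually_gt_at_top)
  from eventually_happens'[OF trivial_limit_at_top_linorder this]
  obtain R where R: "0 < R" "(SUP y \<in> ?X - ?B x0 R. \<integral>\<^sup>+x\<in>?B y r. k x \<partial>\<nu>) < ennreal \<delta>"
    by (elim exE conjE)
  \<comment> \<open>For the other centres only the part of \<open>Z N\<close> in one fixed \<open>d\<close>-ball matters; its \<open>\<nu>\<close>-measure
      tends to 0, so that equi-integrability applies for some \<open>N\<close>.\<close>
  obtain K where "qm_constant ?X \<rho> K"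
    using ex_qm_constant[OF \<rho>] ..
  note K = qm_constantD[OF this]
  define R' where "R' = \<kappa> * (K * max R r)"
  have R': "0 < R'" using \<kappa> K(1) R by (auto simp: R'_def max_def)
  have near: "?B y r \<subseteq> ?D x0 R'" if y: "y \<in> ?B x0 R" for y
  proof
    fix x assume "x \<in> ?B y r"
    then have x: "x \<in> ?X" "\<rho> y x < r" by (auto simp: qm_ball_def)
    have y': "y \<in> ?X" "\<rho> x0 y < R" using y by (auto simp: qm_ball_def)
    have "max (\<rho> x0 y) (\<rho> y x) < max R r" using x y' by auto
    then have "K * max (\<rho> x0 y) (\<rho> y x) < K * max R r" using K(1) by simp
    then have "\<rho> x0 x < K * max R r" using K(3)[OF x0 x(1) y'(1)] by simp
    then show "x \<in> ?D x0 R'" using B_sub[OF x0, of "K * max R r"] x(1) by (auto simp: R'_def qm_ball_def)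
  qed
  define A where "A = (\<lambda>N. Z N \<inter> ?D x0 R')"
  have Am: "A N \<in> sets \<mu>" for N using Zm ball(1)[OF x0 R'] by (auto simp: A_def)
  have "(\<lambda>N. emeasure \<nu> (A N)) \<longlonglongrightarrow> emeasure \<nu> (\<Inter>N. A N)"
  proof (rule Lim_emeasure_decseq)
    show "range A \<subseteq> sets \<nu>" using Am sets by auto
    show "decseq A" by (force simp: decseq_def A_def Z_def)
    fix N
    have "emeasure \<nu> (A N) \<le> emeasure \<nu> (?D x0 R')"
      using ball(1)[OF x0 R'] sets by (intro emeasure_mono) (auto simp: A_def)
    also have "\<dots> \<le> ennreal C * emeasure \<mu> (?D x0 R')" using le ball(1)[OF x0 R'] by blast
    also have "\<dots> < top" by (rule ennreal_mult_less_topI[OF ennreal_less_top ball(3)[OF x0 R']])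
    finally show "emeasure \<nu> (A N) \<noteq> \<infinity>" by simp
  qed
  moreover have "(\<Inter>N. A N) = {}"
  proof -
    have False if x: "\<And>N. x \<in> A N" for x
    proof -
      have "x \<in> ?X" using x[of 0] by (auto simp: A_def qm_ball_def)
      then obtain i where "x \<in> b i" using z(2) by (auto simp: b_def)
      then show False using x[of "Suc i"] by (auto simp: A_def Z_def)
    qed
    then show ?thesis by blast
  qed
  ultimately have lim: "(\<lambda>N. emeasure \<nu> (A N)) \<longlonglongrightarrow> 0" by simp
  obtain \<delta>' where \<delta>': "0 < \<delta>'" "\<And>S. S \<in> sets \<nu> \<Longrightarrow> emeasure \<nu> S < ennreal \<delta>' \<Longrightarrow>
     (SUP f\<in>(\<lambda>y x. indicator (?B y r) x / measure \<mu> (?B x r)) ` ?X. \<integral>\<^sup>+x\<in>S. ennreal \<bar>f x\<bar> \<partial>\<nu>) < ennreal \<delta>"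
    using equi[OF r(2), unfolded equi_integrable_def, rule_format, OF \<delta>(1)] by (elim exE conjE) auto
  have "eventually (\<lambda>N. emeasure \<nu> (A N) < ennreal \<delta>') sequentially"
    using lim \<delta>'(1) by (intro order_tendstoD(2)) auto
  then obtain N where N: "emeasure \<nu> (A N) < ennreal \<delta>'"
    by (auto simp: eventually_sequentially)
  have kernel: "(\<integral>\<^sup>+x\<in>Z N. k x * indicator (?B y r) x \<partial>\<nu>) \<le> ennreal \<delta>" if y: "y \<in> ?X" for y
  proof (cases "y \<in> ?B x0 R")
    case True
    define f where "f = (\<lambda>x. indicator (?B y r) x / measure \<mu> (?B x r))"
    have "(\<integral>\<^sup>+x\<in>Z N. k x * indicator (?B y r) x \<partial>\<nu>) \<le> (\<integral>\<^sup>+x\<in>A N. ennreal \<bar>f x\<bar> \<partial>\<nu>)"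
      using near[OF True] by (intro nn_integral_mono) (auto simp: k_def f_def A_def split: split_indicator)
    also have "\<dots> \<le> (SUP f\<in>(\<lambda>y x. indicator (?B y r) x / measure \<mu> (?B x r)) ` ?X. \<integral>\<^sup>+x\<in>A N. ennreal \<bar>f x\<bar> \<partial>\<nu>)"
      using y by (intro SUP_upper) (auto simp: f_def)
    also have "\<dots> < ennreal \<delta>"
      using \<delta>'(2)[OF _ N] Am sets by auto
    finally show ?thesis by simp
  next
    case False
    have "(\<integral>\<^sup>+x\<in>Z N. k x * indicator (?B y r) x \<partial>\<nu>) \<le> (\<integral>\<^sup>+x\<in>?B y r. k x \<partial>\<nu>)"
      by (intro nn_integral_mono) (auto split: split_indicator)
    also have "\<dots> \<le> (SUP y \<in> ?X - ?B x0 R. \<integral>\<^sup>+x\<in>?B y r. k x \<partial>\<nu>)"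
      using y False by (intro SUP_upper) auto
    finally show ?thesis using R(2) by simp
  qed
  have tail: "(\<integral>\<^sup>+x\<in>Z N. abs_powr (u x) p \<partial>\<nu>) \<le> ennreal \<eta>"
    if u: "u \<in> weak_hajlasz_ball d \<mu> \<alpha> p M" for u
  proof -
    obtain G where G: "oscillation_bound d \<mu> p s1 \<eta>1 u G" using s1(2)[OF u] by blast
    have um: "u \<in> borel_measurable \<mu>" and uM: "Lp_mass \<mu> p u \<le> ennreal M'"
      using u M' by (auto simp: weak_hajlasz_ball_def)
    have rs: "d x y < s1" if "x \<in> ?X" "y \<in> ?X" "\<rho> x y < r" for x y
    proof -
      have "\<kappa> * \<rho> x y < \<kappa> * r" using that(3) \<kappa>(1) by simp
      then show ?thesis using \<kappa>(3)[OF that(1,2)] r(3) by simp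
    qed
    have "(\<integral>\<^sup>+x\<in>Z N. abs_powr (u x) p \<partial>\<nu>)
      \<le> ennreal (2 powr p) * (ennreal C * ennreal \<eta>1 + ennreal \<delta> * (ennreal \<eta>1 + (Lp_mass \<mu> p u)))"
      by (rule nn_integral_tail_le_kernel[OF qmm sets le sub sym Bpos p um G rs Zm kernel[unfolded k_def]])
    also have "\<dots> \<le> ennreal (2 powr p) * (ennreal C * ennreal \<eta>1 + ennreal \<delta> * (ennreal \<eta>1 + ennreal M'))"
      using uM by (intro mult_left_mono add_mono) auto
    also have "\<dots> = ennreal (P * (C * \<eta>1) + P * (\<delta> * (\<eta>1 + M')))"
      using P C \<eta>1(1) \<delta>(1) M'(2) unfolding P_def[symmetric]
      by (simp add: ennreal_plus[symmetric] ennreal_mult[symmetric] distrib_left del: ennreal_plus)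
    also have "P * (C * \<eta>1) + P * (\<delta> * (\<eta>1 + M')) = \<eta>" unfolding \<eta>1(2) \<delta>(2) by simp
    finally show ?thesis .
  qed
  show "\<exists>(N::nat) Q. disjoint_family_on Q {..<N} \<and>
        (\<forall>i<N. Q i \<in> sets \<mu> \<and> emeasure \<mu> (Q i) < top \<and> (\<forall>x\<in>Q i. \<forall>y\<in>Q i. d x y < s)) \<and>
        (\<forall>u\<in>weak_hajlasz_ball d \<mu> \<alpha> p M.
           (\<integral>\<^sup>+x\<in>space \<mu> - (\<Union>i<N. Q i). abs_powr (u x) p \<partial>\<nu>) \<le> ennreal \<eta>)"
    using cells(1)[of N] cells(2)[of N] tail
    by (intro exI[of _ N] exI[of _ "disjointed b"]) (simp add: cells(3) Z_def)
qed

section \<open>Hoelder continuous bumps from chains\<close>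

text \<open>The supremum is a genuine one, as the quasi-triangle inequality bounds the set; the value 1 occurs
  in it for \<open>z = x \<noteq> y\<close>.\<close>

lemma qm_const_bounds:
  assumes qm: "quasi_metric X d"
  shows "1 \<le> qm_const X d"
    and "x \<in> X \<Longrightarrow> y \<in> X \<Longrightarrow> z \<in> X \<Longrightarrow> d x y \<le> qm_const X d * max (d x z) (d z y)"
proof -
  obtain C where "qm_constant X d C"
    using ex_qm_constant[OF qm] ..
  note C = qm_constantD[OF this]
  define A where "A = {d x y / max (d x z) (d z y) | x y z. x \<in> X \<and> y \<in> X \<and> z \<in> X \<and> \<not> (x = y \<and> y = z)}"
  have pos: "0 < max (d x z) (d z y)" if "x \<in> X" "y \<in> X" "z \<in> X" "\<not> (x = y \<and> y = z)" for x y z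
    using that C(4)[of x z] C(4)[of z y] C(5)[of x z] C(5)[of z y] by (auto simp: less_max_iff_disj less_le)
  have "bdd_above A"
  proof (rule bdd_aboveI)
    fix a assume "a \<in> A"
    then obtain x y z where a: "a = d x y / max (d x z) (d z y)" and xyz: "x \<in> X" "y \<in> X" "z \<in> X" "\<not> (x = y \<and> y = z)"
      unfolding A_def by blast
    show "a \<le> C" unfolding a using C(3)[OF xyz(1-3)] pos[OF xyz] by (simp add: pos_divide_le_eq)
  qed
  then have upper: "a \<le> qm_const X d" if "a \<in> A" for a
    using that unfolding qm_const_def A_def[symmetric] by (rule cSup_upper[rotated])
  obtain x y where xy: "x \<in> X" "y \<in> X" "x \<noteq> y" using qm unfolding quasi_metric_def by auto
  have "d x y / max (d x x) (d x y) \<in> A" unfolding A_def using xy by blast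
  moreover have "d x x = 0" "0 < d x y" using C(4,5) xy by (auto simp: less_le)
  ultimately show one: "1 \<le> qm_const X d" using upper[of "d x y / max (d x x) (d x y)"] by simp
  show "d x y \<le> qm_const X d * max (d x z) (d z y)" if xyz: "x \<in> X" "y \<in> X" "z \<in> X" for x y z
  proof (cases "x = y \<and> y = z")
    case True
    then show ?thesis using C(5)[OF xyz(1,1)] by simp
  next
    case False
    have "d x y / max (d x z) (d z y) \<in> A" unfolding A_def using xyz False by blast
    from upper[OF this] show ?thesis using pos[OF xyz False] by (simp add: pos_divide_le_eq)
  qed
qed

text \<open>Frink's lemma, with the two end links counted only half so that the induction closes. If neither
  end link alone controls \<open>D (f l) (f m)\<close>, there is an inner link \<open>r\<close> where control passes from
  the right part of the chain to the left part. Then both \<open>D (f l) (f (Suc r))\<close> and \<open>D (f r) (f m)\<close>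
  are at least half of \<open>D (f l) (f m)\<close>, and in the sum of the two induction hypotheses the doubly
  counted link \<open>r\<close> is compensated by the end corrections.\<close>

lemma chain_inequality_interior:
  fixes D :: "'a \<Rightarrow> 'a \<Rightarrow> real"
  assumes nn: "\<And>x y. x \<in> X \<Longrightarrow> y \<in> X \<Longrightarrow> 0 \<le> D x y"
    and max2: "\<And>x y z. x \<in> X \<Longrightarrow> y \<in> X \<Longrightarrow> z \<in> X \<Longrightarrow> D x y \<le> 2 * max (D x z) (D z y)"
    and f: "\<And>i. i \<le> N \<Longrightarrow> f i \<in> X"
  shows "l + 2 \<le> m \<Longrightarrow> m \<le> N \<Longrightarrow>
     D (f l) (f m) \<le> 4 * (\<Sum>i=l..<m. D (f i) (f (Suc i))) - 2 * D (f l) (f (Suc l)) - 2 * D (f (m - 1)) (f m)"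
proof (induction "m - l" arbitrary: l m rule: less_induct)
  case less
  define c where "c = (\<lambda>i. D (f i) (f (Suc i)))"
  define S where "S = (\<lambda>l m. \<Sum>i=l..<m. c i)"
  have c0: "0 \<le> c i" if "i < N" for i using that nn f by (simp add: c_def)
  have X: "f i \<in> X" if "i \<le> m" for i using that less.prems f by simp
  have Suc_m1: "Suc (m - 1) = m" using less.prems by simp
  have ends: "c l + c (m - 1) \<le> S l m"
  proof -
    have "S l m = c l + S (Suc l) m" using less.prems by (simp add: S_def sum.atLeast_Suc_lessThan)
    moreover have "S (Suc l) m = S (Suc l) (m - 1) + c (m - 1)"
      using less.prems sum.atLeastLessThan_Suc[of "Suc l" "m - 1" c] Suc_m1 by (simp add: S_def)
    moreover have "0 \<le> S (Suc l) (m - 1)" unfolding S_def using c0 less.prems by (intro sum_nonneg) auto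
    ultimately show ?thesis by linarith
  qed
  have "D (f l) (f m) \<le> 4 * S l m - 2 * c l - 2 * c (m - 1)"
  proof (cases "D (f l) (f m) \<le> 2 * c l \<or> D (f l) (f m) \<le> 2 * c (m - 1)")
    case True
    moreover have "0 \<le> c l" "0 \<le> c (m - 1)" using c0 less.prems by auto
    ultimately show ?thesis using ends by linarith
  next
    case False
    define P where "P = (\<lambda>r. D (f l) (f m) \<le> 2 * D (f r) (f m))"
    have alt: "P r \<or> D (f l) (f m) \<le> 2 * D (f l) (f r)" if "r \<le> m" for r
      using max2[OF X X X, of l m r] that less.prems by (auto simp: P_def max_def split: if_splits)
    have P1: "P (Suc l)" using alt[of "Suc l"] False less.prems by (auto simp: c_def)
    have P2: "\<not> P (m - 1)" using False Suc_m1 by (simp add: P_def c_def)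
    have "\<exists>r\<ge>Suc l. r < m - 1 \<and> P r \<and> \<not> P (Suc r)"
    proof (rule ccontr)
      assume *: "\<not> ?thesis"
      have "k \<le> m - 1 \<longrightarrow> P k" if "Suc l \<le> k" for k
        using that by (induction k rule: dec_induct) (use P1 * in auto)
      then show False using P2 less.prems by auto
    qed
    then obtain r where r: "Suc l \<le> r" "r < m - 1" "P r" "\<not> P (Suc r)" by blast
    have "D (f l) (f (Suc r)) \<le> 4 * S l (Suc r) - 2 * c l - 2 * c r"
      using less.hyps[of "Suc r" l] r less.prems by (simp add: S_def c_def)
    moreover have "D (f r) (f m) \<le> 4 * S r m - 2 * c r - 2 * c (m - 1)"
      using less.hyps[of m r] r less.prems Suc_m1 by (simp add: S_def c_def)
    moreover have "D (f l) (f m) \<le> 2 * D (f l) (f (Suc r))" using alt[of "Suc r"] r by auto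
    moreover have "D (f l) (f m) \<le> 2 * D (f r) (f m)" using r(3) by (simp add: P_def)
    moreover have "S l (Suc r) = S l r + c r" using r by (simp add: S_def)
    moreover have "S l m = S l r + S r m"
      unfolding S_def using r by (intro sum.atLeastLessThan_concat[symmetric]) auto
    ultimately show ?thesis by linarith
  qed
  then show ?case using Suc_m1 by (simp add: S_def c_def)
qed

lemma chain_inequality:
  fixes D :: "'a \<Rightarrow> 'a \<Rightarrow> real"
  assumes nn: "\<And>x y. x \<in> X \<Longrightarrow> y \<in> X \<Longrightarrow> 0 \<le> D x y"
    and zero: "\<And>x. x \<in> X \<Longrightarrow> D x x = 0"
    and max2: "\<And>x y z. x \<in> X \<Longrightarrow> y \<in> X \<Longrightarrow> z \<in> X \<Longrightarrow> D x y \<le> 2 * max (D x z) (D z y)"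
    and f: "\<And>i. i \<le> n \<Longrightarrow> f i \<in> X"
  shows "D (f 0) (f n) \<le> 4 * (\<Sum>i<n. D (f i) (f (Suc i)))"
proof -
  consider "n = 0" | "n = 1" | "2 \<le> n" by linarith
  then show ?thesis
  proof cases
    case 1
    then show ?thesis using zero f by simp
  next
    case 2
    then show ?thesis using nn[of "f 0" "f 1"] f by simp
  next
    case 3
    have "D (f 0) (f n) \<le> 4 * (\<Sum>i=0..<n. D (f i) (f (Suc i))) - 2 * D (f 0) (f (Suc 0)) - 2 * D (f (n - 1)) (f n)"
      using 3 by (intro chain_inequality_interior[OF nn max2 f]) auto
    moreover have "0 \<le> D (f 0) (f (Suc 0))" "0 \<le> D (f (n - 1)) (f n)" using nn f 3 by auto
    ultimately show ?thesis by (simp add: atLeast0LessThan)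
  qed
qed

text \<open>The infimum of this set is Frink's chain distance from \<open>x\<close> to \<open>A\<close>. Taking the infimum
  over all endpoints in \<open>A\<close> at once avoids a second infimum over \<open>A\<close>.\<close>

definition chain_lengths :: "'a set \<Rightarrow> ('a \<Rightarrow> 'a \<Rightarrow> real) \<Rightarrow> 'a set \<Rightarrow> 'a \<Rightarrow> real set" where
  "chain_lengths X D A x =
     {(\<Sum>i<n. D (f i) (f (Suc i))) | f n. f 0 = x \<and> f n \<in> A \<and> (\<forall>i\<le>n. f i \<in> X)}"

lemma chain_lengths_step:
  assumes "x \<in> X" "s \<in> chain_lengths X D A y"
  shows "D x y + s \<in> chain_lengths X D A x"
proof -
  obtain f and n :: nat where f: "s = (\<Sum>i<n. D (f i) (f (Suc i)))" "f 0 = y" "f n \<in> A" "\<forall>i\<le>n. f i \<in> X"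
    using assms(2) unfolding chain_lengths_def by blast
  define g where "g = (\<lambda>i. case i of 0 \<Rightarrow> x | Suc j \<Rightarrow> f j)"
  have "(\<Sum>i<Suc n. D (g i) (g (Suc i))) = D x y + s"
    unfolding sum.lessThan_Suc_shift using f by (simp add: g_def)
  moreover have "g 0 = x" "g (Suc n) \<in> A" "\<forall>i\<le>Suc n. g i \<in> X"
    using f assms(1) by (auto simp: g_def split: nat.split)
  ultimately show ?thesis
    unfolding chain_lengths_def by (intro CollectI exI[of _ g] exI[of _ "Suc n"]) simp
qed

text \<open>With \<open>D = \<rho>\<^sup>\<gamma>\<close> the assumption on \<open>\<gamma>\<close> reads \<open>D x y \<le> 2 * max (D x z) (D z y)\<close>. The chain distance
  \<open>\<phi>\<close> to \<open>A\<close> satisfies \<open>\<phi> x \<le> D x y + \<phi> y\<close> since a link may be put in front of a chain, vanishes on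
  \<open>A\<close>, and is bounded below off \<open>B\<close> by the chain inequality. Hence \<open>max 0 (1 - \<phi> / c)\<close> is as required.
  The constant \<open>L\<close> depends on the gap \<open>t\<close> but not on \<open>A\<close> and \<open>B\<close>.\<close>

lemma ex_holder_bump:
  fixes d \<rho> :: "'a \<Rightarrow> 'a \<Rightarrow> real"
  assumes qm: "quasi_metric X d" and \<rho>: "quasi_metric X \<rho>" and eqv: "qm_equivalent X \<rho> d"
    and \<gamma>: "0 < \<gamma>" "qm_const X \<rho> powr \<gamma> \<le> 2" and t: "0 < t"
  shows "\<exists>L\<ge>0. \<forall>A B. A \<subseteq> X \<and> A \<noteq> {} \<and> (\<forall>z\<in>X - B. \<forall>a\<in>A. t \<le> d z a) \<longrightarrow>
     (\<exists>u. (\<forall>x\<in>X. 0 \<le> u x \<and> u x \<le> 1) \<and> (\<forall>a\<in>A. u a = 1) \<and> (\<forall>z\<in>X - B. u z = 0) \<and>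
          (\<forall>x\<in>X. \<forall>y\<in>X. \<bar>u x - u y\<bar> \<le> L * d x y powr \<gamma>))"
proof -
  obtain C where "qm_constant X d C"
    using ex_qm_constant[OF qm] ..
  note C = qm_constantD[OF this]
  obtain \<kappa> where \<kappa>: "0 < \<kappa>" "\<And>x y. x \<in> X \<Longrightarrow> y \<in> X \<Longrightarrow> inverse \<kappa> * \<rho> x y \<le> d x y"
      "\<And>x y. x \<in> X \<Longrightarrow> y \<in> X \<Longrightarrow> d x y \<le> \<kappa> * \<rho> x y"
    using eqv unfolding qm_equivalent_def by auto
  have \<rho>0: "0 \<le> \<rho> x y" "\<rho> x x = 0" if "x \<in> X" "y \<in> X" for x y
    using \<rho> that by (auto simp: quasi_metric_def)
  define D where "D = (\<lambda>x y. \<rho> x y powr \<gamma>)"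
  have D0: "0 \<le> D x y" "x \<in> X \<Longrightarrow> D x x = 0" for x y using \<rho>0 by (auto simp: D_def)
  have D2: "D x y \<le> 2 * max (D x z) (D z y)" if xyz: "x \<in> X" "y \<in> X" "z \<in> X" for x y z
  proof -
    let ?m = "max (\<rho> x z) (\<rho> z y)"
    have m: "0 \<le> ?m" using \<rho>0 xyz by (auto simp: le_max_iff_disj)
    have "D x y \<le> (qm_const X \<rho> * ?m) powr \<gamma>"
      unfolding D_def using qm_const_bounds(2)[OF \<rho> xyz] \<rho>0(1)[OF xyz(1,2)] \<gamma>(1) by (intro powr_mono2) auto
    also have "\<dots> = qm_const X \<rho> powr \<gamma> * ?m powr \<gamma>"
      using qm_const_bounds(1)[OF \<rho>] m by (simp add: powr_mult)
    also have "\<dots> \<le> 2 * ?m powr \<gamma>" using \<gamma>(2) by (intro mult_right_mono) auto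
    also have "?m powr \<gamma> = max (D x z) (D z y)"
    proof -
      have "\<rho> x z powr \<gamma> \<le> \<rho> z y powr \<gamma>" if "\<rho> x z \<le> \<rho> z y"
        using that \<rho>0(1)[OF xyz(1,3)] \<gamma>(1) by (intro powr_mono2) auto
      moreover have "\<rho> z y powr \<gamma> \<le> \<rho> x z powr \<gamma>" if "\<rho> z y \<le> \<rho> x z"
        using that \<rho>0(1)[OF xyz(3,2)] \<gamma>(1) by (intro powr_mono2) auto
      ultimately show ?thesis by (auto simp: D_def max_def)
    qed
    finally show ?thesis .
  qed
  define c where "c = (t / \<kappa>) powr \<gamma> / 4"
  have c: "0 < c" using t \<kappa> by (simp add: c_def)
  define L where "L = (\<kappa> * C) powr \<gamma> / c"
  have DL: "D x y \<le> c * (L * d x y powr \<gamma>)" "D y x \<le> c * (L * d x y powr \<gamma>)" if xy: "x \<in> X" "y \<in> X" for x y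
  proof -
    have d0: "0 \<le> d x y" using C(4) xy by blast
    have *: "\<rho> a b powr \<gamma> \<le> c * (L * d x y powr \<gamma>)" if ab: "a \<in> X" "b \<in> X" "d a b \<le> C * d x y" for a b
    proof -
      have "\<rho> a b \<le> \<kappa> * d a b" using \<kappa>(2)[OF ab(1,2)] \<kappa>(1) by (simp add: field_simps)
      also have "\<dots> \<le> \<kappa> * (C * d x y)" using ab(3) \<kappa>(1) by simp
      finally have "\<rho> a b powr \<gamma> \<le> (\<kappa> * C * d x y) powr \<gamma>"
        using \<rho>0(1)[OF ab(1,2)] \<gamma>(1) by (intro powr_mono2) (auto simp: mult.assoc)
      then show ?thesis using \<kappa>(1) C(1) d0 c by (simp add: L_def powr_mult)
    qed
    have "d x y \<le> C * d x y" using mult_right_mono[OF C(1) d0] by simp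
    then show "D x y \<le> c * (L * d x y powr \<gamma>)" unfolding D_def using xy by (intro *)
    show "D y x \<le> c * (L * d x y powr \<gamma>)" unfolding D_def using xy C(2) by (intro *) auto
  qed
  have "\<exists>u. (\<forall>x\<in>X. 0 \<le> u x \<and> u x \<le> 1) \<and> (\<forall>a\<in>A. u a = 1) \<and> (\<forall>z\<in>X - B. u z = 0) \<and>
          (\<forall>x\<in>X. \<forall>y\<in>X. \<bar>u x - u y\<bar> \<le> L * d x y powr \<gamma>)"
    if A: "A \<subseteq> X" "A \<noteq> {}" and B: "\<And>z a. z \<in> X - B \<Longrightarrow> a \<in> A \<Longrightarrow> t \<le> d z a" for A B
  proof -
    define \<phi> where "\<phi> x = Inf (chain_lengths X D A x)" for x
    have nn: "0 \<le> s" if "s \<in> chain_lengths X D A x" for s x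
      using that D0(1) by (auto simp: chain_lengths_def intro!: sum_nonneg)
    have bdd: "bdd_below (chain_lengths X D A x)" for x using nn by (rule bdd_belowI)
    have zero: "0 \<in> chain_lengths X D A a" if "a \<in> A" for a
      unfolding chain_lengths_def using that A(1) by (intro CollectI exI[of _ "\<lambda>_. a"] exI[of _ 0]) auto
    have ne: "chain_lengths X D A x \<noteq> {}" if "x \<in> X" for x
      using A(2) chain_lengths_step[OF that zero] by blast
    have \<phi>0: "0 \<le> \<phi> x" if "x \<in> X" for x
      unfolding \<phi>_def using ne[OF that] nn by (rule cInf_greatest)
    have \<phi>A: "\<phi> a = 0" if "a \<in> A" for a
      using cInf_lower[OF zero[OF that] bdd] \<phi>0[of a] that A(1) by (auto simp: \<phi>_def)
    have \<phi>B: "c \<le> \<phi> z" if z: "z \<in> X - B" for z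
      unfolding \<phi>_def
    proof (rule cInf_greatest)
      show "chain_lengths X D A z \<noteq> {}" using ne z by blast
      fix s assume "s \<in> chain_lengths X D A z"
      then obtain f and n :: nat where f: "s = (\<Sum>i<n. D (f i) (f (Suc i)))" "f 0 = z" "f n \<in> A" "\<forall>i\<le>n. f i \<in> X"
        unfolding chain_lengths_def by blast
      have "t \<le> \<kappa> * \<rho> z (f n)" using B[OF z f(3)] \<kappa>(3)[of z "f n"] z f(3) A(1) by auto
      then have "(t / \<kappa>) powr \<gamma> \<le> \<rho> z (f n) powr \<gamma>"
        using t \<kappa>(1) \<gamma>(1) by (intro powr_mono2) (auto simp: field_simps)
      then have "4 * c \<le> D (f 0) (f n)" by (simp add: D_def c_def f(2))
      also have "\<dots> \<le> 4 * s" unfolding f(1) using f(4) by (intro chain_inequality[OF D0(1) D0(2) D2]) auto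
      finally show "c \<le> s" by simp
    qed
    have \<phi>L: "\<phi> x \<le> D x y + \<phi> y" if xy: "x \<in> X" "y \<in> X" for x y
    proof -
      have "\<phi> x - D x y \<le> \<phi> y"
        unfolding \<phi>_def[of y]
      proof (rule cInf_greatest[OF ne[OF xy(2)]])
        fix s assume "s \<in> chain_lengths X D A y"
        then have "\<phi> x \<le> D x y + s"
          unfolding \<phi>_def by (intro cInf_lower[OF _ bdd] chain_lengths_step xy)
        then show "\<phi> x - D x y \<le> s" by simp
      qed
      then show ?thesis by simp
    qed
    define u where "u = (\<lambda>x. max 0 (1 - \<phi> x / c))"
    have "\<bar>u x - u y\<bar> \<le> L * d x y powr \<gamma>" if xy: "x \<in> X" "y \<in> X" for x y
    proof -
      have "\<phi> x - \<phi> y \<le> c * (L * d x y powr \<gamma>)" "\<phi> y - \<phi> x \<le> c * (L * d x y powr \<gamma>)"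
        using \<phi>L[OF xy] \<phi>L[OF xy(2,1)] DL[OF xy] by linarith+
      then have "\<phi> x / c - \<phi> y / c \<le> L * d x y powr \<gamma>" "\<phi> y / c - \<phi> x / c \<le> L * d x y powr \<gamma>"
        using c by (simp_all add: diff_divide_distrib[symmetric] pos_divide_le_eq mult.commute)
      then show ?thesis by (auto simp: u_def max_def)
    qed
    moreover have "0 \<le> u x \<and> u x \<le> 1" if "x \<in> X" for x using \<phi>0[OF that] c by (auto simp: u_def)
    moreover have "u a = 1" if "a \<in> A" for a using \<phi>A[OF that] by (simp add: u_def)
    moreover have "u z = 0" if "z \<in> X - B" for z using \<phi>B[OF that] c by (simp add: u_def)
    ultimately show ?thesis by (intro exI[of _ u]) blast
  qed
  moreover have "0 \<le> L" using c by (simp add: L_def)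
  ultimately show ?thesis by (intro exI[of _ L]) blast
qed

lemma holder_imp_measurable:
  fixes u :: "'a \<Rightarrow> real"
  assumes qmm: "quasi_metric_measure_space d \<mu>" and \<gamma>: "0 < \<gamma>" and L: "0 \<le> L"
    and u: "\<And>x y. x \<in> space \<mu> \<Longrightarrow> y \<in> space \<mu> \<Longrightarrow> \<bar>u x - u y\<bar> \<le> L * d x y powr \<gamma>"
  shows "u \<in> borel_measurable \<mu>"
  unfolding borel_measurable_iff_greater
proof
  fix a
  have d0: "0 \<le> d x y" if "x \<in> space \<mu>" "y \<in> space \<mu>" for x y
    using qmm that by (auto simp: quasi_metric_measure_space_def quasi_metric_def)
  have "openin (qm_topology (space \<mu>) d) {x \<in> space \<mu>. a < u x}"
    unfolding openin_qm_topology
  proof (intro conjI ballI)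
    fix x assume "x \<in> {x \<in> space \<mu>. a < u x}"
    then have x: "x \<in> space \<mu>" "a < u x" by auto
    define r where "r = ((u x - a) / (L + 1)) powr (1 / \<gamma>)"
    have r: "0 < r" using x L by (simp add: r_def)
    have "a < u y" if y: "y \<in> space \<mu>" "d x y < r" for y
    proof -
      have "d x y powr \<gamma> \<le> r powr \<gamma>" using y d0[OF x(1) y(1)] \<gamma> by (intro powr_mono2) auto
      also have "\<dots> = (u x - a) / (L + 1)" using \<gamma> x L by (simp add: r_def powr_powr)
      finally have "L * d x y powr \<gamma> \<le> L * ((u x - a) / (L + 1))" using L by (rule mult_left_mono)
      also have "\<dots> < u x - a" using x L by (simp add: field_simps)
      finally show ?thesis using u[OF x(1) y(1)] by linarith
    qed
    then show "\<exists>r>0. qm_ball (space \<mu>) d x r \<subseteq> {x \<in> space \<mu>. a < u x}"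
      using r by (intro exI[of _ r]) (auto simp: qm_ball_def)
  qed auto
  then show "{w \<in> space \<mu>. a < u w} \<in> sets \<mu>"
    using qmm by (auto simp: quasi_metric_measure_space_def)
qed

text \<open>The natural exponent is \<open>\<gamma> = 1 / log 2 C\<^sub>\<rho>\<close>, for which \<open>C\<^sub>\<rho>\<^sup>\<gamma> = 2\<close>; if \<open>C\<^sub>\<rho> = 1\<close>, every exponent
  is admissible. Strict inequality \<open>\<alpha> < \<gamma>\<close> is lost only if \<open>\<alpha>\<close> equals an attained index.\<close>

lemma ex_exponent_of_index:
  assumes "preceq_index \<alpha> q X d" "0 < \<alpha>"
  shows "\<exists>\<rho> \<gamma>. quasi_metric X \<rho> \<and> qm_equivalent X \<rho> d \<and> \<alpha> \<le> \<gamma> \<and> (\<alpha> < \<gamma> \<or> q = top) \<and>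
           qm_const X \<rho> powr \<gamma> \<le> 2"
proof -
  have *: "\<exists>\<gamma>. \<alpha> \<le> \<gamma> \<and> (ennreal \<alpha> < qm_inv_log X \<rho> \<longrightarrow> \<alpha> < \<gamma>) \<and> qm_const X \<rho> powr \<gamma> \<le> 2"
    if \<rho>: "quasi_metric X \<rho>" and le: "ennreal \<alpha> \<le> qm_inv_log X \<rho>" for \<rho>
  proof (cases "qm_const X \<rho> = 1")
    case True
    then show ?thesis by (intro exI[of _ "\<alpha> + 1"]) simp
  next
    case False
    define l where "l = log 2 (qm_const X \<rho>)"
    have C: "1 < qm_const X \<rho>" using qm_const_bounds(1)[OF \<rho>] False by simp
    then have l: "0 < l" by (simp add: l_def)
    have eq: "qm_inv_log X \<rho> = ennreal (1 / l)"
      using l by (simp add: qm_inv_log_def l_def[symmetric] inverse_ennreal divide_inverse)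
    have "qm_const X \<rho> powr (1 / l) = (2 powr l) powr (1 / l)"
      using C by (simp add: l_def)
    also have "\<dots> = 2" using l by (simp add: powr_powr)
    finally have "qm_const X \<rho> powr (1 / l) = 2" .
    moreover have "\<alpha> \<le> 1 / l" using le l unfolding eq by (simp add: ennreal_le_iff)
    moreover have "ennreal \<alpha> < qm_inv_log X \<rho> \<longrightarrow> \<alpha> < 1 / l"
      unfolding eq using assms(2) by (simp add: ennreal_less_iff)
    ultimately show ?thesis by (intro exI[of _ "1 / l"]) simp
  qed
  show ?thesis
  proof (cases "ennreal \<alpha> = qm_index X d")
    case True
    then obtain \<rho> where \<rho>: "q = top" "quasi_metric X \<rho>" "qm_equivalent X \<rho> d" "qm_inv_log X \<rho> = ennreal \<alpha>"
      using assms unfolding preceq_index_def qm_index_attained_def by auto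
    obtain \<gamma> where "\<alpha> \<le> \<gamma>" "qm_const X \<rho> powr \<gamma> \<le> 2" using *[OF \<rho>(2)] \<rho>(4) by auto
    then show ?thesis using \<rho> by blast
  next
    case False
    then have "ennreal \<alpha> < qm_index X d" using assms unfolding preceq_index_def by auto
    then obtain \<rho> where \<rho>: "quasi_metric X \<rho>" "qm_equivalent X \<rho> d" "ennreal \<alpha> < qm_inv_log X \<rho>"
      unfolding qm_index_def less_SUP_iff by auto
    obtain \<gamma> where "\<alpha> < \<gamma>" "qm_const X \<rho> powr \<gamma> \<le> 2" 
      using *[OF \<rho>(1) less_imp_le[OF \<rho>(3)]] \<rho>(3) by auto
    then show ?thesis using \<rho> by (intro exI[of _ \<rho>] exI[of _ \<gamma>]) auto
  qed
qed

section \<open>Separated bumps obstruct compactness\<close>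

text \<open>The gradient is a multiple of the indicator of \<open>B\<close> at every level: for \<open>k \<le> 0\<close> it only uses
  \<open>0 \<le> u \<le> 1\<close>, for \<open>k > 0\<close> the Hoelder bound, where \<open>\<gamma> - \<alpha>\<close> gives the decay in \<open>k\<close>.\<close>

lemma bump_norm_le:
  fixes u :: "'a \<Rightarrow> real"
  assumes qm: "quasi_metric (space m) d" and p: "0 < p" and q: "0 < q" and a: "0 < \<alpha>" "\<alpha> \<le> \<gamma>" "\<alpha> < \<gamma> \<or> q = top"
    and um: "u \<in> borel_measurable m" and u: "\<And>x. x \<in> space m \<Longrightarrow> 0 \<le> u x \<and> u x \<le> 1"
    and B: "B \<in> sets m" "\<And>x. x \<in> space m - B \<Longrightarrow> u x = 0"
    and L: "0 \<le> L" "\<And>x y. x \<in> space m \<Longrightarrow> y \<in> space m \<Longrightarrow> \<bar>u x - u y\<bar> \<le> L * d x y powr \<gamma>"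
    and s: "0 \<le> s"
  defines "R \<equiv> (1 + lq_norm q (\<lambda>k. ennreal (geometric_weight \<alpha> (\<gamma> - \<alpha>) k)) * ennreal (2 powr \<alpha> + L))
     * (ennreal s * ennreal_powr (emeasure m B) (1 / p))"
  shows "hajlasz_TL_norm d \<alpha> p q m (\<lambda>x. s * u x) \<le> R" "hajlasz_Besov_norm d \<alpha> p q m (\<lambda>x. s * u x) \<le> R"
proof -
  note B(1)[measurable]
  define w where "w = (\<lambda>k. (2 powr \<alpha> + L) * geometric_weight \<alpha> (\<gamma> - \<alpha>) k)"
  have w0: "0 \<le> w k" for k using L by (simp add: w_def less_imp_le)
  define h where "h = (\<lambda>k x. s * w k * indicator B x)"
  have h: "h \<in> frac_gradients d m \<alpha> (\<lambda>x. s * u x)"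
    unfolding frac_gradients_def
  proof (intro CollectI conjI allI ballI bexI[of _ "{}"] impI)
    fix k x y assume xy: "x \<in> space m - {}" "y \<in> space m - {}" "2 powi (- k - 1) \<le> d x y \<and> d x y < 2 powi (- k)"
    then have dl: "2 powr (- real_of_int k - 1) \<le> d x y" and du: "d x y < 2 powr (- real_of_int k)"
      by (auto simp: powi_eq_powr)
    have d0: "0 < d x y" using dl by (rule less_le_trans[rotated]) simp
    have key: "\<bar>u x - u y\<bar> \<le> d x y powr \<alpha> * w k"
    proof (cases "k \<le> 0")
      case True
      have "\<bar>u x - u y\<bar> \<le> 1" using u[of x] u[of y] xy by auto
      also have "1 = (2 powr (- real_of_int k - 1)) powr \<alpha> * (2 powr \<alpha> * 2 powr (\<alpha> * k))"
        by (simp add: powr_powr powr_add[symmetric] algebra_simps)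
      also have "\<dots> \<le> d x y powr \<alpha> * w k"
        using dl a L(1) True by (intro mult_mono powr_mono2) (auto simp: w_def geometric_weight_def)
      finally show ?thesis .
    next
      case False
      have "\<bar>u x - u y\<bar> \<le> L * d x y powr \<gamma>" using L xy by auto
      also have "\<dots> = d x y powr \<alpha> * (L * d x y powr (\<gamma> - \<alpha>))"
        by (simp add: powr_add[symmetric] mult.left_commute)
      also have "d x y powr (\<gamma> - \<alpha>) \<le> (2 powr (- real_of_int k)) powr (\<gamma> - \<alpha>)"
        using d0 du a by (intro powr_mono2) auto
      also have "\<dots> = geometric_weight \<alpha> (\<gamma> - \<alpha>) k"
        using False by (simp add: geometric_weight_def powr_powr algebra_simps)
      also have "L * geometric_weight \<alpha> (\<gamma> - \<alpha>) k \<le> w k"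
        unfolding w_def by (intro mult_right_mono) (auto simp: less_imp_le)
      finally show ?thesis using L(1) by (simp add: mult_left_mono)
    qed
    show "\<bar>s * u x - s * u y\<bar> \<le> d x y powr \<alpha> * (h k x + h k y)"
    proof (cases "x \<in> B \<or> y \<in> B")
      case True
      have "\<bar>s * u x - s * u y\<bar> = s * \<bar>u x - u y\<bar>" using s by (simp add: right_diff_distrib[symmetric] abs_mult)
      also have "\<dots> \<le> s * (d x y powr \<alpha> * w k)" using key s by (rule mult_left_mono)
      also have "\<dots> = d x y powr \<alpha> * (s * w k)" by simp
      also have "\<dots> \<le> d x y powr \<alpha> * (h k x + h k y)"
        using True s w0[of k] by (intro mult_left_mono) (auto simp: h_def split: split_indicator)
      finally show ?thesis .
    next
      case False
      then have "u x = 0" "u y = 0" using B(2) xy by auto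
      then show ?thesis using s w0[of k] by (simp add: h_def)
    qed
  qed (use s w0 in \<open>auto simp: h_def\<close>)
  define H where "H = (\<lambda>x. ennreal (s * (2 powr \<alpha> + L)) * indicator B x)"
  define l where "l = (\<lambda>k. ennreal (geometric_weight \<alpha> (\<gamma> - \<alpha>) k))"
  have Hm: "H \<in> borel_measurable m" unfolding H_def by measurable
  have dom: "ennreal (h k x) \<le> l k * H x" for k x
    using s L(1) by (auto simp: h_def w_def l_def H_def ennreal_mult[symmetric] less_imp_le mult_ac split: split_indicator)
  have ind: "Lp_norm m p (indicator B) = ennreal_powr (emeasure m B) (1 / p)"
  proof -
    have "(\<integral>\<^sup>+x. ennreal_powr (indicator B x) p \<partial>m) = (\<integral>\<^sup>+x. indicator B x \<partial>m)"
      using ennreal_powr_ennreal[of 1 p] by (intro nn_integral_cong) (auto split: split_indicator)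
    then show ?thesis by (simp add: Lp_norm_def)
  qed
  have "Lp_norm m p H = ennreal (s * (2 powr \<alpha> + L)) * ennreal_powr (emeasure m B) (1 / p)"
    unfolding H_def using p by (subst Lp_norm_cmult) (auto simp: ind)
  then have H: "Lp_norm m p H = ennreal (2 powr \<alpha> + L) * (ennreal s * ennreal_powr (emeasure m B) (1 / p))"
    using s L(1) by (simp add: ennreal_mult mult_ac)
  have "Lp_norm m p (\<lambda>x. ennreal \<bar>s * u x\<bar>) \<le> Lp_norm m p (\<lambda>x. ennreal s * indicator B x)"
  proof (rule Lp_norm_mono[OF p])
    fix x assume x: "x \<in> space m"
    have "\<bar>s * u x\<bar> \<le> s" using u[OF x] s by (simp add: abs_mult mult_left_le)
    then show "ennreal \<bar>s * u x\<bar> \<le> ennreal s * indicator B x"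
      using B(2)[of x] x by (auto split: split_indicator intro: ennreal_leI)
  qed
  also have "\<dots> = ennreal s * ennreal_powr (emeasure m B) (1 / p)"
    using p by (subst Lp_norm_cmult) (auto simp: ind)
  finally have "Lp_norm m p (\<lambda>x. ennreal \<bar>s * u x\<bar>) + lq_norm q l * Lp_norm m p H \<le> R"
    unfolding R_def l_def[symmetric] H distrib_right by (simp add: mult.assoc add_right_mono)
  moreover have "hajlasz_TL_norm d \<alpha> p q m (\<lambda>x. s * u x) \<le> Lp_norm m p (\<lambda>x. ennreal \<bar>s * u x\<bar>) + lq_norm q l * Lp_norm m p H"
    by (rule dominated_gradient_TL[OF p q h Hm dom])
  moreover have "hajlasz_Besov_norm d \<alpha> p q m (\<lambda>x. s * u x) \<le> Lp_norm m p (\<lambda>x. ennreal \<bar>s * u x\<bar>) + lq_norm q l * Lp_norm m p H"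
    by (rule dominated_gradient_Besov[OF p q h Hm dom])
  ultimately show "hajlasz_TL_norm d \<alpha> p q m (\<lambda>x. s * u x) \<le> R" "hajlasz_Besov_norm d \<alpha> p q m (\<lambda>x. s * u x) \<le> R"
    by (meson order_trans)+
qed

text \<open>In a finite \<open>e\<close>-net, infinitely many of the \<open>v i\<close> would share a net point; two of them would then
  have \<open>L\<^sup>p\<close> distance below the separation, by the choice of \<open>e\<close> with \<open>2 * 2\<^sup>p * e\<^sup>p = 1 / 2\<close>.\<close>

lemma no_compact_embedding_if_separated:
  fixes v :: "'i \<Rightarrow> 'a \<Rightarrow> real" and n1 n2 :: "'a measure \<Rightarrow> ('a \<Rightarrow> real) \<Rightarrow> ennreal"
  assumes p: "0 < p" and S: "infinite S"
    and vm: "\<And>i. i \<in> S \<Longrightarrow> v i \<in> borel_measurable m"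
    and sep: "\<And>i j. i \<in> S \<Longrightarrow> j \<in> S \<Longrightarrow> i \<noteq> j \<Longrightarrow> 1 \<le> Lp_mass m p (\<lambda>x. v i x - v j x)"
    and bdd: "\<And>i. i \<in> S \<Longrightarrow> n1 m (v i) \<le> ennreal K"
    and n2: "\<And>u. Lp_norm m p (\<lambda>x. ennreal \<bar>u x\<bar>) \<le> n2 m u"
  shows "\<not> compact_embedding m n1 m n2"
proof
  assume ce: "compact_embedding m n1 m n2"
  define e where "e = (1 / (4 * 2 powr p)) powr (1 / p)"
  have e: "0 < e" "e powr p = 1 / (4 * 2 powr p)" using p by (auto simp: e_def powr_powr)
  have 1: "v ` S \<subseteq> finite_norm_space m n1"
    using vm le_less_trans[OF bdd ennreal_less_top] by (auto simp: finite_norm_space_def)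
  have 2: "\<exists>K::real. \<forall>u\<in>v ` S. n1 m u \<le> ennreal K" using bdd by blast
  from ce have 3: "\<forall>B\<subseteq>finite_norm_space m n1. (\<exists>K::real. \<forall>u\<in>B. n1 m u \<le> ennreal K) \<longrightarrow>
        (\<forall>\<epsilon>>0. \<exists>F. finite F \<and> F \<subseteq> finite_norm_space m n2 \<and>
           (\<forall>u\<in>B. \<exists>w\<in>F. n2 m (\<lambda>x. u x - w x) < ennreal \<epsilon>))"
    unfolding compact_embedding_def by (elim conjE)
  have "\<exists>F. finite F \<and> F \<subseteq> finite_norm_space m n2 \<and>
           (\<forall>u\<in>v ` S. \<exists>w\<in>F. n2 m (\<lambda>x. u x - w x) < ennreal e)"
    using mp[OF mp[OF spec[OF 3, of "v ` S"] 1] 2] e(1) by simp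
  then obtain F where F: "finite F" "F \<subseteq> borel_measurable m" "\<forall>i\<in>S. \<exists>w\<in>F. n2 m (\<lambda>x. v i x - w x) < ennreal e"
    by (auto simp: finite_norm_space_def)
  obtain w where w: "\<And>i. i \<in> S \<Longrightarrow> w i \<in> F" "\<And>i. i \<in> S \<Longrightarrow> n2 m (\<lambda>x. v i x - w i x) < ennreal e"
    using bchoice[of S "\<lambda>i w. w \<in> F \<and> n2 m (\<lambda>x. v i x - w x) < ennreal e"] F(3) by blast
  have "finite (w ` S)" using w(1) F(1) by (meson finite_subset image_subsetI)
  then obtain i0 where i0: "i0 \<in> S" "infinite {i \<in> S. w i = w i0}"
    using pigeonhole_infinite[OF S, of w] by blast
  then have "infinite ({i \<in> S. w i = w i0} - {i0})" by simp
  then have "{i \<in> S. w i = w i0} - {i0} \<noteq> {}" by (rule infinite_imp_nonempty)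
  then obtain j where "j \<in> {i \<in> S. w i = w i0} - {i0}" by blast
  then have j: "j \<in> S" "w j = w i0" "j \<noteq> i0" by auto
  have small: "Lp_mass m p (\<lambda>x. v i x - w i x) \<le> ennreal (e powr p)" if "i \<in> S" for i
  proof -
    have "Lp_norm m p (\<lambda>x. ennreal \<bar>v i x - w i x\<bar>) \<le> ennreal e"
      using n2[of "\<lambda>x. v i x - w i x"] w(2)[OF that] by simp
    from Lp_norm_le_imp[OF p this] show ?thesis using e(1) by (simp add: ennreal_powr_ennreal)
  qed
  have [measurable]: "v j \<in> borel_measurable m" "v i0 \<in> borel_measurable m" "w i0 \<in> borel_measurable m"
    using vm j i0 w(1) F(2) by auto
  have "1 \<le> Lp_mass m p (\<lambda>x. v j x - v i0 x)" using sep j i0(1) by blast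
  also have "\<dots> \<le> (\<integral>\<^sup>+x. ennreal (2 powr p) * (abs_powr (v j x - w i0 x) p
        + abs_powr (v i0 x - w i0 x) p) \<partial>m)"
  proof (rule nn_integral_mono)
    fix x
    have "ennreal \<bar>v j x - v i0 x\<bar> \<le> ennreal \<bar>v j x - w i0 x\<bar> + ennreal \<bar>v i0 x - w i0 x\<bar>"
      by (simp add: ennreal_plus[symmetric] ennreal_leI del: ennreal_plus)
    then show "abs_powr (v j x - v i0 x) p \<le> ennreal (2 powr p) *
       (abs_powr (v j x - w i0 x) p + abs_powr (v i0 x - w i0 x) p)"
      using p by (intro order_trans[OF ennreal_powr_mono ennreal_powr_add_le]) auto
  qed
  also have "\<dots> = ennreal (2 powr p) * ((Lp_mass m p (\<lambda>x. v j x - w i0 x))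
        + (Lp_mass m p (\<lambda>x. v i0 x - w i0 x)))"
    by (simp add: nn_integral_cmult nn_integral_add)
  also have "\<dots> \<le> ennreal (2 powr p) * (ennreal (e powr p) + ennreal (e powr p))"
    using small[OF j(1)] small[OF i0(1)] j(2) by (intro mult_left_mono add_mono) auto
  also have "\<dots> = ennreal (1 / 2)"
    unfolding e(2) by (simp add: ennreal_plus[symmetric] ennreal_mult[symmetric] del: ennreal_plus)
  finally have "ennreal 1 \<le> ennreal (1 / 2)" unfolding ennreal_1 .
  then show False by (subst (asm) ennreal_le_iff) auto
qed

text \<open>The supports \<open>B\<^sub>d(x, C\<^sub>d \<delta>)\<close> are just large enough to leave a gap: if \<open>d x z \<ge> C\<^sub>d \<delta>\<close> and
  \<open>d x a < \<delta>\<close>, then \<open>d a z \<ge> \<delta>\<close>. Thus a single use of doubling compares support and plateau,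
  also in the ultrametric case \<open>C\<^sub>d = 1\<close>, where iterating the doubling condition would give nothing.\<close>

lemma totally_bounded_if_compact_embedding:
  fixes d :: "'a \<Rightarrow> 'a \<Rightarrow> real"
  assumes qmm: "quasi_metric_measure_space d \<mu>"
    and \<delta>0: "0 < \<delta>0" "\<And>\<delta>. \<delta> \<in> {0<..\<delta>0} \<Longrightarrow> doubling d \<mu> (qm_const (space \<mu>) d) \<delta>"
    and pq: "0 < \<alpha>" "0 < p" "0 < q"
    and index: "preceq_index \<alpha> q (space \<mu>) d"
    and n1: "n1 = hajlasz_TL_norm d \<alpha> p q \<or> n1 = hajlasz_Besov_norm d \<alpha> p q"
    and n2: "\<And>u. Lp_norm \<mu> p (\<lambda>x. ennreal \<bar>u x\<bar>) \<le> n2 \<mu> u"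
    and ce: "compact_embedding \<mu> n1 \<mu> n2"
  shows "qm_totally_bounded (space \<mu>) d"
proof (rule ccontr)
  assume "\<not> qm_totally_bounded (space \<mu>) d"
  then obtain \<epsilon> where \<epsilon>: "0 < \<epsilon>" "\<And>F. finite F \<Longrightarrow> F \<subseteq> space \<mu> \<Longrightarrow> \<not> space \<mu> \<subseteq> (\<Union>x\<in>F. qm_ball (space \<mu>) d x \<epsilon>)"
    unfolding qm_totally_bounded_def by auto
  let ?X = "space \<mu>" and ?B = "qm_ball (space \<mu>) d" and ?C = "qm_const (space \<mu>) d"
  have qm: "quasi_metric ?X d"
    and ball: "\<And>x r. x \<in> ?X \<Longrightarrow> 0 < r \<Longrightarrow> ?B x r \<in> sets \<mu>"
      "\<And>x r. x \<in> ?X \<Longrightarrow> 0 < r \<Longrightarrow> 0 < emeasure \<mu> (?B x r)"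
      "\<And>x r. x \<in> ?X \<Longrightarrow> 0 < r \<Longrightarrow> emeasure \<mu> (?B x r) < top"
    using qmm by (auto simp: quasi_metric_measure_space_def)
  have C: "1 \<le> ?C" "\<And>x y z. x \<in> ?X \<Longrightarrow> y \<in> ?X \<Longrightarrow> z \<in> ?X \<Longrightarrow> d x y \<le> ?C * max (d x z) (d z y)"
    using qm_const_bounds[OF qm] by auto
  obtain K where "qm_constant ?X d K"
    using ex_qm_constant[OF qm] ..
  note K = qm_constantD[OF this]
  obtain S t where S: "0 < t" "S \<subseteq> ?X" "\<forall>x\<in>S. \<forall>y\<in>S. x \<noteq> y \<longrightarrow> t \<le> d x y" "?X \<subseteq> (\<Union>z\<in>S. ?B z \<epsilon>)"
    using ex_maximal_separated[OF qm \<epsilon>(1)] by (elim exE conjE)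
  have inf: "infinite S" using \<epsilon>(2) S by blast
  obtain r where r: "0 < r" "\<And>x y. x \<in> ?X \<Longrightarrow> y \<in> ?X \<Longrightarrow> t \<le> d x y \<Longrightarrow> ?B x r \<inter> ?B y r = {}"
    using ball_inter_empty[OF qm S(1)] by auto
  define \<delta> where "\<delta> = min \<delta>0 (r / ?C)"
  have \<delta>: "0 < \<delta>" "\<delta> \<in> {0<..\<delta>0}" "?C * \<delta> \<le> r" "\<delta> \<le> ?C * \<delta>"
  proof -
    show 0: "0 < \<delta>" "\<delta> \<in> {0<..\<delta>0}" using \<delta>0 r C(1) by (auto simp: \<delta>_def)
    have "\<delta> \<le> r / ?C" by (simp add: \<delta>_def)
    then show "?C * \<delta> \<le> r" using C(1) by (simp add: field_simps)
    show "\<delta> \<le> ?C * \<delta>" using mult_right_mono[OF C(1), of \<delta>] 0 by simp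
  qed
  obtain c where c: "1 \<le> c" "\<And>x. x \<in> ?X \<Longrightarrow> emeasure \<mu> (?B x (?C * \<delta>)) \<le> ennreal c * emeasure \<mu> (?B x \<delta>)"
    using \<delta>0(2)[OF \<delta>(2)] unfolding doubling_def by auto
  obtain \<rho> \<gamma> where \<rho>: "quasi_metric ?X \<rho>" "qm_equivalent ?X \<rho> d" and \<gamma>: "\<alpha> \<le> \<gamma>" "\<alpha> < \<gamma> \<or> q = top" "qm_const ?X \<rho> powr \<gamma> \<le> 2"
    using ex_exponent_of_index[OF index pq(1)] by auto
  have \<gamma>0: "0 < \<gamma>" using \<gamma>(1) pq(1) by simp
  have tK: "0 < \<delta> / K" using \<delta> K(1) by simp
  obtain L where L: "0 \<le> L" "\<And>A B. A \<subseteq> ?X \<Longrightarrow> A \<noteq> {} \<Longrightarrow> (\<forall>z\<in>?X - B. \<forall>a\<in>A. \<delta> / K \<le> d z a) \<Longrightarrow>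
     \<exists>u. (\<forall>x\<in>?X. 0 \<le> u x \<and> u x \<le> 1) \<and> (\<forall>a\<in>A. u a = 1) \<and> (\<forall>z\<in>?X - B. u z = 0) \<and>
          (\<forall>x\<in>?X. \<forall>y\<in>?X. \<bar>u x - u y\<bar> \<le> L * d x y powr \<gamma>)"
    using ex_holder_bump[OF qm \<rho> \<gamma>0 \<gamma>(3) tK] by auto
  define A where "A = (\<lambda>x. ?B x \<delta>)"
  define B where "B = (\<lambda>x. ?B x (?C * \<delta>))"
  have AB: "A x \<subseteq> B x" for x using \<delta>(4) by (auto simp: A_def B_def qm_ball_def)
  have "\<exists>u. (\<forall>y\<in>?X. 0 \<le> u y \<and> u y \<le> 1) \<and> (\<forall>a\<in>A x. u a = 1) \<and> (\<forall>z\<in>?X - B x. u z = 0) \<and>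
          (\<forall>y\<in>?X. \<forall>z\<in>?X. \<bar>u y - u z\<bar> \<le> L * d y z powr \<gamma>)" if x: "x \<in> S" for x
  proof (rule L(2))
    have xX: "x \<in> ?X" using x S(2) by auto
    show "A x \<subseteq> ?X" by (auto simp: A_def qm_ball_def)
    show "A x \<noteq> {}" using ball(2)[OF xX \<delta>(1)] by (auto simp: A_def)
    show "\<forall>z\<in>?X - B x. \<forall>a\<in>A x. \<delta> / K \<le> d z a"
    proof (intro ballI)
      fix z a assume z: "z \<in> ?X - B x" and a: "a \<in> A x"
      then have za: "z \<in> ?X" "a \<in> ?X" "?C * \<delta> \<le> d x z" "d x a < \<delta>" by (auto simp: A_def B_def qm_ball_def)
      have "?C * \<delta> \<le> ?C * max (d x a) (d a z)" using za(3) C(2)[OF xX za(1,2)] by simp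
      then have "\<delta> \<le> max (d x a) (d a z)" using C(1) by simp
      then have "\<delta> \<le> d a z" using za(4) by (simp add: le_max_iff_disj)
      also have "\<dots> \<le> K * d z a" using K(2) za by blast
      finally show "\<delta> / K \<le> d z a" using K(1) by (simp add: pos_divide_le_eq mult.commute)
    qed
  qed
  then have "\<forall>x\<in>S. \<exists>u. (\<forall>y\<in>?X. 0 \<le> u y \<and> u y \<le> 1) \<and> (\<forall>a\<in>A x. u a = 1) \<and> (\<forall>z\<in>?X - B x. u z = 0) \<and>
          (\<forall>y\<in>?X. \<forall>z\<in>?X. \<bar>u y - u z\<bar> \<le> L * d y z powr \<gamma>)" by (rule ballI)
  from bchoice[OF this] obtain u where "\<forall>x\<in>S. (\<forall>y\<in>?X. 0 \<le> u x y \<and> u x y \<le> 1) \<and> (\<forall>a\<in>A x. u x a = 1) \<and>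
          (\<forall>z\<in>?X - B x. u x z = 0) \<and> (\<forall>y\<in>?X. \<forall>z\<in>?X. \<bar>u x y - u x z\<bar> \<le> L * d y z powr \<gamma>)"
    by (elim exE)
  then have u: "\<And>x y. x \<in> S \<Longrightarrow> y \<in> ?X \<Longrightarrow> 0 \<le> u x y \<and> u x y \<le> 1" "\<And>x a. x \<in> S \<Longrightarrow> a \<in> A x \<Longrightarrow> u x a = 1"
      "\<And>x z. x \<in> S \<Longrightarrow> z \<in> ?X - B x \<Longrightarrow> u x z = 0"
      "\<And>x y z. x \<in> S \<Longrightarrow> y \<in> ?X \<Longrightarrow> z \<in> ?X \<Longrightarrow> \<bar>u x y - u x z\<bar> \<le> L * d y z powr \<gamma>" by auto
  have um: "u x \<in> borel_measurable \<mu>" if "x \<in> S" for x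
    using u(4)[OF that] by (rule holder_imp_measurable[OF qmm \<gamma>0 L(1)])
  define m where "m = (\<lambda>x. measure \<mu> (A x))"
  have mA: "emeasure \<mu> (A x) = ennreal (m x)" "0 < m x" if "x \<in> S" for x
  proof -
    have x: "x \<in> ?X" using that S(2) by auto
    show e: "emeasure \<mu> (A x) = ennreal (m x)"
      unfolding m_def A_def using ball(3)[OF x \<delta>(1)] by (intro emeasure_eq_ennreal_measure) auto
    show "0 < m x" using ball(2)[OF x \<delta>(1)] e by (simp add: A_def)
  qed
  define s where "s = (\<lambda>x. m x powr (- 1 / p))"
  define v where "v = (\<lambda>x y. s x * u x y)"
  have s0: "0 \<le> s x" for x by (simp add: s_def)
  have Bs: "B x \<in> sets \<mu>" if "x \<in> S" for x
    unfolding B_def using that S(2) \<delta> C(1) by (intro ball) auto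
  have sB: "ennreal (s x) * ennreal_powr (emeasure \<mu> (B x)) (1 / p) \<le> ennreal (c powr (1 / p))" if x: "x \<in> S" for x
  proof -
    have "emeasure \<mu> (B x) \<le> ennreal (c * m x)"
      using c(2)[of x] x S(2) mA[OF x] c(1) by (auto simp: B_def A_def ennreal_mult)
    then have "ennreal_powr (emeasure \<mu> (B x)) (1 / p) \<le> ennreal_powr (ennreal (c * m x)) (1 / p)"
      using pq(2) by (intro ennreal_powr_mono) auto
    also have "\<dots> = ennreal (c powr (1 / p) * m x powr (1 / p))"
      using c(1) mA(2)[OF x] by (simp add: ennreal_powr_ennreal powr_mult)
    finally have "ennreal (s x) * ennreal_powr (emeasure \<mu> (B x)) (1 / p)
        \<le> ennreal (s x) * ennreal (c powr (1 / p) * m x powr (1 / p))" by (rule mult_left_mono) simp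
    also have "\<dots> = ennreal (c powr (1 / p) * (m x powr (- 1 / p) * m x powr (1 / p)))"
      by (simp add: s_def ennreal_mult[symmetric] mult_ac)
    also have "m x powr (- 1 / p) * m x powr (1 / p) = 1"
      using mA(2)[OF x] by (simp add: powr_add[symmetric])
    finally show ?thesis by simp
  qed
  define R where "R = (1 + lq_norm q (\<lambda>k. ennreal (geometric_weight \<alpha> (\<gamma> - \<alpha>) k)) * ennreal (2 powr \<alpha> + L))
     * ennreal (c powr (1 / p))"
  have "lq_norm q (\<lambda>k. ennreal (geometric_weight \<alpha> (\<gamma> - \<alpha>) k)) < top"
    using \<gamma> pq by (intro lq_norm_geometric_weight) auto
  then have "R < top"
    unfolding R_def by (intro ennreal_mult_less_topI iffD2[OF ennreal_add_less_top] conjI) auto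
  then obtain R' where R': "R = ennreal R'" by (rule ennreal_less_topE)
  have norm: "n1 \<mu> (v x) \<le> ennreal R'" if x: "x \<in> S" for x
  proof -
    have "n1 \<mu> (v x) \<le> (1 + lq_norm q (\<lambda>k. ennreal (geometric_weight \<alpha> (\<gamma> - \<alpha>) k)) * ennreal (2 powr \<alpha> + L))
      * (ennreal (s x) * ennreal_powr (emeasure \<mu> (B x)) (1 / p))"
      using n1 bump_norm_le[OF qm pq(2,3,1) \<gamma>(1,2) um[OF x] u(1)[OF x] Bs[OF x] u(3)[OF x] L(1) u(4)[OF x] s0]
      unfolding v_def by auto
    also have "\<dots> \<le> R" unfolding R_def using sB[OF x] by (rule mult_left_mono) simp
    finally show ?thesis using R' by simp
  qed
  have sep: "1 \<le> Lp_mass \<mu> p (\<lambda>z. v x z - v y z)" if xy: "x \<in> S" "y \<in> S" "x \<noteq> y" for x y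
  proof -
    have X: "x \<in> ?X" "y \<in> ?X" using xy S(2) by auto
    have "?B x r \<inter> ?B y r = {}" using r(2)[OF X] S(3) xy by auto
    then have disj: "A x \<inter> B y = {}"
      using \<delta>(3) AB[of x] by (fastforce simp: B_def qm_ball_def)
    have Am: "A x \<in> sets \<mu>" unfolding A_def using ball(1)[OF X(1) \<delta>(1)] .
    have "1 = ennreal (1 / m x) * emeasure \<mu> (A x)"
      using mA[OF xy(1)] by (simp add: ennreal_mult[symmetric])
    also have "\<dots> = (\<integral>\<^sup>+z\<in>A x. ennreal (1 / m x) \<partial>\<mu>)" using Am by (simp add: nn_integral_cmult_indicator)
    also have "\<dots> \<le> Lp_mass \<mu> p (\<lambda>z. v x z - v y z)"
    proof (rule nn_integral_mono)
      fix z assume z: "z \<in> ?X"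
      have "ennreal (1 / m x) = abs_powr (v x z - v y z) p" if zA: "z \<in> A x"
      proof -
        have "u y z = 0" using u(3)[OF xy(2), of z] z zA disj by auto
        then have "\<bar>v x z - v y z\<bar> = s x" using u(2)[OF xy(1) zA] s0[of x] by (simp add: v_def)
        moreover have "s x powr p = m x powr (- 1)"
          using pq(2) by (simp add: s_def powr_powr)
        then have "s x powr p = 1 / m x"
          using mA(2)[OF xy(1)] by (simp add: powr_minus_divide)
        ultimately show ?thesis using s0[of x] by (simp add: ennreal_powr_ennreal)
      qed
      then show "ennreal (1 / m x) * indicator (A x) z \<le> abs_powr (v x z - v y z) p"
        by (auto split: split_indicator)
    qed
    finally show ?thesis .
  qed
  have vm: "v x \<in> borel_measurable \<mu>" if "x \<in> S" for x
    unfolding v_def using um[OF that] by simp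
  show False
    using no_compact_embedding_if_separated[where v=v and ?n1.0=n1 and ?n2.0=n2, OF pq(2) inf vm sep norm n2] ce
    by (rule notE)
qed

theorem corollary7p5:
  fixes d :: "'a \<Rightarrow> 'a \<Rightarrow> real" and \<mu> :: "'a measure"
  assumes "quasi_metric_measure_space d \<mu>"
  shows
    "(\<forall>\<nu> :: 'a measure.
       sets \<nu> = sets \<mu> \<and>
       (\<exists>C>0. \<forall>A\<in>sets \<mu>. emeasure \<nu> A \<le> ennreal C * emeasure \<mu> A) \<and>
       (\<exists>\<rho> r0 x0.
          quasi_metric (space \<mu>) \<rho> \<and>
          (\<forall>x\<in>space \<mu>. \<forall>y\<in>space \<mu>. \<rho> x y = \<rho> y x) \<and>
          qm_equivalent (space \<mu>) \<rho> d \<and>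
          continuous_map (prod_topology (qm_topology (space \<mu>) d) (qm_topology (space \<mu>) d))
            euclideanreal (\<lambda>(x, y). \<rho> x y) \<and>
          0 < r0 \<and> x0 \<in> space \<mu> \<and>
          (\<forall>r\<in>{0<..r0}.
             equi_integrable \<nu>
               ((\<lambda>y x. indicator (qm_ball (space \<mu>) \<rho> y r) x / measure \<mu> (qm_ball (space \<mu>) \<rho> x r))
                  ` space \<mu>) \<and>
             ((\<lambda>R. SUP y \<in> space \<mu> - qm_ball (space \<mu>) \<rho> x0 R.
                 \<integral>\<^sup>+x\<in>qm_ball (space \<mu>) \<rho> y r.
                   ennreal (1 / measure \<mu> (qm_ball (space \<mu>) \<rho> x r)) \<partial>\<nu>)
               \<longlongrightarrow> 0) at_top))
       \<longrightarrow> (\<forall>(\<alpha>::real) (p::real) (q::ennreal) (r::ennreal) (\<beta>::real).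
             0 < \<alpha> \<and> 0 < p \<and> 0 < q \<and> 0 < r \<and> 0 < \<beta> \<and> \<beta> < \<alpha> \<longrightarrow>
             compact_embedding \<mu> (hajlasz_TL_norm d \<alpha> p q) \<nu> (hajlasz_TL_norm d \<beta> p r) \<and>
             compact_embedding \<mu> (hajlasz_TL_norm d \<alpha> p q) \<nu> (hajlasz_Besov_norm d \<beta> p r) \<and>
             compact_embedding \<mu> (hajlasz_Besov_norm d \<alpha> p q) \<nu> (hajlasz_TL_norm d \<beta> p r) \<and>
             compact_embedding \<mu> (hajlasz_Besov_norm d \<alpha> p q) \<nu> (hajlasz_Besov_norm d \<beta> p r))) \<and>
     (\<forall>\<nu> :: 'a measure.
       sets \<nu> = sets \<mu> \<and>
       (\<exists>C>0. \<forall>A\<in>sets \<mu>. emeasure \<nu> A \<le> ennreal C * emeasure \<mu> A) \<and>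
       qm_totally_bounded (space \<mu>) d
       \<longrightarrow> (\<forall>(\<alpha>::real) (p::real) (q::ennreal) (r::ennreal) (\<beta>::real).
             0 < \<alpha> \<and> 0 < p \<and> 0 < q \<and> 0 < r \<and> 0 < \<beta> \<and> \<beta> < \<alpha> \<longrightarrow>
             compact_embedding \<mu> (hajlasz_TL_norm d \<alpha> p q) \<nu> (hajlasz_TL_norm d \<beta> p r) \<and>
             compact_embedding \<mu> (hajlasz_TL_norm d \<alpha> p q) \<nu> (hajlasz_Besov_norm d \<beta> p r) \<and>
             compact_embedding \<mu> (hajlasz_Besov_norm d \<alpha> p q) \<nu> (hajlasz_TL_norm d \<beta> p r) \<and>
             compact_embedding \<mu> (hajlasz_Besov_norm d \<alpha> p q) \<nu> (hajlasz_Besov_norm d \<beta> p r))) \<and>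
     ((\<exists>\<delta>0>0. \<forall>\<delta>\<in>{0<..\<delta>0}. doubling d \<mu> (qm_const (space \<mu>) d) \<delta>) \<and>
     (\<exists>(\<alpha>::real) (p::real) (q::ennreal) (r::ennreal) (\<beta>::real).
        0 < \<alpha> \<and> 0 < p \<and> 0 < q \<and> 0 < r \<and> 0 < \<beta> \<and> preceq_index \<alpha> q (space \<mu>) d \<and>
        (compact_embedding \<mu> (hajlasz_TL_norm d \<alpha> p q) \<mu> (hajlasz_TL_norm d \<beta> p r) \<or>
         compact_embedding \<mu> (hajlasz_TL_norm d \<alpha> p q) \<mu> (hajlasz_Besov_norm d \<beta> p r) \<or>
         compact_embedding \<mu> (hajlasz_Besov_norm d \<alpha> p q) \<mu> (hajlasz_TL_norm d \<beta> p r) \<or>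
         compact_embedding \<mu> (hajlasz_Besov_norm d \<alpha> p q) \<mu> (hajlasz_Besov_norm d \<beta> p r)))
     \<longrightarrow> qm_totally_bounded (space \<mu>) d)"
proof (rule conjI[OF _ conjI], goal_cases)
  have qm: "quasi_metric (space \<mu>) d"
    using assms by (simp add: quasi_metric_measure_space_def)
  {
    case 1
    show ?case
    proof (intro allI impI, goal_cases)
      case (1 \<nu> \<alpha> p q r \<beta>)
      from 1(1) have sets: "sets \<nu> = sets \<mu>" by (elim conjE)
      from 1(1) obtain C where C: "0 < C" "\<forall>A\<in>sets \<mu>. emeasure \<nu> A \<le> ennreal C * emeasure \<mu> A"
        by (elim conjE exE)
      from 1(1) obtain \<rho> r0 x0 where \<rho>: "quasi_metric (space \<mu>) \<rho>"
          "\<forall>x\<in>space \<mu>. \<forall>y\<in>space \<mu>. \<rho> x y = \<rho> y x" "qm_equivalent (space \<mu>) \<rho> d"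
          "continuous_map (prod_topology (qm_topology (space \<mu>) d) (qm_topology (space \<mu>) d))
            euclideanreal (\<lambda>(x, y). \<rho> x y)"
        and r0: "0 < r0" and x0: "x0 \<in> space \<mu>"
        and kernel: "\<forall>r\<in>{0<..r0}.
             equi_integrable \<nu>
               ((\<lambda>y x. indicator (qm_ball (space \<mu>) \<rho> y r) x / measure \<mu> (qm_ball (space \<mu>) \<rho> x r))
                  ` space \<mu>) \<and>
             ((\<lambda>R. SUP y \<in> space \<mu> - qm_ball (space \<mu>) \<rho> x0 R.
                 \<integral>\<^sup>+x\<in>qm_ball (space \<mu>) \<rho> y r.
                   ennreal (1 / measure \<mu> (qm_ball (space \<mu>) \<rho> x r)) \<partial>\<nu>)
               \<longlongrightarrow> 0) at_top"
        by (elim conjE exE)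
      from 1(2) have pq: "0 < p" "0 < \<alpha>" "0 < q" "0 < r" "0 < \<beta>" "\<beta> < \<alpha>" by auto
      have "uniformly_tight_cells d \<mu> \<nu> \<alpha> p"
        using kernel \<rho>(2)
        by (intro tight_if_kernel_condition[OF assms sets C \<rho>(1) _ \<rho>(3,4) r0 x0 _ _ pq(1,2)]) auto
      then show ?case
        by (intro conjI compact_embeddings_if_tight[OF sets C qm pq])
    qed
  next
    case 2
    show ?case
    proof (intro allI impI, goal_cases)
      case (1 \<nu> \<alpha> p q r \<beta>)
      from 1(1) have sets: "sets \<nu> = sets \<mu>" by (elim conjE)
      from 1(1) obtain C where C: "0 < C" "\<forall>A\<in>sets \<mu>. emeasure \<nu> A \<le> ennreal C * emeasure \<mu> A"
        by (elim conjE exE)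
      from 1(1) have "qm_totally_bounded (space \<mu>) d" by (elim conjE)
      then have "uniformly_tight_cells d \<mu> \<nu> \<alpha> p" by (rule tight_if_totally_bounded[OF assms])
      moreover from 1(2) have pq: "0 < p" "0 < \<alpha>" "0 < q" "0 < r" "0 < \<beta>" "\<beta> < \<alpha>" by auto
      ultimately show ?case
        by (intro conjI compact_embeddings_if_tight[OF sets C qm pq])
    qed
  next
    case 3
    show ?case
    proof (intro impI, elim conjE exE, goal_cases)
      case (1 \<delta>0 \<alpha> p q r \<beta>)
      have "Lp_norm \<mu> p (\<lambda>x. ennreal \<bar>u x\<bar>) \<le> hajlasz_TL_norm d \<beta> p r \<mu> u"
        "Lp_norm \<mu> p (\<lambda>x. ennreal \<bar>u x\<bar>) \<le> hajlasz_Besov_norm d \<beta> p r \<mu> u" for u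
        by (simp_all add: hajlasz_TL_norm_def hajlasz_Besov_norm_def)
      with 1 show ?case
        using totally_bounded_if_compact_embedding[OF assms, of \<delta>0 \<alpha> p q] by metis
    qed
  }
qed

end
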